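(* There exists a holomorphic endomorphism of $\mathbb{P}^2$ (of degree at least $2$) which has a proper attractor containing an algebraic curve in its interior.
   Context: An attracting set of $f$ is a compact set $A=\bigcap_{n\ge0}f^n(U)$ where $U\subset\mathbb{P}^2$ is open with $\overline{f(U)}\subset U$; it is proper if $A\neq\mathbb{P}^2$. An attractor is an attracting set $A$ on which $f_{|A}$ is topologically transitive. *)

theory Defs
  imports "HOL-Analysis.Analysis"
begin

type_synonym c3 = "complex \<times> complex \<times> complex"

definition smult3 :: "complex \<Rightarrow> c3 \<Rightarrow> c3" where
  "smult3 c v = (c * fst v, c * fst (snd v), c * snd (snd v))"

definition cline :: "c3 \<Rightarrow> c3 set" where
  "cline v = {smult3 c v | c. c \<noteq> 0}"

typedef cp2 = "{S. \<exists>v. v \<noteq> 0 \<and> S = cline v}"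
  apply (rule exI[of _ "cline (1,0,0)"])
  apply (rule CollectI)
  apply (rule exI[of _ "(1,0,0)"])
  by (simp add: zero_prod_def)

definition proj :: "c3 \<Rightarrow> cp2" where
  "proj v = Abs_cp2 (cline v)"

instantiation cp2 :: topological_space
begin
definition open_cp2 :: "cp2 set \<Rightarrow> bool" where
  "open_cp2 U = open {v :: c3. v \<noteq> 0 \<and> proj v \<in> U}"
instance
proof
  have e: "{v :: c3. v \<noteq> 0 \<and> proj v \<in> UNIV} = UNIV - {0}" by auto
  have "open (UNIV - {0::c3})" by (rule open_Diff[OF open_UNIV closed_singleton])
  then show "open (UNIV :: cp2 set)"
    unfolding open_cp2_def by (simp only: e)
next
  fix S T :: "cp2 set"
  assume "open S" "open T"
  then have "open ({v :: c3. v \<noteq> 0 \<and> proj v \<in> S} \<inter> {v. v \<noteq> 0 \<and> proj v \<in> T})"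
    unfolding open_cp2_def by (rule open_Int)
  moreover have "{v :: c3. v \<noteq> 0 \<and> proj v \<in> S} \<inter> {v. v \<noteq> 0 \<and> proj v \<in> T}
      = {v. v \<noteq> 0 \<and> proj v \<in> S \<inter> T}" by auto
  ultimately show "open (S \<inter> T)" unfolding open_cp2_def by simp
next
  fix K :: "cp2 set set"
  assume "\<forall>S\<in>K. open S"
  then have "open (\<Union>S\<in>K. {v :: c3. v \<noteq> 0 \<and> proj v \<in> S})"
    unfolding open_cp2_def by auto
  moreover have "(\<Union>S\<in>K. {v :: c3. v \<noteq> 0 \<and> proj v \<in> S}) = {v. v \<noteq> 0 \<and> proj v \<in> \<Union>K}"
    by auto
  ultimately show "open (\<Union>K)" unfolding open_cp2_def by simp
qed
end

text \<open>A homogeneous polynomial of degree d is given by its coefficient family on the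
  monomials x^i y^j z^k with i+j+k = d.\<close>

definition hmonos :: "nat \<Rightarrow> (nat \<times> nat \<times> nat) set" where
  "hmonos d = {(i, j, k). i + j + k = d}"

definition heval :: "nat \<Rightarrow> (nat \<times> nat \<times> nat \<Rightarrow> complex) \<Rightarrow> c3 \<Rightarrow> complex" where
  "heval d a v = (\<Sum>m\<in>hmonos d. case m of (i, j, k) \<Rightarrow>
      a (i, j, k) * fst v ^ i * fst (snd v) ^ j * snd (snd v) ^ k)"

definition holo_endo_deg :: "nat \<Rightarrow> (cp2 \<Rightarrow> cp2) \<Rightarrow> bool" where
  "holo_endo_deg d f \<longleftrightarrow>
     (\<exists>F0 F1 F2. \<forall>v. v \<noteq> 0 \<longrightarrow>
        (heval d F0 v, heval d F1 v, heval d F2 v) \<noteq> 0 \<and>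
        f (proj v) = proj (heval d F0 v, heval d F1 v, heval d F2 v))"

definition algebraic_curve :: "cp2 set \<Rightarrow> bool" where
  "algebraic_curve C \<longleftrightarrow>
     (\<exists>d P. d \<ge> 1 \<and> (\<exists>m\<in>hmonos d. P m \<noteq> 0) \<and>
        C = {proj v | v. v \<noteq> 0 \<and> heval d P v = 0})"

definition attracting_set :: "(cp2 \<Rightarrow> cp2) \<Rightarrow> cp2 set \<Rightarrow> bool" where
  "attracting_set f A \<longleftrightarrow> compact A \<and>
     (\<exists>U. open U \<and> closure (f ` U) \<subseteq> U \<and> A = (\<Inter>n. (f ^^ n) ` U))"

definition topologically_transitive_on :: "cp2 set \<Rightarrow> (cp2 \<Rightarrow> cp2) \<Rightarrow> bool" where
  "topologically_transitive_on A f \<longleftrightarrow>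
     (\<forall>U V. openin (top_of_set A) U \<longrightarrow> openin (top_of_set A) V \<longrightarrow> U \<noteq> {} \<longrightarrow> V \<noteq> {} \<longrightarrow>
        (\<exists>n. (f ^^ n) ` U \<inter> V \<noteq> {}))"

definition attractor :: "(cp2 \<Rightarrow> cp2) \<Rightarrow> cp2 set \<Rightarrow> bool" where
  "attractor f A \<longleftrightarrow> attracting_set f A \<and> topologically_transitive_on A f"

end

theory Submission
  imports Defs "HOL-Complex_Analysis.Complex_Analysis"
    "HOL-Computational_Algebra.Fundamental_Theorem_Algebra"
begin

text \<open>
  Put \<open>u = y + \<i> x\<close>, \<open>w = y - \<i> x\<close> and consider \<open>[x : y : t] \<mapsto> [u\<^sup>k : w\<^sup>k : c(x,y) T + \<delta> T\<^sup>k]\<close>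
  with \<open>T = t + 7u/10\<close> and \<open>c = 7/10 w\<^bsup>11\<^esup> (w\<^bsup>k-12\<^esup> + u\<^bsup>k-12\<^esup>)\<close>, where \<open>k = 12 l\<close> is large and \<open>\<delta>\<close> is tiny.
  It preserves the pencil of lines through \<open>[0 : 0 : 1]\<close> and is a uniform contraction on the fibres of
  the disc bundle \<open>|t| < 300 |(x,y)|\<close>, which it maps well inside itself; this gives the attracting set \<open>A\<close>.

  Over a point of the base, twelve of the \<open>k\<close> preimages \<open>u/w\<close> are the vertices of a regular dodecagon
  with a common multiplier, so the images of the twelve unit discs overlap and cover the unit disc
  above that point, even without the discs lying over a neighbourhood of the two critical values
  \<open>[0 : 1]\<close> and \<open>[1 : 0]\<close>. Hence, away from these values, the unit disc bundle is contained in its own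
  image, so in \<open>A\<close>; one more iteration produces a neighbourhood of the line \<open>t = 0\<close>.

  The map induced on the base is postcritically finite: both critical points are sent to the repelling
  fixed point \<open>1\<close> after two steps. A Montel argument shows that it is topologically transitive, and since
  fibres are contracted, transitivity lifts to \<open>A\<close>.
\<close>

section \<open>Families omitting two values\<close>

text \<open>The obstacle: every fibre map contracts, yet the images of discs have to fill discs, so
  several preimages of a base point must share the work, with image discs of comparable size and
  different centres. The shift \<open>7u/10\<close> separates the centres. The exponents in
  \<open>c\<close> equalise the sizes: if \<open>z = u/w\<close> and \<open>z^k = \<zeta>\<close>,
  then \<open>c\<close> is \<open>7/10 (1 + z^(k-12))\<close> up to the factor
  \<open>w^(k-1)\<close>, and \<open>z^(k-12) = \<zeta> / z^12\<close> is the same for all twelve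
  \<open>z\<close> with the same twelfth power. A large \<open>k\<close> forces \<open>z\<close>
  close to the unit circle as long as \<zeta> stays away from \<open>0\<close> and infinity; near
  these values the dodecagon degenerates, which is why they are cut out. The term
  \<open>\<delta> T^k\<close> keeps the map defined at \<open>[0 : 0 : 1]\<close> and takes over
  near the critical values, where the slope has no useful lower bound. The Cayley coordinates
  \<open>u\<close>, \<open>w\<close> ensure that the critical values \<open>0\<close> and infinity
  are not fixed, as for a pure power map, but move on to \<open>1\<close>; since \<open>4\<close>
  divides \<open>k\<close>, the point \<open>1\<close> is fixed.\<close>

lemma Schottky_cball:
  assumes "f holomorphic_on cball a (2*d)" "0 < d" "norm (f a) \<le> B"
    and "\<And>z. z \<in> cball a (2*d) \<Longrightarrow> f z \<noteq> 0 \<and> f z \<noteq> 1"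
    and "x \<in> cball a d"
  shows "norm (f x) \<le> exp(pi * exp(pi * (2 + 2 * B + 12)))"
proof -
  define g where "g = (\<lambda>z. f (a + of_real (2*d) * z))"
  have sub: "a + of_real (2*d) * z \<in> cball a (2*d)" if "z \<in> cball 0 1" for z
  proof -
    have "dist a (a + of_real (2*d) * z) = 2*d * norm z"
      using assms(2) by (simp add: dist_norm norm_mult)
    also have "\<dots> \<le> 2*d" using that assms(2) by (simp add: mult_left_le)
    finally show ?thesis by simp
  qed
  have hol: "g holomorphic_on cball 0 1"
    unfolding g_def
    by (rule holomorphic_on_compose_gen[of _ _ f "cball a (2*d)", unfolded o_def])
       (use assms(1) sub in \<open>auto intro!: holomorphic_intros\<close>)
  define z where "z = (x - a) / of_real (2*d)"
  have nz: "norm z \<le> 1/2"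
    using assms(2,5) by (simp add: z_def norm_divide dist_norm norm_minus_commute field_simps)
  have gz: "g z = f x" using assms(2) by (simp add: g_def z_def)
  \<comment> \<open>Schottky's bound on the disc of half the radius: at \<open>t = 1/2\<close> the
    factor \<open>t / (1 - t)\<close> is \<open>1\<close>, hence the \<open>12\<close> in the
    statement.\<close>
  have "norm (g z) \<le> exp(pi * exp(pi * (2 + 2 * B + 12 * (1/2) / (1 - 1/2))))"
    by (rule Schottky[OF hol]) (use assms sub nz in \<open>auto simp: g_def\<close>)
  then show ?thesis by (simp add: gz)
qed

text \<open>A bound at one point near \<open>y\<close>, which may move with \<open>j\<close>,
  replaces the usual local bound: Schottky's theorem carries bounds from the centre of a disc to
  nearby points, so the set of points with bounded values is open and closed in the connected set
  \<open>G\<close>. In the applications the moving points are orbit points, where the values of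
  inverse branches are known.\<close>

lemma Montel_omitting_0_1:
  fixes a :: "nat \<Rightarrow> complex \<Rightarrow> complex"
  assumes G: "open G" "connected G" and hol: "\<And>j. a j holomorphic_on G"
    and om: "\<And>j z. z \<in> G \<Longrightarrow> a j z \<noteq> 0 \<and> a j z \<noteq> 1"
    and p: "p \<longlonglongrightarrow> y" "y \<in> G" "\<And>j. norm (a j (p j)) \<le> B"
  obtains g r where "g holomorphic_on G" "strict_mono (r :: nat \<Rightarrow> nat)"
    "\<And>x. x \<in> G \<Longrightarrow> (\<lambda>n. a (r n) x) \<longlonglongrightarrow> g x"
    "\<And>K. \<lbrakk>compact K; K \<subseteq> G\<rbrakk> \<Longrightarrow> uniform_limit K (a \<circ> r) g sequentially"
proof -
  have loc: "\<exists>C. \<forall>j\<in>J. \<forall>x\<in>cball z d. norm (a j x) \<le> C"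
    if "cball z (2*d) \<subseteq> G" "d > 0" "\<And>j. j \<in> J \<Longrightarrow> norm (a j z) \<le> C'" for z d C' J
  proof (intro exI ballI)
    fix j x assume "j \<in> J" "x \<in> cball z d"
    then show "norm (a j x) \<le> exp(pi * exp(pi * (2 + 2 * C' + 12)))"
      using that hol[of j] om[of _ j]
      by (intro Schottky_cball[of "a j" z d C' x]) (auto intro: holomorphic_on_subset)
  qed
  define U where "U = {z\<in>G. \<exists>C. \<forall>j. norm (a j z) \<le> C}"
  have yU: "y \<in> U"
  proof -
    obtain d where d: "d > 0" "cball y d \<subseteq> G" using G(1) p(2) open_contains_cball by blast
    obtain J where J: "\<And>j. j \<ge> J \<Longrightarrow> dist (p j) y < d/3"
      using p(1) d(1) unfolding lim_sequentially by (meson divide_pos_pos zero_less_numeral)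
    have "norm (a j y) \<le> exp(pi * exp(pi * (2 + 2 * B + 12)))" if "j \<ge> J" for j
    proof -
      have sub: "cball (p j) (2*(d/3)) \<subseteq> G"
      proof
        fix x assume "x \<in> cball (p j) (2*(d/3))"
        then have "dist y x \<le> d" using J[OF that] dist_triangle[of y x "p j"] by (simp add: dist_commute)
        then show "x \<in> G" using d by auto
      qed
      show ?thesis
        by (rule Schottky_cball[of "a j" "p j" "d/3"])
           (use sub hol[of j] om d p(3) J[OF that] in \<open>auto simp: less_imp_le intro: holomorphic_on_subset\<close>)
    qed
    \<comment> \<open>Schottky's theorem around \<open>p j\<close> controls only the indices from
      \<open>J\<close> on; the sum covers the finitely many others.\<close>
    then have "norm (a j y) \<le> max (exp(pi * exp(pi * (2 + 2 * B + 12)))) (\<Sum>i<J. norm (a i y))" for j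
      by (cases "j \<ge> J") (auto simp: le_max_iff_disj intro!: member_le_sum)
    then show ?thesis using p(2) unfolding U_def by blast
  qed
  have opU: "\<exists>d>0. cball z d \<subseteq> U" if zU: "z \<in> U" for z
  proof -
    obtain C' where C': "\<And>j. norm (a j z) \<le> C'" using zU unfolding U_def by blast
    obtain d where d: "d > 0" "cball z d \<subseteq> G"
      using zU G(1) open_contains_cball unfolding U_def by blast
    then obtain C where "\<forall>j\<in>UNIV. \<forall>x\<in>cball z (d/2). norm (a j x) \<le> C"
      using loc[of z "d/2" UNIV C'] C' by auto
    moreover have "cball z (d/2) \<subseteq> G" using d by auto
    ultimately have "cball z (d/2) \<subseteq> U" unfolding U_def by blast
    then show ?thesis using d(1) by (intro exI[of _ "d/2"]) auto
  qed
  have "U = G"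
  proof (rule ccontr)
    assume "U \<noteq> G"
    have "open U" using opU open_contains_cball by blast
    moreover have "open (G - U)"
    proof (subst open_contains_cball, intro ballI)
      fix z assume z: "z \<in> G - U"
      then obtain d where d: "d > 0" "cball z d \<subseteq> G" using G(1) open_contains_cball by blast
      \<comment> \<open>A point of \<open>U\<close> this close to \<open>z\<close> would pass its
        bound on to \<open>z\<close>, because Schottky's disc around it still lies in
        \<open>G\<close>.\<close>
      have "x \<notin> U" if "x \<in> cball z (d/3)" for x
      proof
        assume "x \<in> U"
        then obtain C' where C': "\<And>j. norm (a j x) \<le> C'" unfolding U_def by blast
        have "cball x (2*(d/3)) \<subseteq> G"
        proof
          fix w assume "w \<in> cball x (2*(d/3))"
          then have "dist z w \<le> d" using that dist_triangle[of z w x] by simp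
          then show "w \<in> G" using d by auto
        qed
        then obtain C where "\<forall>j\<in>UNIV. \<forall>w\<in>cball x (d/3). norm (a j w) \<le> C"
          using loc[of x "d/3" UNIV C'] C' d by auto
        then have "\<forall>j. norm (a j z) \<le> C" using that by (simp add: dist_commute)
        then show False using z unfolding U_def by blast
      qed
      moreover have "cball z (d/3) \<subseteq> G" using d by auto
      ultimately show "\<exists>e>0. cball z e \<subseteq> G - U"
        using d(1) by (intro exI[of _ "d/3"]) auto
    qed
    ultimately show False
      using connectedD[OF G(2), of U "G - U"] yU \<open>U \<noteq> G\<close> unfolding U_def by blast
  qed
  have bd: "\<exists>C. \<forall>h\<in>range a. \<forall>z\<in>K. norm (h z) \<le> C" if K: "compact K" "K \<subseteq> G" for K
  proof -
    have "\<exists>d C. d > 0 \<and> (\<forall>j. \<forall>x\<in>ball z d. norm (a j x) \<le> C)" if "z \<in> K" for z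
    proof -
      have "z \<in> U" using that K(2) \<open>U = G\<close> by auto
      then obtain C' where C': "\<And>j. norm (a j z) \<le> C'" unfolding U_def by blast
      have "z \<in> G" using that K(2) by auto
      then obtain d where d: "d > 0" "cball z d \<subseteq> G" using G(1) open_contains_cball by blast
      then obtain C where "\<forall>j\<in>UNIV. \<forall>x\<in>cball z (d/2). norm (a j x) \<le> C"
        using loc[of z "d/2" UNIV C'] C' by auto
      then show ?thesis using d(1) by (intro exI[of _ "d/2"] exI[of _ C]) auto
    qed
    then obtain d C where dC: "\<And>z. z \<in> K \<Longrightarrow> d z > 0"
        "\<And>z. z \<in> K \<Longrightarrow> \<forall>j. \<forall>x\<in>ball z (d z). norm (a j x) \<le> C z"
      by metis
    have "K \<subseteq> (\<Union>z\<in>K. ball z (d z))" using dC(1) by force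
    then obtain S where S: "S \<subseteq> K" "finite S" "K \<subseteq> (\<Union>z\<in>S. ball z (d z))"
      using compactE_image[OF K(1), of K "\<lambda>z. ball z (d z)"] by auto
    have "norm (a j x) \<le> (\<Sum>z\<in>S. \<bar>C z\<bar>)" if xK: "x \<in> K" for j x
    proof -
      obtain z where z: "z \<in> S" "x \<in> ball z (d z)" using subsetD[OF S(3) xK] by auto
      have "norm (a j x) \<le> C z" using dC(2)[OF subsetD[OF S(1) z(1)]] z(2) by simp
      then have "norm (a j x) \<le> \<bar>C z\<bar>" by simp
      also have "\<dots> \<le> (\<Sum>z\<in>S. \<bar>C z\<bar>)" using z S by (intro member_le_sum) auto
      finally show ?thesis .
    qed
    then show ?thesis by (intro exI[of _ "\<Sum>z\<in>S. \<bar>C z\<bar>"]) auto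
  qed
  show ?thesis
    by (rule Montel[OF G(1), of "range a" a]) (use hol bd that in auto)
qed

section \<open>The map on the base\<close>

text \<open>The division convention makes \<open>cayley_pow k\<close> vanish at its pole \<open>-\<i>\<close>; hence an orbit that avoids \<open>0\<close>
  has avoided the pole as well, and agrees with the orbit on the Riemann sphere.\<close>

definition cayley_pow :: "nat \<Rightarrow> complex \<Rightarrow> complex" where
  "cayley_pow k z = ((1 + \<i> * z) / (1 - \<i> * z)) ^ k"

text \<open>The homogeneous lift of the base map in the chart \<open>z = x / y\<close>. Unlike
  \<open>cayley_pow\<close> it is faithful at the pole and at infinity.\<close>

definition base_lift :: "nat \<Rightarrow> complex \<times> complex \<Rightarrow> complex \<times> complex" where
  "base_lift k v = ((snd v + \<i> * fst v) ^ k, (snd v - \<i> * fst v) ^ k)"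

lemma i_power_eq_1: "4 dvd k \<Longrightarrow> \<i> ^ k = 1" "4 dvd k \<Longrightarrow> (- \<i>) ^ k = 1"
proof -
  assume "4 dvd k"
  then obtain m where "k = 4 * m" by auto
  then show "\<i> ^ k = 1" "(- \<i>) ^ k = 1" by (simp_all add: power_mult)
qed

lemma cayley_pow_1: "4 dvd k \<Longrightarrow> cayley_pow k 1 = 1"
proof -
  assume k: "4 dvd k"
  have "1 + \<i> = \<i> * (1 - \<i>)" "1 - \<i> \<noteq> 0" by (auto simp: complex_eq_iff)
  then have "(1 + \<i>) / (1 - \<i>) = \<i>" by (metis nonzero_mult_div_cancel_right)
  then show ?thesis using i_power_eq_1(1)[OF k] by (simp add: cayley_pow_def)
qed

lemma base_lift_nonzero: "k > 0 \<Longrightarrow> v \<noteq> 0 \<Longrightarrow> base_lift k v \<noteq> 0"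
proof
  assume a: "k > 0" "v \<noteq> 0" "base_lift k v = 0"
  then have "snd v + \<i> * fst v = 0" "snd v - \<i> * fst v = 0"
    by (auto simp: base_lift_def zero_prod_def)
  then have "snd v = 0" "fst v = 0" by (auto simp: algebra_simps)
  then show False using a(2) by (simp add: prod_eq_iff)
qed

lemma base_lift_funpow_nonzero: "k > 0 \<Longrightarrow> v \<noteq> 0 \<Longrightarrow> (base_lift k ^^ n) v \<noteq> 0"
  by (induction n) (auto simp: base_lift_nonzero)

lemma base_lift_cayley_pow:
  assumes "cayley_pow k a \<noteq> 0" "c \<noteq> 0"
  obtains c' where "c' \<noteq> 0" "base_lift k (c * a, c) = (c' * cayley_pow k a, c')"
proof (cases "k = 0")
  case True
  then show ?thesis using that[of 1] by (simp add: base_lift_def cayley_pow_def)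
next
  case False
  have nz: "1 - \<i> * a \<noteq> 0"
    using assms(1) False by (auto simp: cayley_pow_def)
  show ?thesis
  proof (rule that)
    have "base_lift k (c * a, c) = ((c * (1 + \<i> * a)) ^ k, (c * (1 - \<i> * a)) ^ k)"
      by (simp add: base_lift_def algebra_simps)
    also have "\<dots> = ((c * (1 - \<i> * a)) ^ k * cayley_pow k a, (c * (1 - \<i> * a)) ^ k)"
      using nz by (simp add: cayley_pow_def power_divide power_mult_distrib)
    finally show "base_lift k (c * a, c) = ((c * (1 - \<i> * a)) ^ k * cayley_pow k a, (c * (1 - \<i> * a)) ^ k)" .
  qed (use nz assms in auto)
qed

lemma base_lift_funpow_cayley_pow:
  assumes "\<And>i. i \<le> n \<Longrightarrow> (cayley_pow k ^^ i) z \<noteq> 0"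
  shows "\<exists>c. c \<noteq> 0 \<and> (base_lift k ^^ n) (z, 1) = (c * (cayley_pow k ^^ n) z, c)"
  using assms
proof (induction n)
  case 0
  then show ?case by (intro exI[of _ 1]) auto
next
  case (Suc n)
  then obtain c where c: "c \<noteq> 0" "(base_lift k ^^ n) (z, 1) = (c * (cayley_pow k ^^ n) z, c)" by auto
  have "cayley_pow k ((cayley_pow k ^^ n) z) \<noteq> 0" using Suc.prems[of "Suc n"] by simp
  from base_lift_cayley_pow[OF this c(1)] show ?case using c(2) by (metis comp_apply funpow.simps(2))
qed

lemma base_lift_surj: 
  assumes "k > 0" shows "\<exists>v. base_lift k v = p"
proof -
  obtain a where a: "fst p = a ^ k" by (rule exists_complex_root[of k "fst p"]) (use assms in auto)
  obtain b where b: "snd p = b ^ k" by (rule exists_complex_root[of k "snd p"]) (use assms in auto)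
  have 1: "(a+b)/2 + \<i> * ((a-b)/(2*\<i>)) = a" by (simp add: field_simps)
  have 2: "(a+b)/2 - \<i> * ((a-b)/(2*\<i>)) = b" by (simp add: field_simps)
  have "base_lift k ((a-b)/(2*\<i>), (a+b)/2) = (a ^ k, b ^ k)"
    unfolding base_lift_def fst_conv snd_conv 1 2 ..
  then show ?thesis using a b by (metis prod.collapse)
qed

lemma base_lift_scale: "base_lift k (c * x, c * y) = (c^k * fst (base_lift k (x,y)), c^k * snd (base_lift k (x,y)))"
  by (simp add: base_lift_def flip: power_mult_distrib) (simp add: algebra_simps)

lemma base_lift_funpow_scale:
  "(base_lift k ^^ n) (c * x, c * y) =
    (c^(k^n) * fst ((base_lift k ^^ n) (x,y)), c^(k^n) * snd ((base_lift k ^^ n) (x,y)))"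
proof (induction n)
  case (Suc n)
  have "(base_lift k ^^ Suc n) (c * x, c * y) = base_lift k (c^(k^n) * fst ((base_lift k ^^ n) (x,y)), c^(k^n) * snd ((base_lift k ^^ n) (x,y)))"
    by (simp add: Suc)
  then show ?case by (simp add: base_lift_scale flip: power_mult) (simp add: mult.commute)
qed auto

lemma base_lift_funpow_holomorphic:
  "(\<lambda>z. fst ((base_lift k ^^ n) (z, 1))) holomorphic_on S"
  "(\<lambda>z. snd ((base_lift k ^^ n) (z, 1))) holomorphic_on S"
proof (induction n)
  case (Suc n)
  { case 1 show ?case using Suc by (auto simp: base_lift_def intro!: holomorphic_intros) }
  { case 2 show ?case using Suc by (auto simp: base_lift_def intro!: holomorphic_intros) }
qed (auto intro!: holomorphic_intros)

text \<open>The diagonal lies over the fixed point \<open>1\<close>. Its orbit, which never reaches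
  zero, witnesses that the coordinates of the iterated lift do not vanish identically as functions
  of \<open>z\<close>.\<close>

lemma base_lift_diagonal:
  assumes k: "4 dvd k" "k > 0" and c0: "c0 \<noteq> 0"
  shows "\<exists>c. c \<noteq> 0 \<and> (base_lift k ^^ n) (c0, c0) = (c, c)"
proof -
  have "\<exists>c'. c' \<noteq> 0 \<and> base_lift k (c, c) = (c', c')" if c: "c \<noteq> 0" for c
  proof -
    obtain c' where "c' \<noteq> 0" "base_lift k (c * 1, c) = (c' * cayley_pow k 1, c')"
      by (rule base_lift_cayley_pow[of k 1 c]) (use cayley_pow_1[OF k(1)] c in auto)
    then show ?thesis using cayley_pow_1[OF k(1)] by auto
  qed
  then show ?thesis using c0 by (induction n) fastforce+
qed

text \<open>The points to be avoided are zeros of the entire functions \<open>X n\<close>,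
  \<open>Y n\<close> and \<open>X n - Y n\<close>. None of these vanishes identically, so only
  countably many points are lost, while \<open>D\<close> is uncountable.\<close>

lemma exists_generic_point:
  assumes k: "4 dvd k" "k > 0" and D: "open D" "D \<noteq> {}"
  obtains z where "z \<in> D" "\<And>n. (cayley_pow k ^^ n) z \<noteq> 0 \<and> (cayley_pow k ^^ n) z \<noteq> 1"
proof -
  define X where "X = (\<lambda>n z. fst ((base_lift k ^^ n) (z, 1)))"
  define Y where "Y = (\<lambda>n z. snd ((base_lift k ^^ n) (z, 1)))"
  have hol: "X n holomorphic_on S" "Y n holomorphic_on S" for n S
    unfolding X_def Y_def by (rule base_lift_funpow_holomorphic)+
  have cnt: "countable {z. g z = 0}" if "g holomorphic_on UNIV" "g z0 \<noteq> 0" for g :: "complex \<Rightarrow> complex" and z0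
  proof -
    have "g z \<noteq> 0" if "g constant_on UNIV" for z
      using that \<open>g z0 \<noteq> 0\<close> unfolding constant_on_def by auto
    moreover have "countable {z\<in>UNIV. g z = 0}" if "\<not> g constant_on UNIV"
      using holomorphic_countable_zeros[OF \<open>g holomorphic_on UNIV\<close> open_UNIV connected_UNIV _ that]
        fsigma_UNIV by blast
    ultimately show ?thesis by (cases "g constant_on UNIV") auto
  qed
  have d: "X n 1 = Y n 1" "Y n 1 \<noteq> 0" for n
    using base_lift_diagonal[OF k, of 1 n] unfolding X_def Y_def by auto
  \<comment> \<open>The point \<open>1\<close> cannot serve as a witness here. Instead
    \<open>0\<close> is pulled back along the surjective lift; the preimage is not the point at
    infinity, because that one is sent to the fixed point \<open>1\<close>.\<close>
  have "\<exists>z. X n z - Y n z \<noteq> 0" for n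
  proof (cases n)
    case 0
    then show ?thesis by (intro exI[of _ 0]) (simp add: X_def Y_def)
  next
    case (Suc n')
    have "\<exists>v. (base_lift k ^^ n) v = p" for p
    proof (induction n arbitrary: p)
      case (Suc n)
      then show ?case using base_lift_surj[OF k(2)] by (metis comp_apply funpow.simps(2))
    qed auto
    then obtain x y where xy: "(base_lift k ^^ n) (x, y) = (0, 1)" by (metis surj_pair)
    have "x \<noteq> 0 \<or> y \<noteq> 0"
    proof (rule ccontr)
      assume "\<not> ?thesis"
      then have "(x,y) = (0 * 1, 0 * 1)" by simp
      then show False using xy base_lift_funpow_scale[of n k 0 1 1] k(2) by (simp add: power_0_left)
    qed
    have "y \<noteq> 0"
    proof
      assume y0: "y = 0"
      then have "x \<noteq> 0" using \<open>x \<noteq> 0 \<or> y \<noteq> 0\<close> by simp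
      have "base_lift k (x, y) = (x^k, x^k)"
        using i_power_eq_1[OF k(1)] power_mult_distrib[of \<i> x k] power_mult_distrib[of "-\<i>" x k]
        by (simp add: base_lift_def y0)
      then have "(base_lift k ^^ n) (x, y) = (base_lift k ^^ n') (x^k, x^k)"
        using Suc by (simp add: funpow_swap1)
      then show False using base_lift_diagonal[OF k, of "x^k" n'] xy \<open>x \<noteq> 0\<close> by auto
    qed
    have "(base_lift k ^^ n) (y * (x/y), y * 1) = (0, 1)" using xy \<open>y \<noteq> 0\<close> by simp
    then have "X n (x/y) = 0" "Y n (x/y) \<noteq> 0"
      unfolding base_lift_funpow_scale X_def Y_def using \<open>y \<noteq> 0\<close> by auto
    then show ?thesis by (intro exI[of _ "x/y"]) auto
  qed
  then obtain zz where zz: "\<And>n. X n (zz n) - Y n (zz n) \<noteq> 0" by metis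
  define E where "E = (\<Union>n. {z. X n z = 0}) \<union> (\<Union>n. {z. Y n z = 0}) \<union> (\<Union>n. {z. X n z - Y n z = 0})"
  have "countable E" unfolding E_def
  proof (intro countable_Un countable_UN)
    show "countable {z. X n z = 0}" for n using cnt[OF hol(1), of n 1] d[of n] by simp
    show "countable {z. Y n z = 0}" for n using cnt[OF hol(2), of n 1] d[of n] by simp
    show "countable {z. X n z - Y n z = 0}" for n
      by (rule cnt[of "\<lambda>z. X n z - Y n z", OF _ zz]) (intro holomorphic_intros hol)
  qed auto
  moreover obtain x e where xe: "e > 0" "ball x e \<subseteq> D" using D open_contains_ball by (metis equals0I)
  ultimately have "\<not> ball x e \<subseteq> E" using uncountable_ball[of e x] countable_subset[of "ball x e" E] by metis
  then have "\<not> D \<subseteq> E" using xe(2) by (meson order_trans)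
  then obtain z where zD: "z \<in> D" "z \<notin> E" by auto
  then have z: "z \<in> D" "\<And>n. X n z \<noteq> 0 \<and> Y n z \<noteq> 0 \<and> X n z \<noteq> Y n z"
    by (auto simp: E_def)
  have *: "(cayley_pow k ^^ n) z = X n z / Y n z" for n
  proof (induction n)
    case 0
    then show ?case by (simp add: X_def Y_def)
  next
    case (Suc n)
    have "(base_lift k ^^ Suc n) (z, 1) = base_lift k (X n z, Y n z)" by (simp add: X_def Y_def)
    then have eq: "X (Suc n) z = (Y n z + \<i> * X n z)^k" "Y (Suc n) z = (Y n z - \<i> * X n z)^k"
      by (auto simp: X_def Y_def base_lift_def)
    have "(1 + \<i> * (X n z / Y n z)) / (1 - \<i> * (X n z / Y n z)) = (Y n z + \<i> * X n z) / (Y n z - \<i> * X n z)"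
      using z(2)[of n] by (simp add: divide_simps)
    then have "cayley_pow k (X n z / Y n z) = X (Suc n) z / Y (Suc n) z"
      unfolding cayley_pow_def eq by (simp only: power_divide)
    then show ?case using Suc by simp
  qed
  show ?thesis by (rule that[OF z(1)]) (use z(2) * in auto)
qed


section \<open>Inverse branches of the iterates\<close>

lemma cayley_pow_inverse_branch_step:
  assumes k: "4 dvd k" "k > 0" and G: "open G" "simply_connected G"
    and g: "g holomorphic_on G" "\<And>w. w \<in> G \<Longrightarrow> g w \<noteq> 0 \<and> g w \<noteq> 1"
    and a: "a \<in> G" "cayley_pow k z = g a"
  obtains g' where "g' holomorphic_on G" "g' a = z" "\<And>w. w \<in> G \<Longrightarrow> cayley_pow k (g' w) = g w"
    "\<And>w. w \<in> G \<Longrightarrow> g' w \<noteq> 0 \<and> g' w \<noteq> 1 \<and> g' w \<noteq> -1"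
proof -
  obtain L where L: "L holomorphic_on G" "\<And>w. w \<in> G \<Longrightarrow> g w = exp (L w)"
    using G g simply_connected_eq_holomorphic_log[OF G(1)] by metis
  define m where "m = (1 + \<i> * z) / (1 - \<i> * z)"
  have mk: "m ^ k = g a" using a(2) by (simp add: m_def cayley_pow_def)
  have nz: "1 - \<i> * z \<noteq> 0" using mk g(2)[OF a(1)] k(2) by (auto simp: m_def power_0_left)
  \<comment> \<open>A \<open>k\<close>-th root of unity that makes the root \<open>rt\<close> take
    the prescribed value \<open>m\<close> at \<open>a\<close>.\<close>
  define th where "th = m / exp (L a / of_nat k)"
  define rt where "rt = (\<lambda>w. th * exp (L w / of_nat k))"
  have ek: "exp (L w / of_nat k) ^ k = g w" if "w \<in> G" for w
    using L(2)[OF that] k(2) by (simp flip: exp_of_nat_mult)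
  have "th ^ k = 1" using ek[OF a(1)] mk g(2)[OF a(1)] by (simp add: th_def power_divide)
  then have rk: "rt w ^ k = g w" if "w \<in> G" for w
    using ek[OF that] by (simp add: rt_def power_mult_distrib)
  have ra: "rt a = m" by (simp add: rt_def th_def)
  have "even k" using k(1) by (meson dvd_trans even_numeral)
  then have "(-1 :: complex) ^ k = 1" by simp
  \<comment> \<open>A \<open>k\<close>-th root of a value other than \<open>1\<close> is no fourth
    root of unity. Under the inverse Cayley transform the values \<open>-1\<close>,
    \<open>1\<close>, \<open>\<i>\<close>, \<open>-\<i>\<close> of \<open>rt\<close> correspond to
    infinity, \<open>0\<close>, \<open>1\<close>, \<open>-1\<close>.\<close>
  then have rn: "rt w \<noteq> -1" "rt w \<noteq> 1" "rt w \<noteq> \<i>" "rt w \<noteq> -\<i>" if "w \<in> G" for w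
    using rk[OF that] g(2)[OF that] i_power_eq_1[OF k(1)] by (metis power_one)+
  then have rn1: "rt w + 1 \<noteq> 0" if "w \<in> G" for w using that by (metis add_eq_0_iff2)
  define g' where "g' = (\<lambda>w. - \<i> * (rt w - 1) / (rt w + 1))"
  have inv: "(1 + \<i> * g' w) / (1 - \<i> * g' w) = rt w" if "w \<in> G" for w
  proof -
    have e: "\<i> * g' w = (rt w - 1) / (rt w + 1)" by (simp add: g'_def field_simps)
    have 1: "1 + \<i> * g' w = 2 * rt w / (rt w + 1)" "1 - \<i> * g' w = 2 / (rt w + 1)"
      unfolding e using rn1[OF that] by (simp_all add: divide_simps)
    show ?thesis unfolding 1 using rn1[OF that] by simp
  qed
  show ?thesis
  proof (rule that)
    show "g' holomorphic_on G"
      unfolding g'_def rt_def using L(1) rn1 k by (auto intro!: holomorphic_intros simp: rt_def)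
    have "m + 1 = 2 / (1 - \<i> * z)" "m - 1 = 2 * \<i> * z / (1 - \<i> * z)"
      unfolding m_def using nz by (simp_all add: divide_simps)
    then show "g' a = z" unfolding g'_def ra using nz by simp
    show "cayley_pow k (g' w) = g w" if "w \<in> G" for w
      using inv[OF that] rk[OF that] by (simp add: cayley_pow_def)
    show "g' w \<noteq> 0 \<and> g' w \<noteq> 1 \<and> g' w \<noteq> -1" if w: "w \<in> G" for w
    proof (intro conjI notI)
      assume "g' w = 0" then show False using inv[OF w] rn[OF w] by simp
    next
      have 1: "(1 + \<i>) / (1 - \<i>) = \<i>" "(1 - \<i>) / (1 + \<i>) = -\<i>"
      proof -
        have "1 + \<i> = \<i> * (1 - \<i>)" "1 - \<i> \<noteq> 0" "1 - \<i> = -\<i> * (1 + \<i>)" "1 + \<i> \<noteq> 0"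
          by (auto simp: complex_eq_iff)
        then show "(1 + \<i>) / (1 - \<i>) = \<i>" "(1 - \<i>) / (1 + \<i>) = -\<i>"
          by (metis nonzero_mult_div_cancel_right)+
      qed
      { assume "g' w = 1" then show False using inv[OF w] rn[OF w] 1 by simp }
      { assume "g' w = -1" then show False using inv[OF w] rn[OF w] 1 by simp }
    qed
  qed
qed

text \<open>\<open>G\<close> avoids the critical values \<open>0\<close> and infinity, so a
  logarithm yields each root; the new branch again avoids \<open>0\<close> and \<open>1\<close>,
  which keeps the induction going. The preimage \<open>-1\<close> of \<open>1\<close> is omitted
  too, but only for \<open>i < n\<close>: for \<open>i = n\<close> the value is \<open>w\<close>
  itself, and \<open>G\<close> may contain \<open>-1\<close>.\<close>

lemma cayley_pow_inverse_branch:
  assumes k: "4 dvd k" "k > 0" and G: "open G" "simply_connected G" "0 \<notin> G" "1 \<notin> G"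
    and z: "(cayley_pow k ^^ n) z \<in> G"
  obtains g where "g ((cayley_pow k ^^ n) z) = z"
    "\<And>w. w \<in> G \<Longrightarrow> (cayley_pow k ^^ n) (g w) = w"
    "\<And>i. i \<le> n \<Longrightarrow> (\<lambda>w. (cayley_pow k ^^ i) (g w)) holomorphic_on G"
    "\<And>i w. i \<le> n \<Longrightarrow> w \<in> G \<Longrightarrow> (cayley_pow k ^^ i) (g w) \<noteq> 0 \<and> (cayley_pow k ^^ i) (g w) \<noteq> 1"
    "\<And>i w. i < n \<Longrightarrow> w \<in> G \<Longrightarrow> (cayley_pow k ^^ i) (g w) \<noteq> -1"
  using z
proof (induction n arbitrary: z thesis)
  case 0
  show ?case by (rule 0(1)[of "\<lambda>w. w"]) (use G in \<open>auto intro!: holomorphic_intros\<close>)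
next
  case (Suc n)
  let ?P = "cayley_pow k"
  let ?a = "(?P ^^ n) (?P z)"
  have a: "(?P ^^ Suc n) z = ?a" by (simp add: funpow_swap1)
  then have aG: "?a \<in> G" using Suc.prems(2) by simp
  obtain g where g: "g ?a = ?P z" "\<And>w. w \<in> G \<Longrightarrow> (?P ^^ n) (g w) = w"
    "\<And>i. i \<le> n \<Longrightarrow> (\<lambda>w. (?P ^^ i) (g w)) holomorphic_on G"
    "\<And>i w. i \<le> n \<Longrightarrow> w \<in> G \<Longrightarrow> (?P ^^ i) (g w) \<noteq> 0 \<and> (?P ^^ i) (g w) \<noteq> 1"
    "\<And>i w. i < n \<Longrightarrow> w \<in> G \<Longrightarrow> (?P ^^ i) (g w) \<noteq> -1"
    by (rule Suc.IH[OF _ aG]) blast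
  have g0: "g holomorphic_on G" "\<And>w. w \<in> G \<Longrightarrow> g w \<noteq> 0 \<and> g w \<noteq> 1"
    using g(3)[of 0] g(4)[of 0] by auto
  obtain g' where g': "g' holomorphic_on G" "g' ?a = z" "\<And>w. w \<in> G \<Longrightarrow> ?P (g' w) = g w"
    "\<And>w. w \<in> G \<Longrightarrow> g' w \<noteq> 0 \<and> g' w \<noteq> 1 \<and> g' w \<noteq> -1"
    by (rule cayley_pow_inverse_branch_step[OF k G(1,2) g0 aG, of z]) (use g(1) in auto)
  have it: "(?P ^^ Suc i) (g' w) = (?P ^^ i) (g w)" if "w \<in> G" for i w
    using g'(3)[OF that] by (simp add: funpow_swap1)
  show ?case
  proof (rule Suc.prems(1))
    show "g' ((?P ^^ Suc n) z) = z" using a g'(2) by simp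
    show "(?P ^^ Suc n) (g' w) = w" if "w \<in> G" for w using it[OF that] g(2)[OF that] by simp
    show "(\<lambda>w. (?P ^^ i) (g' w)) holomorphic_on G" if i: "i \<le> Suc n" for i
    proof (cases i)
      case 0 then show ?thesis using g'(1) by simp
    next
      case (Suc j)
      have "(\<lambda>w. (?P ^^ j) (g w)) holomorphic_on G" using g(3) i Suc by simp
      then show ?thesis unfolding Suc by (rule holomorphic_transform) (use it in auto)
    qed
    show "(?P ^^ i) (g' w) \<noteq> 0 \<and> (?P ^^ i) (g' w) \<noteq> 1" if "i \<le> Suc n" "w \<in> G" for i w
      using that it[OF that(2)] g(4)[of _ w] g'(4)[of w] by (cases i) auto
    show "(?P ^^ i) (g' w) \<noteq> -1" if "i < Suc n" "w \<in> G" for i w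
      using that it[OF that(2)] g(5)[of _ w] g'(4)[of w] by (cases i) auto
  qed
qed

section \<open>The repelling fixed point and accumulation of orbits\<close>

lemma cayley_pow_has_derivative_1:
  assumes k: "4 dvd k" "k > 0"
  obtains D where "(cayley_pow k has_field_derivative D) (at 1)" "norm D = real k"
proof -
  have ne: "1 - \<i> \<noteq> 0" by (simp add: complex_eq_iff)
  have ii: "(1 + \<i>) / (1 - \<i>) = \<i>"
    using ne by (simp add: divide_eq_eq algebra_simps)
  define D where "D = of_nat k * ((1 + \<i>) / (1 - \<i>)) ^ (k-1) * ((\<i> * (1 - \<i>) - (1 + \<i>) * (- \<i>)) / ((1 - \<i>) * (1 - \<i>)))"
  have "((\<lambda>z. ((1 + \<i> * z) / (1 - \<i> * z)) ^ k) has_field_derivative D) (at 1)"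
    unfolding D_def by (rule derivative_eq_intros refl | use ne in simp)+
  then have "(cayley_pow k has_field_derivative D) (at 1)"
    by (simp add: cayley_pow_def[abs_def])
  moreover have "(\<i> * (1 - \<i>) - (1 + \<i>) * (- \<i>)) / ((1 - \<i>) * (1 - \<i>)) = -1"
    by (simp add: divide_eq_eq algebra_simps)
  then have "norm D = real k" unfolding D_def ii by (simp add: norm_mult norm_power)
  ultimately show ?thesis using that by blast
qed

text \<open>If the orbit accumulated only at \<open>0\<close>, \<open>1\<close> and infinity, it
  would eventually stay near \<open>1\<close>, because neighbourhoods of all three points are mapped
  close to \<open>1\<close>. There each step at least doubles the distance from the repelling point
  \<open>1\<close>, which is absurd for a nearby orbit that never equals \<open>1\<close>.\<close>

lemma cayley_pow_orbit_accumulates: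
  assumes k: "4 dvd k" "k > 0" 
    and z: "\<And>n. (cayley_pow k ^^ n) z \<noteq> 0 \<and> (cayley_pow k ^^ n) z \<noteq> 1"
  obtains y s where "y \<noteq> 0" "y \<noteq> 1" "strict_mono (s :: nat \<Rightarrow> nat)"
    "(\<lambda>j. (cayley_pow k ^^ s j) z) \<longlonglongrightarrow> y"
proof -
  let ?P = "cayley_pow k"
  define x where "x = (\<lambda>n. (?P ^^ n) z)"
  have xS: "x (Suc n) = ?P (x n)" for n by (simp add: x_def)
  have k4: "k \<ge> 4" using k by (simp add: dvd_imp_le)
  have P1: "?P 1 = 1" using cayley_pow_1[OF k(1)] .
  obtain D where D: "(?P has_field_derivative D) (at 1)" "norm D = real k"
    using cayley_pow_has_derivative_1[OF k] .
  have "((\<lambda>z. (?P z - ?P 1) / (z - 1)) \<longlongrightarrow> D) (at 1)"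
    using D(1) by (simp add: has_field_derivative_iff)
  then have "((\<lambda>z. norm ((?P z - 1) / (z - 1))) \<longlongrightarrow> norm D) (at 1)"
    unfolding P1 by (rule tendsto_norm)
  then have "eventually (\<lambda>z. norm ((?P z - 1) / (z - 1)) > 2) (at 1)"
    by (rule order_tendstoD) (use D(2) k4 in auto)
  then obtain d where d: "d > 0" "\<And>z. z \<noteq> 1 \<Longrightarrow> dist z 1 < d \<Longrightarrow> norm ((?P z - 1) / (z - 1)) > 2"
    unfolding eventually_at by auto
  have exp2: "norm (?P z - 1) \<ge> 2 * norm (z - 1)" if "norm (z - 1) < d" for z
    using d(2)[of z] that by (cases "z = 1") (auto simp: norm_divide dist_norm field_simps)
  have "isCont ?P 1" using D(1) DERIV_isCont by blast
  then obtain e1 where e1: "e1 > 0" "\<And>z. dist z 1 < e1 \<Longrightarrow> norm (?P z - 1) < d"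
    using d(1) P1 unfolding continuous_at_eps_delta dist_norm by metis
  have "isCont ?P 0" unfolding cayley_pow_def[abs_def] by (intro continuous_intros) auto
  moreover have "?P 0 = 1" by (simp add: cayley_pow_def)
  ultimately obtain e2 where e2: "e2 > 0" "\<And>z. norm z < e2 \<Longrightarrow> norm (?P z - 1) < d"
    using d(1) unfolding continuous_at_eps_delta dist_norm by (metis diff_zero)
  \<comment> \<open>The map near infinity in the coordinate \<open>s = 1/z\<close>; its value there
    is \<open>1\<close> because \<open>k\<close> is even.\<close>
  have "isCont (\<lambda>s. ((s + \<i>) / (s - \<i>)) ^ k) 0" by (intro continuous_intros) auto
  moreover have "even k" using k(1) by (meson dvd_trans even_numeral)
  then have "((0 + \<i>) / (0 - \<i>)) ^ k = 1" by simp
  ultimately obtain e3 where e3: "e3 > 0" "\<And>s. norm s < e3 \<Longrightarrow> norm (((s + \<i>) / (s - \<i>)) ^ k - 1) < d"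
    using d(1) unfolding continuous_at_eps_delta dist_norm by (metis diff_zero)
  have e3': "norm (?P z - 1) < d" if "norm (inverse z) < e3" "z \<noteq> 0" for z
  proof -
    have "(inverse z + \<i>) / (inverse z - \<i>) = (z * (inverse z + \<i>)) / (z * (inverse z - \<i>))"
      using that(2) by simp
    also have "\<dots> = (1 + \<i> * z) / (1 - \<i> * z)" using that(2) by (simp add: algebra_simps)
    finally show ?thesis using e3(2)[OF that(1)] by (simp add: cayley_pow_def)
  qed
  define K where "K = {z :: complex. e1 \<le> dist z 1} \<inter> {z. e2 \<le> norm z} \<inter> cball 0 (1/e3)"
  have "compact K" unfolding K_def
    by (intro closed_Int_compact closed_Int closed_Collect_le continuous_intros compact_cball)
  have notK: "norm (?P z - 1) < d" if "z \<notin> K" "z \<noteq> 0" for z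
    using that e1(2)[of z] e2(2)[of z] e3'[of z] e3(1)
    by (auto simp: K_def not_le norm_inverse norm_divide field_simps)
  have "infinite {n. x n \<in> K}"
  proof
    assume "finite {n. x n \<in> K}"
    then obtain m where m: "\<And>n. x n \<in> K \<Longrightarrow> n < m"
      using finite_nat_set_iff_bounded by auto
    have nd: "norm (x n - 1) < d" if nm: "n \<ge> Suc m" for n
    proof -
      obtain n' where n': "n = Suc n'" "n' \<ge> m" using nm by (cases n) auto
      then show ?thesis using notK[of "x n'"] m[of n'] z[of n'] xS[of n'] unfolding x_def by auto
    qed
    have "norm (x (Suc m + j) - 1) \<ge> 2 ^ j * norm (x (Suc m) - 1)" for j
    proof (induction j)
      case (Suc j)
      have "2 ^ Suc j * norm (x (Suc m) - 1) \<le> 2 * norm (x (Suc m + j) - 1)" using Suc by simp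
      also have "\<dots> \<le> norm (x (Suc (Suc m + j)) - 1)"
        unfolding xS[of "Suc m + j"] by (rule exp2[OF nd]) simp
      finally show ?case by simp
    qed auto
    then have b: "2 ^ j * norm (x (Suc m) - 1) < d" for j
      using nd[of "Suc m + j"] by (meson le_add1 order_le_less_trans)
    have "norm (x (Suc m) - 1) > 0" using z[of "Suc m"] unfolding x_def by simp
    then obtain j where "d / norm (x (Suc m) - 1) < 2 ^ j"
      using real_arch_pow[of 2] by auto
    then show False using b[of j] \<open>norm (x (Suc m) - 1) > 0\<close> by (simp add: field_simps)
  qed
  define t where "t = enumerate {n. x n \<in> K}"
  have t: "strict_mono t" "\<And>n. x (t n) \<in> K"
    using \<open>infinite {n. x n \<in> K}\<close> enumerate_in_set[of "{n. x n \<in> K}"]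
    by (auto simp: t_def strict_mono_enumerate)
  obtain y r where y: "y \<in> K" "strict_mono r" "((\<lambda>n. x (t n)) \<circ> r) \<longlonglongrightarrow> y"
    using \<open>compact K\<close> t(2) unfolding compact_def by metis
  show ?thesis
  proof (rule that[of y "t \<circ> r"])
    show "y \<noteq> 0" "y \<noteq> 1" using y(1) e1(1) e2(1) by (auto simp: K_def)
    show "strict_mono (t \<circ> r)" using t(1) y(2) by (simp add: strict_mono_o)
    show "(\<lambda>j. (?P ^^ (t \<circ> r) j) z) \<longlonglongrightarrow> y" using y(3) by (simp add: x_def o_def)
  qed
qed

text \<open>The slits issue from \<open>0\<close> and \<open>1\<close> and point away from
  \<open>c\<close>, so the complement is starlike about \<open>c\<close>. Since \<open>c\<close> is
  taken on the side of the real axis where \<open>y\<close> lies, the slits beyond their end points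
  are strictly on the other side and miss both \<open>-1\<close> and \<open>y\<close>.\<close>

lemma slit_plane:
  fixes y :: complex
  assumes "y \<noteq> 0" "y \<noteq> 1"
  obtains G where "open G" "simply_connected G" "connected G" "0 \<notin> G" "1 \<notin> G" "-1 \<in> G" "y \<in> G"
proof -
  define c where "c = Complex (1/2) (if Im y \<ge> 0 then 1 else -1)"
  \<comment> \<open>The half-line \<open>c + s (a - c)\<close>, \<open>s \<ge> 1\<close>, written as
    a real equation and a real inequality, which makes it visibly closed.\<close>
  define ray where "ray = (\<lambda>a. {z. Im ((z - c) * cnj (a - c)) = 0} \<inter> {z. (norm (a - c))\<^sup>2 \<le> Re ((z - c) * cnj (a - c))})"
  have cl: "closed (ray a)" for a
    unfolding ray_def by (intro closed_Int closed_Collect_eq closed_Collect_le continuous_intros)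
  define G where "G = - (ray 0 \<union> ray 1)"
  have c: "c \<noteq> 0" "c \<noteq> 1" by (auto simp: c_def complex_eq_iff)
  have op: "open G" unfolding G_def using cl by (intro open_Compl closed_Un)
  have "starlike G"
    unfolding starlike_def
  proof (intro bexI ballI)
    show "c \<in> G" using c by (auto simp: G_def ray_def)
    fix x assume x: "x \<in> G"
    have "w \<notin> ray a" if a: "a \<in> {0,1}" "x \<notin> ray a" and w: "w \<in> closed_segment c x" for a w
    proof
      assume wr: "w \<in> ray a"
      obtain u where u: "0 \<le> u" "u \<le> 1" "w = c + of_real u * (x - c)"
        using w by (auto simp: in_segment scaleR_conv_of_real algebra_simps)
      define b where "b = (x - c) * cnj (a - c)"
      have eq: "(w - c) * cnj (a - c) = of_real u * b" by (simp add: u(3) b_def del: complex_cnj_diff)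
      have "Im (of_real u * b) = u * Im b" "Re (of_real u * b) = u * Re b" by simp_all
      then have wb: "u * Im b = 0" "(norm (a - c))\<^sup>2 \<le> u * Re b"
        using wr unfolding ray_def Int_iff mem_Collect_eq eq by auto
      have ac: "(norm (a - c))\<^sup>2 > 0" using a c by auto
      then have "u > 0" using wb(2) u(1) by (cases "u = 0") auto
      then have "Re b > 0" using wb(2) ac by (smt (verit) mult_nonneg_nonpos)
      then have "u * Re b \<le> Re b" using u by (simp add: mult_left_le_one_le)
      then have "x \<in> ray a" using wb \<open>u > 0\<close> unfolding ray_def b_def by auto
      then show False using a(2) by blast
    qed
    then show "closed_segment c x \<subseteq> G" using x by (auto simp: G_def)
  qed
  moreover have "v \<in> G" if v: "v \<noteq> 0" "v \<noteq> 1" "Im v * Im c \<ge> 0" for v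
  proof -
    have "v \<notin> ray a" if a: "a \<in> {0,1}" for a
    proof
      assume vr: "v \<in> ray a"
      have ac: "(norm (a - c))\<^sup>2 > 0" using a c by auto
      define s where "s = Re ((v - c) * cnj (a - c)) / (norm (a - c))\<^sup>2"
      have "(v - c) * cnj (a - c) = of_real (s * (norm (a - c))\<^sup>2)"
        using vr ac by (auto simp: ray_def s_def complex_eq_iff)
      also have "\<dots> = of_real s * (a - c) * cnj (a - c)"
        by (simp only: of_real_mult complex_norm_square mult.assoc)
      finally have "v - c = of_real s * (a - c)" using ac by (simp del: complex_cnj_diff)
      then have s: "s \<ge> 1" "v = c + of_real s * (a - c)"
        using vr ac by (auto simp: ray_def s_def field_simps simp del: complex_cnj_diff)
      have "Im v = (1 - s) * Im c" unfolding s(2) using a by (auto simp: algebra_simps)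
      moreover have "Im c * Im c = 1" by (auto simp: c_def)
      ultimately have "Im v * Im c = 1 - s" by (simp add: mult.assoc)
      then have "s = 1" using v(3) s(1) by simp
      then show False using s(2) v a by auto
    qed
    then show ?thesis by (auto simp: G_def)
  qed
  then have "-1 \<in> G" "y \<in> G" using assms by (auto simp: c_def)
  moreover have "a \<in> ray a" for a
    unfolding ray_def cmod_power2 by (simp add: algebra_simps power2_eq_square)
  then have "0 \<notin> G" "1 \<notin> G" by (auto simp: G_def)
  ultimately show ?thesis
    using that op starlike_imp_simply_connected starlike_imp_connected by blast
qed

section \<open>Topological transitivity on the base\<close>

lemma uniform_limit_moving_point:
  fixes f :: "nat \<Rightarrow> 'a::metric_space \<Rightarrow> 'b::metric_space"
  assumes "uniform_limit K f l sequentially" "continuous_on K l" "x \<longlonglongrightarrow> a" "a \<in> K"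
    and "eventually (\<lambda>n. x n \<in> K) sequentially"
  shows "(\<lambda>n. f n (x n)) \<longlonglongrightarrow> l a"
proof (rule tendstoI)
  fix e :: real assume "e > 0"
  have "(\<lambda>n. l (x n)) \<longlonglongrightarrow> l a"
    using continuous_on_tendsto_compose[OF assms(2,3,4,5)] .
  then have "eventually (\<lambda>n. dist (l (x n)) (l a) < e/2) sequentially"
    using \<open>e > 0\<close> tendstoD half_gt_zero by blast
  moreover have "eventually (\<lambda>n. \<forall>z\<in>K. dist (f n z) (l z) < e/2) sequentially"
    using uniform_limitD[OF assms(1), of "e/2"] \<open>e > 0\<close> by simp
  ultimately show "eventually (\<lambda>n. dist (f n (x n)) (l a) < e) sequentially"
    using assms(5) by eventually_elim (metis dist_commute dist_triangle_half_l)
qed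

text \<open>All inverse branches of the iterates omit the postcritical set \<open>{0, 1, \<infinity>}\<close>, so they form a normal
  family on a slit plane \<open>G\<close>. If some open set had iterates avoiding an open set, a sequence of such
  branches would converge to the identity of \<open>G\<close>; but they all omit \<open>-1\<close>, a preimage of \<open>1\<close>,
  contradicting Hurwitz's theorem.\<close>

theorem base_lift_transitive:
  assumes k: "4 dvd k" "k > 0" and D: "open D" "D \<noteq> {}" and Q: "open Q" "Q \<noteq> {}"
  shows "\<exists>n\<ge>m. \<exists>z\<in>D. snd ((base_lift k ^^ n) (z, 1)) \<noteq> 0 \<and>
            fst ((base_lift k ^^ n) (z, 1)) / snd ((base_lift k ^^ n) (z, 1)) \<in> Q"
proof (rule ccontr)
  assume neg: "\<not> ?thesis"
  let ?P = "cayley_pow k"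
  define X where "X = (\<lambda>n z. fst ((base_lift k ^^ n) (z, 1)))"
  define Y where "Y = (\<lambda>n z. snd ((base_lift k ^^ n) (z, 1)))"
  obtain q e where q: "e > 0" "ball q e \<subseteq> Q" using Q open_contains_ball by (metis equals0I)
  have far: "e * norm (Y n z) \<le> norm (X n z - q * Y n z)" if "n \<ge> m" "z \<in> D" for n z
  proof (cases "Y n z = 0")
    case False
    then have "X n z / Y n z \<notin> ball q e" using neg that q(2) unfolding X_def Y_def by blast
    then have "e \<le> norm (X n z / Y n z - q)" by (simp add: dist_norm norm_minus_commute)
    also have "X n z / Y n z - q = (X n z - q * Y n z) / Y n z" using False by (simp add: field_simps)
    finally show ?thesis using False by (simp add: norm_divide field_simps)
  qed auto
  have nz: "X n z - q * Y n z \<noteq> 0" if "n \<ge> m" "z \<in> D" for n z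
  proof
    assume 0: "X n z - q * Y n z = 0"
    then have "Y n z = 0" using far[OF that] q(1) by (simp add: mult_le_0_iff)
    moreover have "X n z = 0" using 0 calculation by simp
    ultimately have "(base_lift k ^^ n) (z, 1) = 0" by (simp add: X_def Y_def prod_eq_iff)
    then show False using base_lift_funpow_nonzero[OF k(2), of "(z, 1)" n] by (simp add: zero_prod_def)
  qed
  \<comment> \<open>This is \<open>1 / (p - q)\<close> for the \<open>n\<close>-th image
    \<open>p\<close> of \<open>z\<close>, in homogeneous form and hence holomorphic also where
    \<open>p\<close> is infinity. Avoiding the ball around \<open>q\<close> bounds it by
    \<open>1 / e\<close>, so these functions form a normal family.\<close>
  define h where "h = (\<lambda>n z. Y n z / (X n z - q * Y n z))"
  have hol_h: "h n holomorphic_on D" if "n \<ge> m" for n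
    using nz[OF that] unfolding h_def X_def Y_def
    by (intro holomorphic_intros base_lift_funpow_holomorphic) auto
  have bd_h: "norm (h n z) \<le> 1 / e" if "n \<ge> m" "z \<in> D" for n z
    using far[OF that] nz[OF that] q(1) by (simp add: h_def norm_divide field_simps)
  have h_val: "h n z = 1 / ((?P ^^ n) z - q)" if nzd: "\<And>i. i \<le> n \<Longrightarrow> (?P ^^ i) z \<noteq> 0" for n z
  proof -
    obtain c where c: "c \<noteq> 0" "(base_lift k ^^ n) (z, 1) = (c * (?P ^^ n) z, c)"
      using base_lift_funpow_cayley_pow[of n k z] nzd by metis
    have "X n z - q * Y n z = c * ((?P ^^ n) z - q)" by (simp add: X_def Y_def c algebra_simps)
    then show ?thesis using c by (simp add: h_def Y_def)
  qed
  obtain z0 where z0: "z0 \<in> D" "\<And>n. (?P ^^ n) z0 \<noteq> 0 \<and> (?P ^^ n) z0 \<noteq> 1"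
    using exists_generic_point[OF k D] by metis
  obtain y s0 where y: "y \<noteq> 0" "y \<noteq> 1" and s0: "strict_mono (s0 :: nat \<Rightarrow> nat)"
    "(\<lambda>j. (?P ^^ s0 j) z0) \<longlonglongrightarrow> y"
    using cayley_pow_orbit_accumulates[OF k z0(2)] by metis
  obtain G where G: "open G" "simply_connected G" "connected G" "0 \<notin> G" "1 \<notin> G" "-1 \<in> G" "y \<in> G"
    using slit_plane[OF y] by metis
  have "eventually (\<lambda>j. (?P ^^ s0 j) z0 \<in> G) sequentially"
    using s0(2) G(1,7) by (rule topological_tendstoD)
  then obtain J where J: "\<And>j. j \<ge> J \<Longrightarrow> (?P ^^ s0 j) z0 \<in> G"
    unfolding eventually_sequentially by blast
  \<comment> \<open>Dropping \<open>J + m\<close> terms puts all remaining orbit points into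
    \<open>G\<close> and makes all exponents at least \<open>m\<close>.\<close>
  define s where "s = (\<lambda>j. s0 (j + (J + m)))"
  have s_mono: "strict_mono s" using s0(1) by (auto simp: s_def strict_mono_def)
  have s_m: "s j \<ge> m" for j
    using strict_mono_imp_increasing[OF s0(1), of "j + (J + m)"] by (simp add: s_def)
  have s_G: "(?P ^^ s j) z0 \<in> G" for j unfolding s_def by (rule J) simp
  have s_lim: "(\<lambda>j. (?P ^^ s j) z0) \<longlonglongrightarrow> y"
    unfolding s_def using LIMSEQ_ignore_initial_segment[OF s0(2), of "J + m"] .
  define br where "br = (\<lambda>n g. g ((?P ^^ n) z0) = z0 \<and> (\<forall>w\<in>G. (?P ^^ n) (g w) = w) \<and>
    (\<forall>i\<le>n. (\<lambda>w. (?P ^^ i) (g w)) holomorphic_on G) \<and>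
    (\<forall>i\<le>n. \<forall>w\<in>G. (?P ^^ i) (g w) \<noteq> 0 \<and> (?P ^^ i) (g w) \<noteq> 1) \<and>
    (\<forall>i<n. \<forall>w\<in>G. (?P ^^ i) (g w) \<noteq> -1))"
  have "\<exists>g. br (s j) g" for j
    unfolding br_def by (rule cayley_pow_inverse_branch[OF k G(1,2,4,5) s_G]) blast
  then obtain g where "\<And>j. br (s j) (g j)" by metis
  then have g: "\<And>j. g j ((?P ^^ s j) z0) = z0"
    "\<And>j w. w \<in> G \<Longrightarrow> (?P ^^ s j) (g j w) = w"
    "\<And>j i. i \<le> s j \<Longrightarrow> (\<lambda>w. (?P ^^ i) (g j w)) holomorphic_on G"
    "\<And>j i w. i \<le> s j \<Longrightarrow> w \<in> G \<Longrightarrow> (?P ^^ i) (g j w) \<noteq> 0 \<and> (?P ^^ i) (g j w) \<noteq> 1"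
    "\<And>j i w. i < s j \<Longrightarrow> w \<in> G \<Longrightarrow> (?P ^^ i) (g j w) \<noteq> -1"
    unfolding br_def by blast+
  have g_hol: "g j holomorphic_on G" for j using g(3)[of 0 j] by simp
  have g_om: "g j w \<noteq> 0 \<and> g j w \<noteq> 1" if "w \<in> G" for j w using g(4)[of 0 j w] that by simp
  \<comment> \<open>Each branch takes the value \<open>z0\<close> at its orbit point, and these
    points tend to \<open>y\<close>: this is the bound at moving points that the Montel lemma asks
    for.\<close>
  obtain gl r1 where gl: "gl holomorphic_on G" and r1: "strict_mono (r1 :: nat \<Rightarrow> nat)"
    and gl_lim: "\<And>x. x \<in> G \<Longrightarrow> (\<lambda>n. g (r1 n) x) \<longlonglongrightarrow> gl x"
    and gl_unif: "\<And>K. \<lbrakk>compact K; K \<subseteq> G\<rbrakk> \<Longrightarrow> uniform_limit K (g \<circ> r1) gl sequentially"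
    by (rule Montel_omitting_0_1[where a = g and B = "norm z0", OF G(1,3) g_hol g_om s_lim G(7)]) (auto simp: g(1))
  obtain H r2 where H: "H holomorphic_on D" and r2: "strict_mono (r2 :: nat \<Rightarrow> nat)"
    and H_unif: "\<And>K. \<lbrakk>compact K; K \<subseteq> D\<rbrakk> \<Longrightarrow> uniform_limit K ((\<lambda>j. h (s (r1 j))) \<circ> r2) H sequentially"
  proof (rule Montel[OF D(1), of "range (\<lambda>j. h (s (r1 j)))" "\<lambda>j. h (s (r1 j))"])
    show "f holomorphic_on D" if "f \<in> range (\<lambda>j. h (s (r1 j)))" for f
      using that hol_h s_m by auto
    show "\<exists>B. \<forall>f\<in>range (\<lambda>j. h (s (r1 j))). \<forall>z\<in>K. norm (f z) \<le> B" if "compact K" "K \<subseteq> D" for K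
      using bd_h s_m that by (intro exI[of _ "1/e"]) auto
  qed auto
  define r where "r = r1 \<circ> r2"
  have r: "strict_mono r" unfolding r_def using r1 r2 by (rule strict_mono_o)
  define sr where "sr = (\<lambda>j. s (r j))"
  have sr: "strict_mono sr" using s_mono r unfolding sr_def strict_mono_def by blast
  have sr_m: "sr j \<ge> m" for j using s_m by (simp add: sr_def)
  have gl_lim': "(\<lambda>j. g (r j) x) \<longlonglongrightarrow> gl x" if "x \<in> G" for x
    using LIMSEQ_subseq_LIMSEQ[OF gl_lim[OF that] r2] by (simp add: r_def o_def)
  have gl_unif': "uniform_limit K (\<lambda>j. g (r j)) gl sequentially" if "compact K" "K \<subseteq> G" for K
    using filterlim_compose[OF gl_unif[OF that, unfolded o_def] filterlim_subseq[OF r2]]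
    by (simp add: r_def o_def)
  have H_unif': "uniform_limit K (\<lambda>j. h (sr j)) H sequentially" if "compact K" "K \<subseteq> D" for K
    using H_unif[OF that] by (simp add: r_def o_def sr_def)
  have orb_lim: "(\<lambda>j. (?P ^^ sr j) z0) \<longlonglongrightarrow> y"
    using LIMSEQ_subseq_LIMSEQ[OF s_lim r] by (simp add: sr_def o_def)
  obtain d0 where d0: "d0 > 0" "cball y d0 \<subseteq> G" using G(1,7) open_contains_cball by blast
  have gl_cont: "continuous_on (cball y d0) gl"
    using gl d0(2) by (meson holomorphic_on_imp_continuous_on holomorphic_on_subset)
  have gly: "gl y = z0"
  proof -
    have "eventually (\<lambda>j. (?P ^^ sr j) z0 \<in> cball y d0) sequentially"
      using orb_lim d0(1) by (auto dest!: tendstoD[of _ _ _ d0] elim!: eventually_mono simp: dist_commute)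
    then have "(\<lambda>j. g (r j) ((?P ^^ sr j) z0)) \<longlonglongrightarrow> gl y"
      using d0 by (intro uniform_limit_moving_point[OF gl_unif'[of "cball y d0"] gl_cont orb_lim]) auto
    then show ?thesis using g(1) by (simp add: sr_def LIMSEQ_const_iff)
  qed
  obtain r0 where r0: "r0 > 0" "cball z0 r0 \<subseteq> D" using D(1) z0(1) open_contains_cball by blast
  have H_cont: "continuous_on (cball z0 r0) H"
    using H r0(2) by (meson holomorphic_on_imp_continuous_on holomorphic_on_subset)
  have "norm ((?P ^^ sr j) z0 - q) \<ge> e" for j
  proof -
    have "h (sr j) z0 = 1 / ((?P ^^ sr j) z0 - q)" using h_val z0(2) by blast
    then have "norm (1 / ((?P ^^ sr j) z0 - q)) \<le> 1 / e" using bd_h[OF sr_m z0(1), of j] by simp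
    moreover have "(?P ^^ sr j) z0 - q \<noteq> 0"
    proof -
      obtain c where c: "c \<noteq> 0" "(base_lift k ^^ sr j) (z0, 1) = (c * (?P ^^ sr j) z0, c)"
        using base_lift_funpow_cayley_pow[of "sr j" k z0] z0(2) by metis
      then show ?thesis using nz[OF sr_m z0(1), of j] by (auto simp: X_def Y_def algebra_simps)
    qed
    ultimately show ?thesis using q(1) by (simp add: norm_divide field_simps)
  qed
  then have yq: "norm (y - q) \<ge> e"
    using orb_lim by (intro tendsto_lowerbound[of "\<lambda>j. norm ((?P ^^ sr j) z0 - q)" _ sequentially])
      (auto intro!: tendsto_intros)
  obtain d2 where d2: "d2 > 0" "\<And>w. w \<in> cball y d0 \<Longrightarrow> dist w y < d2 \<Longrightarrow> dist (gl w) z0 < r0 / 2"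
    using gl_cont gly r0(1) d0(1) unfolding continuous_on_iff
    by (metis centre_in_cball half_gt_zero less_imp_le)
  \<comment> \<open>The entry \<open>e / 2\<close> is due to \<open>norm (y - q) \<ge> e\<close>:
    every \<open>w\<close> in the disc then differs from \<open>q\<close>, and the reciprocals below
    can be inverted.\<close>
  define d1 where "d1 = Min {d0, d2 / 2, e / 2}"
  have d1: "d1 > 0" "d1 \<le> d0" "d1 < d2" "d1 < e"
    using d0(1) d2(1) q(1) by (auto simp: d1_def min_def)
  have wG: "w \<in> G" if "w \<in> cball y d1" for w using that d0(2) d1(2) by auto
  have "eventually (\<lambda>j. \<forall>w\<in>cball y d0. dist (g (r j) w) (gl w) < r0 / 2) sequentially"
    using uniform_limitD[OF gl_unif'[OF compact_cball d0(2)], of "r0 / 2"] r0(1) by simp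
  then obtain N where N: "\<And>j w. j \<ge> N \<Longrightarrow> w \<in> cball y d0 \<Longrightarrow> dist (g (r j) w) (gl w) < r0 / 2"
    unfolding eventually_sequentially by blast
  have near: "g (r j) w \<in> cball z0 r0" if "j \<ge> N" "w \<in> cball y d1" for j w
  proof -
    have "dist (gl w) z0 < r0 / 2" using that d1 by (intro d2(2)) (auto simp: dist_commute)
    moreover have "dist (g (r j) w) (gl w) < r0 / 2" using that d1 by (intro N) auto
    ultimately show ?thesis
      using dist_triangle[of z0 "g (r j) w" "gl w"] by (simp add: dist_commute)
  qed
  \<comment> \<open>Backward by the longer time, then forward by the shorter one, hence again an
    inverse branch. Both \<open>g (r j) w\<close> and \<open>g (r (Suc j)) w\<close> tend to
    \<open>gl w\<close>, near which \<open>h (sr j)\<close> converges uniformly; so their images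
    under the iterate \<open>sr j\<close>, namely \<open>w\<close> and \<open>GG j w\<close>, have
    the same limit.\<close>
  define GG where "GG = (\<lambda>j w. (?P ^^ sr j) (g (r (Suc j)) w))"
  \<comment> \<open>The strict inequality is what makes \<open>GG\<close> omit
    \<open>-1\<close>.\<close>
  have sr_lt: "sr j < s (r (Suc j))" for j
    using sr unfolding sr_def by (simp add: strict_mono_Suc_iff)
  have GG_lim: "(\<lambda>j. GG j w) \<longlonglongrightarrow> w" if w: "w \<in> cball y d1" for w
  proof -
    have glw: "gl w \<in> cball z0 r0" using near[OF _ w] gl_lim'[OF wG[OF w]]
      by (intro Lim_in_closed_set[of "cball z0 r0" "\<lambda>j. g (r j) w" sequentially])
         (auto simp: eventually_sequentially)
    have mv: "(\<lambda>j. h (sr j) (g (r (f j)) w)) \<longlonglongrightarrow> H (gl w)" if f: "\<And>j. f j \<ge> j" "filterlim f at_top sequentially" for f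
    proof (rule uniform_limit_moving_point[OF H_unif'[OF compact_cball r0(2)] H_cont _ glw])
      show "(\<lambda>j. g (r (f j)) w) \<longlonglongrightarrow> gl w"
        using filterlim_compose[OF gl_lim'[OF wG[OF w]] f(2)] .
      show "eventually (\<lambda>j. g (r (f j)) w \<in> cball z0 r0) sequentially"
        using near[OF _ w] f(1) unfolding eventually_sequentially by (meson order_trans)
    qed
    have e1: "h (sr j) (g (r j) w) = 1 / (w - q)" for j
      using h_val[of "sr j" "g (r j) w"] g(4)[of _ "r j" w] g(2)[of w "r j"] wG[OF w] by (simp add: sr_def)
    have "(\<lambda>j. h (sr j) (g (r j) w)) \<longlonglongrightarrow> H (gl w)" by (rule mv[of "\<lambda>j. j"]) (auto simp: filterlim_ident)
    then have Hw: "H (gl w) = 1 / (w - q)" unfolding e1 by (simp add: LIMSEQ_const_iff)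
    have e2: "h (sr j) (g (r (Suc j)) w) = 1 / (GG j w - q)" for j
      using h_val[of "sr j" "g (r (Suc j)) w"] g(4)[of _ "r (Suc j)" w] sr_lt[of j] wG[OF w]
      by (simp add: GG_def)
    have "(\<lambda>j. h (sr j) (g (r (Suc j)) w)) \<longlonglongrightarrow> H (gl w)"
      by (rule mv[of Suc]) (auto simp: filterlim_Suc)
    then have "(\<lambda>j. 1 / (GG j w - q)) \<longlonglongrightarrow> 1 / (w - q)" unfolding e2 Hw .
    moreover have "w - q \<noteq> 0"
    proof
      assume "w - q = 0"
      then have "norm (y - q) \<le> d1" using w by (simp add: dist_norm)
      then show False using yq d1(4) by simp
    qed
    ultimately have "(\<lambda>j. inverse (1 / (GG j w - q))) \<longlonglongrightarrow> inverse (1 / (w - q))"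
      by (intro tendsto_inverse) auto
    then have "(\<lambda>j. GG j w - q) \<longlonglongrightarrow> w - q" by simp
    then show ?thesis using tendsto_add[of "\<lambda>j. GG j w - q" "w - q" sequentially "\<lambda>_. q" q] by simp
  qed
  have GG_hol: "GG j holomorphic_on G" for j
    unfolding GG_def using g(3)[of "sr j" "r (Suc j)"] sr_lt[of j] by simp
  have GG_om: "GG j w \<noteq> 0 \<and> GG j w \<noteq> 1" "GG j w \<noteq> -1" if "w \<in> G" for j w
    unfolding GG_def using g(4)[of "sr j" "r (Suc j)" w] g(5)[of "sr j" "r (Suc j)" w] sr_lt[of j] that by auto
  have GG_val: "GG j ((?P ^^ sr (Suc j)) z0) = (?P ^^ sr j) z0" for j
    unfolding GG_def using g(1)[of "r (Suc j)"] by (simp add: sr_def)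
  obtain B where B: "\<And>j. norm ((?P ^^ sr j) z0) \<le> B"
    using convergent_imp_Bseq[of "\<lambda>j. (?P ^^ sr j) z0"] orb_lim unfolding convergent_def Bseq_def by blast
  have orb_lim': "(\<lambda>j. (?P ^^ sr (Suc j)) z0) \<longlonglongrightarrow> y" using orb_lim by (rule LIMSEQ_Suc)
  \<comment> \<open>So far convergence to the identity is known only near \<open>y\<close>, and
    \<open>-1\<close> may be far away; a further normal family argument and the identity theorem
    extend it to all of \<open>G\<close>.\<close>
  obtain \<Psi> r3 where \<Psi>: "\<Psi> holomorphic_on G" and r3: "strict_mono (r3 :: nat \<Rightarrow> nat)"
    and \<Psi>_lim: "\<And>x. x \<in> G \<Longrightarrow> (\<lambda>n. GG (r3 n) x) \<longlonglongrightarrow> \<Psi> x"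
    and \<Psi>_unif: "\<And>K. \<lbrakk>compact K; K \<subseteq> G\<rbrakk> \<Longrightarrow> uniform_limit K (GG \<circ> r3) \<Psi> sequentially"
    by (rule Montel_omitting_0_1[where a = GG and B = B, OF G(1,3) GG_hol GG_om(1) orb_lim' G(7)])
       (auto simp: GG_val B)
  have \<Psi>_ball: "\<Psi> w = w" if "w \<in> ball y d1" for w
  proof -
    have w: "w \<in> cball y d1" using that by auto
    show ?thesis
      using LIMSEQ_unique[OF \<Psi>_lim[OF wG[OF w]] LIMSEQ_subseq_LIMSEQ[OF GG_lim[OF w] r3, unfolded o_def]] .
  qed
  have \<Psi>_id: "\<Psi> w = w" if "w \<in> G" for w
    by (rule analytic_continuation_open[of "ball y d1" G \<Psi> "\<lambda>w. w" w])
       (use G \<Psi> \<Psi>_ball d1 wG that in \<open>auto intro!: holomorphic_intros\<close>)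
  have "(\<lambda>z. z + 1) (-1 :: complex) \<noteq> 0"
  proof (rule Hurwitz_no_zeros[OF G(1,3), of "\<lambda>n z. GG (r3 n) z + 1" "\<lambda>z. z + 1" "-1"])
    show "(\<lambda>z. GG (r3 n) z + 1) holomorphic_on G" for n by (intro holomorphic_intros GG_hol)
    show "(\<lambda>z. z + 1) holomorphic_on G" by (intro holomorphic_intros)
    show "uniform_limit K (\<lambda>n z. GG (r3 n) z + 1) (\<lambda>z. z + 1) sequentially" if "compact K" "K \<subseteq> G" for K
    proof -
      have "uniform_limit K (\<lambda>n z. GG (r3 n) z + 1) (\<lambda>z. \<Psi> z + 1) sequentially"
        using \<Psi>_unif[OF that] by (intro uniform_limit_intros) (simp add: o_def)
      then show ?thesis
        by (rule uniform_limit_cong'[THEN iffD1, rotated -1]) (use \<Psi>_id that in auto)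
    qed
    show "\<not> (\<lambda>z. z + 1) constant_on G"
    proof
      assume "(\<lambda>z. z + 1) constant_on G"
      moreover have "y + of_real d1 \<in> G" using wG[of "y + of_real d1"] d1(1) by (simp add: dist_norm)
      ultimately have "y + 1 = (y + of_real d1) + 1" using G(7) unfolding constant_on_def by metis
      then show False using d1(1) by simp
    qed
    show "GG (r3 n) z + 1 \<noteq> 0" if "z \<in> G" for n z using GG_om(2)[OF that] by (metis add_eq_0_iff2)
    show "-1 \<in> G" by (rule G(6))
  qed
  then show False by simp
qed

section \<open>Covering a disc by images of discs\<close>

text \<open>The roots have a product of modulus \<open>norm b / norm d\<close>, so one of them is at
  most the geometric mean. The bound does not involve \<open>c\<close>, which makes it usable where
  the slope of the fibre map vanishes.\<close>

lemma small_root_trinomial: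
  fixes d c b :: complex
  assumes "k \<ge> 2" "d \<noteq> 0"
  obtains T where "c * T + d * T ^ k = b" "norm T ^ k \<le> norm b / norm d"
proof -
  define p where "p = monom d k + [:-b, c:]"
  have coeff: "coeff p k = d"
    using assms by (auto simp: p_def coeff_pCons split: nat.splits)
  have deg: "degree p = k"
  proof (rule antisym)
    show "degree p \<le> k" unfolding p_def using assms
      by (intro degree_add_le) (auto simp: degree_monom_eq)
    show "k \<le> degree p" using coeff assms(2) by (intro le_degree) auto
  qed
  have pT: "poly p T = c * T + d * T ^ k - b" for T by (simp add: p_def poly_monom)
  obtain rt where rt: "smult (lead_coeff p) (\<Prod>i<degree p. [:-rt i, 1:]) = p"
    using complex_poly_decompose' by blast
  then have eq: "poly p T = d * (\<Prod>i<k. T - rt i)" for T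
    unfolding deg coeff by (metis (no_types, lifting) poly_prod poly_smult prod.cong poly_pCons poly_0 mult_zero_right add.right_neutral mult.right_neutral uminus_add_conv_diff)
  have a: "norm b / norm d = (\<Prod>i<k. norm (rt i))"
  proof -
    have "- b = d * (\<Prod>i<k. 0 - rt i)"
      using eq[of 0] pT[of 0] assms(1) by (simp add: power_0_left)
    then have "norm (- b) = norm d * norm (\<Prod>i<k. 0 - rt i)" by (metis norm_mult)
    also have "norm (\<Prod>i<k. 0 - rt i) = (\<Prod>i<k. norm (rt i))"
      unfolding prod_norm[symmetric] by simp
    finally show ?thesis using assms(2) by simp
  qed
  have "\<exists>i<k. norm (rt i) ^ k \<le> norm b / norm d"
  proof (rule ccontr)
    assume "\<not> ?thesis"
    then have lt: "norm b / norm d < norm (rt i) ^ k" if "i < k" for i using that by (auto simp: not_le)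
    moreover have "0 < norm (rt i) ^ k" if "i < k" for i
      by (rule order_le_less_trans[OF _ lt[OF that]]) simp
    ultimately have "(\<Prod>i<k. norm b / norm d) < (\<Prod>i<k. norm (rt i) ^ k)"
      using assms by (intro prod_mono_strict[of 0]) (auto intro: less_imp_le)
    then show False by (simp add: a prod_power_distrib)
  qed
  then obtain i where i: "i < k" "norm (rt i) ^ k \<le> norm b / norm d" by blast
  have "poly p (rt i) = 0" unfolding eq using i(1) by auto
  then show ?thesis using i(2) by (intro that[of "rt i"]) (auto simp: pT)
qed

text \<open>Neighbouring \<open>m\<close>-th roots enclose an angle of at most
  \<open>pi / 6\<close>, so the two on either side of the direction \<open>u\<close> are both within
  \<open>pi / 6\<close> of it. Two roots are provided because one of them may turn out to lie in a
  forbidden place.\<close>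

lemma roots_near_direction:
  fixes Z u :: complex
  assumes m: "m \<ge> 12" and u: "norm u = 1"
  obtains z where "z ^ m = Z" "(z * cis (2 * pi / m)) ^ m = Z"
    "Re (z * cnj u) \<ge> sqrt 3 / 2 * norm z"
    "Re (z * cis (2 * pi / m) * cnj u) \<ge> sqrt 3 / 2 * norm z"
proof -
  define \<beta> where "\<beta> = Arg u"
  have ub: "u = cis \<beta>" using u cis_Arg[of u] by (cases "u = 0") (auto simp: \<beta>_def sgn_eq)
  define \<psi> where "\<psi> = Arg Z"
  define r where "r = root m (norm Z)"
  have m0: "m > 0" using m by simp
  have rm: "r ^ m = norm Z" "r \<ge> 0" using m0 by (auto simp: r_def)
  \<comment> \<open>Selects the last root whose argument does not exceed that of
    \<open>u\<close>.\<close>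
  define j where "j = \<lfloor>(m * \<beta> - \<psi>) / (2 * pi)\<rfloor>"
  define \<phi> where "\<phi> = (\<psi> + 2 * pi * j) / m"
  have j: "of_int j \<le> (m * \<beta> - \<psi>) / (2 * pi)" "(m * \<beta> - \<psi>) / (2 * pi) < of_int j + 1"
    unfolding j_def by linarith+
  have phi: "\<phi> \<le> \<beta>" "\<beta> \<le> \<phi> + 2 * pi / m"
    using j m0 unfolding \<phi>_def by (auto simp: field_simps)
  have small: "2 * pi / m \<le> pi / 6" using m pi_gt_zero by (simp add: field_simps)
  have cosb: "sqrt 3 / 2 \<le> cos x" if "\<bar>x\<bar> \<le> 2 * pi / m" for x
    using that small cos_monotone_0_pi_le[of "\<bar>x\<bar>" "pi/6"] by (simp add: cos_30)
  have Zc: "complex_of_real (norm Z) * cis \<psi> = Z"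
    by (cases "Z = 0") (auto simp: \<psi>_def cis_Arg sgn_eq)
  have pw: "(of_real r * cis \<phi>) ^ m = Z"
  proof -
    have "m * \<phi> = \<psi> + 2 * pi * j" using m0 by (simp add: \<phi>_def)
    then have "cis \<phi> ^ m = cis (\<psi> + 2 * pi * j)" by (simp only: Complex.DeMoivre)
    also have "\<dots> = cis \<psi> * cis (2 * pi * j)" by (rule cis_mult[symmetric])
    also have "cis (2 * pi * j) = 1" by (rule cis_multiple_2pi) auto
    finally show ?thesis using rm(1) Zc by (simp add: power_mult_distrib flip: of_real_power)
  qed
  have one: "cis (2 * pi / m) ^ m = 1" using m0 by (simp add: Complex.DeMoivre)
  have Re1: "Re (of_real r * cis x * cnj u) = r * cos (x - \<beta>)" for x
    by (simp add: ub cis_cnj cis_mult mult.assoc cos_diff)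
  have Re2: "Re (of_real r * cis x * cnj u) \<ge> sqrt 3 / 2 * r" if "\<bar>x - \<beta>\<bar> \<le> 2 * pi / m" for x
    unfolding Re1 using mult_left_mono[OF cosb[OF that] rm(2)] by (simp add: mult.commute)
  show ?thesis
  proof (rule that[of "of_real r * cis \<phi>"])
    show "(of_real r * cis \<phi>) ^ m = Z" by (rule pw)
    show "(of_real r * cis \<phi> * cis (2 * pi / m)) ^ m = Z"
      using pw one by (simp add: power_mult_distrib)
    show "sqrt 3 / 2 * norm (of_real r * cis \<phi>) \<le> Re (of_real r * cis \<phi> * cnj u)"
      using Re2[of \<phi>] phi rm(2) by (simp add: norm_mult)
    show "sqrt 3 / 2 * norm (of_real r * cis \<phi>) \<le> Re (of_real r * cis \<phi> * cis (2 * pi / m) * cnj u)"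
      using Re2[of "\<phi> + 2 * pi / m"] phi rm(2) by (simp add: norm_mult mult.assoc cis_mult)
  qed
qed

text \<open>Young's inequality with the weights \<open>j / k\<close> and \<open>(k - j) / k\<close>,
  the second one enlarged to \<open>1\<close>. For fixed \<open>j\<close> and large \<open>k\<close>
  the first coefficient is negligible.\<close>

lemma young_power:
  fixes a b :: real
  assumes "a \<ge> 0" "b \<ge> 0" "j \<le> k" "k > 0"
  shows "a ^ j * b ^ (k - j) \<le> j / k * a ^ k + b ^ k"
proof (cases "a = 0 \<or> b = 0")
  case True
  then show ?thesis using assms by (cases "j = 0"; cases "j = k") (auto simp: power_0_left)
next
  case False
  then have ab: "a > 0" "b > 0" using assms by auto
  have e1: "(a ^ k) powr (j / k) = a ^ j"
    using ab assms by (simp add: powr_powr powr_realpow[symmetric])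
  have e2: "(b ^ k) powr ((k - j) / k) = b ^ (k - j)"
    using ab assms by (simp add: powr_powr powr_realpow[symmetric])
  have "(a ^ k) powr (j / k) * (b ^ k) powr (real (k - j) / k) \<le> j / k * a ^ k + real (k - j) / k * b ^ k"
    using ab assms by (intro Youngs_inequality_0) (auto simp: field_simps of_nat_diff)
  moreover have "real (k - j) / k * b ^ k \<le> 1 * b ^ k"
    using ab assms by (intro mult_right_mono) (auto simp: field_simps)
  ultimately show ?thesis unfolding e1 e2[unfolded of_nat_diff[OF assms(3), symmetric]] by simp
qed

text \<open>The passage from \<open>(x, y)\<close> to \<open>(u, w)\<close> is \<open>sqrt 2\<close>
  times a unitary map.\<close>

lemma norm_rotate:
  fixes x y :: complex
  shows "(norm (y + \<i> * x))\<^sup>2 + (norm (y - \<i> * x))\<^sup>2 = 2 * (norm (x, y))\<^sup>2"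
  unfolding norm_Pair real_sqrt_pow2[OF add_nonneg_nonneg[OF zero_le_power2 zero_le_power2]] cmod_power2
  by (simp add: power2_eq_square algebra_simps)

text \<open>Here \<open>A\<close> and \<open>B\<close> stand for the moduli of \<open>w\<close> and
  \<open>u\<close>. Bounding the square of the sum and then applying Chebyshev's sum inequality
  costs a factor \<open>2\<close> each; with the \<open>1/2\<close> from the norm and
  \<open>(7/10)^2\<close> this leaves \<open>98/100\<close> times
  \<open>A^(2k) + A^22 B^(2k-22)\<close>. Young's inequality turns the mixed term into
  \<open>B^(2k)\<close> plus at most \<open>1/900\<close> of \<open>A^(2k)\<close>, using
  \<open>11 / 10800 < 1/900\<close>.\<close>

lemma multiplier_bound_real:
  fixes A B :: real
  assumes "A \<ge> 0" "B \<ge> 0" "k \<ge> 10800"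
  shows "(7/10 * A ^ 11 * (A ^ (k - 12) + B ^ (k - 12)))\<^sup>2 * ((A\<^sup>2 + B\<^sup>2) / 2) \<le> (995/1000)\<^sup>2 * ((B ^ k)\<^sup>2 + (A ^ k)\<^sup>2)"
proof -
  define a b where "a = A ^ (k - 12)" and "b = B ^ (k - 12)"
  have sq: "(a + b)\<^sup>2 \<le> 2 * (a\<^sup>2 + b\<^sup>2)" using sum_squares_bound[of a b] by (simp add: power2_sum)
  have "(a\<^sup>2 - b\<^sup>2) * (A\<^sup>2 - B\<^sup>2) \<ge> 0"
  proof (cases "A \<le> B")
    case True
    then have "a \<le> b" "0 \<le> a" using assms by (auto simp: a_def b_def power_mono)
    then have "a\<^sup>2 \<le> b\<^sup>2" "A\<^sup>2 \<le> B\<^sup>2" using True assms by (auto simp: power_mono)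
    then show ?thesis by (simp add: mult_nonpos_nonpos)
  next
    case False
    then have "b \<le> a" "0 \<le> b" using assms by (auto simp: a_def b_def power_mono)
    then have "b\<^sup>2 \<le> a\<^sup>2" "B\<^sup>2 \<le> A\<^sup>2" using False assms by (auto simp: power_mono)
    then show ?thesis by simp
  qed
  then have ch: "(a\<^sup>2 + b\<^sup>2) * (A\<^sup>2 + B\<^sup>2) \<le> 2 * (a\<^sup>2 * A\<^sup>2 + b\<^sup>2 * B\<^sup>2)" by (simp add: algebra_simps)
  have aA: "(A ^ 11)\<^sup>2 * (a\<^sup>2 * A\<^sup>2) = (A ^ k)\<^sup>2"
  proof -
    have "A ^ 11 * (a * A) = A ^ (11 + (k - 12) + 1)" unfolding a_def power_add by simp
    also have "11 + (k - 12) + 1 = k" using assms by simp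
    finally show ?thesis by (metis power_mult_distrib)
  qed
  have bB: "b\<^sup>2 * B\<^sup>2 = (B\<^sup>2) ^ (k - 11)"
  proof -
    have "b * B = B ^ (k - 12 + 1)" by (simp add: b_def)
    also have "k - 12 + 1 = k - 11" using assms by simp
    finally show ?thesis by (metis power_mult_distrib power_mult mult.commute)
  qed
  have "(A\<^sup>2) ^ 11 * (B\<^sup>2) ^ (k - 11) \<le> 11 / k * (A\<^sup>2) ^ k + (B\<^sup>2) ^ k"
    using young_power[of "A\<^sup>2" "B\<^sup>2" 11 k] assms by simp
  also have "\<dots> \<le> 1/900 * (A\<^sup>2) ^ k + (B\<^sup>2) ^ k"
    using assms by (intro add_right_mono mult_right_mono) (auto simp: field_simps)
  finally have Y: "(A ^ 11)\<^sup>2 * (b\<^sup>2 * B\<^sup>2) \<le> 1/900 * (A ^ k)\<^sup>2 + (B ^ k)\<^sup>2"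
    unfolding bB by (simp add: power_mult[symmetric] mult.commute)
  have "(7/10 * A ^ 11 * (a + b))\<^sup>2 * ((A\<^sup>2 + B\<^sup>2) / 2) = 49/200 * (A ^ 11)\<^sup>2 * (A\<^sup>2 + B\<^sup>2) * (a + b)\<^sup>2"
    by (simp add: power_mult_distrib power_divide)
  also have "\<dots> \<le> 49/200 * (A ^ 11)\<^sup>2 * (A\<^sup>2 + B\<^sup>2) * (2 * (a\<^sup>2 + b\<^sup>2))"
    by (rule mult_left_mono[OF sq]) simp
  also have "\<dots> = 49/100 * (A ^ 11)\<^sup>2 * ((a\<^sup>2 + b\<^sup>2) * (A\<^sup>2 + B\<^sup>2))" by simp
  also have "\<dots> \<le> 49/100 * (A ^ 11)\<^sup>2 * (2 * (a\<^sup>2 * A\<^sup>2 + b\<^sup>2 * B\<^sup>2))"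
    by (rule mult_left_mono[OF ch]) simp
  also have "\<dots> = 98/100 * ((A ^ 11)\<^sup>2 * (a\<^sup>2 * A\<^sup>2) + (A ^ 11)\<^sup>2 * (b\<^sup>2 * B\<^sup>2))"
    by (simp add: algebra_simps)
  also have "\<dots> \<le> 98/100 * ((A ^ k)\<^sup>2 + (1/900 * (A ^ k)\<^sup>2 + (B ^ k)\<^sup>2))"
    unfolding aA using Y by simp
  also have "\<dots> \<le> (995/1000)\<^sup>2 * ((B ^ k)\<^sup>2 + (A ^ k)\<^sup>2)"
    using zero_le_power2[of "A^k"] zero_le_power2[of "B^k"] by (simp add: power2_eq_square)
  finally show ?thesis unfolding a_def b_def .
qed

text \<open>The covering statement normalised to \<open>w = 1\<close>: \<open>z\<close> stands for
  \<open>u\<close>, \<open>S\<close> for the shifted fibre coordinate, and the last inequality says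
  that the point lies in the unit disc over \<open>z\<close>. The root of order \<open>12 l\<close>
  is taken in two stages: an \<open>l\<close>-th root \<open>Z\<close> of \<zeta> that keeps the
  multiplier large, then a twelfth root of \<open>Z\<close> that puts the centre of the disc near
  the target.\<close>

lemma affine_covering:
  fixes \<zeta> t :: complex and \<delta> :: real
  assumes l: "l \<ge> 900" and \<delta>: "0 < \<delta>" "\<delta> * 2 ^ (12 * l) \<le> 1/1000"
    and \<zeta>: "1/10 < norm \<zeta>" "norm \<zeta> < 10" and t: "(norm t)\<^sup>2 < 1 + (norm \<zeta>)\<^sup>2"
  obtains z S where "z ^ (12 * l) = \<zeta>" "norm (z + 1) / 10 < norm (z - 1)" "norm (z - 1) / 10 < norm (z + 1)"
    "7/10 * (1 + z ^ (12 * l - 12)) * S + of_real \<delta> * S ^ (12 * l) = t"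
    "(norm (S - 7/10 * z))\<^sup>2 < (1 + (norm z)\<^sup>2) / 2"
proof -
  have \<zeta>0: "\<zeta> \<noteq> 0" using \<zeta> by auto
  have "norm (\<zeta> / of_real (norm \<zeta>)) = 1" using \<zeta>0 by (simp add: norm_divide)
  then obtain Z where Z: "Z ^ l = \<zeta>" "Re (Z * cnj (\<zeta> / of_real (norm \<zeta>))) \<ge> sqrt 3 / 2 * norm Z"
    using roots_near_direction[of l "\<zeta> / of_real (norm \<zeta>)" \<zeta>] l by auto
  have Z0: "Z \<noteq> 0" using Z(1) \<zeta>0 l by (auto simp: power_0_left)
  have Zl: "norm Z ^ l = norm \<zeta>" using Z(1) by (metis norm_power)
  \<comment> \<open>The bound \<open>900\<close> on \<open>l\<close> comes from here: Bernoulli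
    gives \<open>(1 + 1/100)^l \<ge> 1 + 9 = 10\<close>.\<close>
  have Zup: "norm Z \<le> 101/100"
  proof (rule ccontr)
    assume "\<not> ?thesis"
    then have "(1 + 1/100) ^ l \<le> norm Z ^ l" by (intro power_mono) auto
    moreover have "1 + real l * (1/100) \<le> (1 + 1/100) ^ l" by (rule Bernoulli_inequality) simp
    ultimately show False using Zl \<zeta> l by simp
  qed
  have Zlo: "norm Z \<ge> 99/100"
  proof (rule ccontr)
    assume "\<not> ?thesis"
    then have "norm Z * (1 + 1/100) \<le> 1" by simp
    then have "(norm Z * (1 + 1/100)) ^ l \<le> 1" by (intro power_le_one) auto
    then have "norm \<zeta> * (1 + 1/100) ^ l \<le> 1" by (simp only: power_mult_distrib Zl)
    moreover have "1 + real l * (1/100) \<le> (1 + 1/100) ^ l" by (rule Bernoulli_inequality) simp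
    then have "norm \<zeta> * 10 \<le> norm \<zeta> * (1 + 1/100) ^ l" using l by (intro mult_left_mono) auto
    ultimately show False using \<zeta>(1) by simp
  qed
  \<comment> \<open>\<open>Z\<close> points roughly in the direction of \<zeta>, so the two summands
    of \<open>1 + \<zeta> / Z\<close> do not cancel.\<close>
  have ReZ: "Re (\<zeta> / Z) \<ge> 0"
  proof -
    have "0 \<le> Re (Z * cnj (\<zeta> / of_real (norm \<zeta>)))" using Z(2) by (smt (verit) mult_nonneg_nonneg norm_ge_zero real_sqrt_ge_zero divide_nonneg_nonneg)
    also have "Re (Z * cnj (\<zeta> / of_real (norm \<zeta>))) = Re (\<zeta> * cnj Z) / norm \<zeta>"
      by (simp add: divide_simps)
    finally have "0 \<le> Re (\<zeta> * cnj Z)" using \<zeta>0 by (simp add: zero_le_divide_iff)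
    then show ?thesis by (simp add: complex_div_cnj[of \<zeta> Z] Re_divide_of_real zero_le_divide_iff flip: of_real_power)
  qed
  \<comment> \<open>The common multiplier: \<open>z ^ (12 * l - 12) = \<zeta> / Z\<close> for each
    twelfth root \<open>z\<close> of \<open>Z\<close>.\<close>
  define g where "g = 7/10 * (1 + \<zeta> / Z)"
  have g2: "(norm g)\<^sup>2 \<ge> 49/100 * ((1 + (norm \<zeta>)\<^sup>2) / (101/100)\<^sup>2)"
  proof -
    have "(norm (1 + \<zeta> / Z))\<^sup>2 = 1 + 2 * Re (\<zeta> / Z) + (norm (\<zeta> / Z))\<^sup>2"
      unfolding cmod_power2 by (simp add: power2_eq_square algebra_simps)
    then have "(norm (1 + \<zeta> / Z))\<^sup>2 \<ge> 1 + (norm \<zeta>)\<^sup>2 / (norm Z)\<^sup>2"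
      using ReZ by (simp add: norm_divide power_divide)
    moreover have "(norm \<zeta>)\<^sup>2 / (norm Z)\<^sup>2 \<ge> (norm \<zeta>)\<^sup>2 / (101/100)\<^sup>2"
      using Zup Z0 by (intro divide_left_mono power_mono mult_pos_pos) auto
    moreover have one: "1 / (101/100)\<^sup>2 \<le> (1::real)" by (simp add: power2_eq_square)
    ultimately have "(norm (1 + \<zeta> / Z))\<^sup>2 \<ge> (1 + (norm \<zeta>)\<^sup>2) / (101/100)\<^sup>2"
      using add_divide_distrib[of 1 "(norm \<zeta>)\<^sup>2" "(101/100)\<^sup>2"] one by linarith
    moreover have "(norm g)\<^sup>2 = 49/100 * (norm (1 + \<zeta> / Z))\<^sup>2"
      unfolding g_def norm_mult power_mult_distrib by (simp add: power2_eq_square)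
    ultimately show ?thesis by linarith
  qed
  have g3: "(norm g)\<^sup>2 * 10201 \<ge> 4900 + 4900 * (norm \<zeta>)\<^sup>2"
    using g2 by (simp add: power_divide)
  have n0: "0 \<le> (norm \<zeta>)\<^sup>2" by simp
  have g1: "norm g \<ge> 69/100"
  proof (rule power2_le_imp_le)
    have "4761 \<le> (norm g)\<^sup>2 * 10000" using g3 n0 by linarith
    then show "(69/100)\<^sup>2 \<le> (norm g)\<^sup>2" by (simp add: power_divide)
  qed auto
  then have g0: "g \<noteq> 0" by auto
  \<comment> \<open>The solution without the \<delta> term. Its bound \<open>145/100\<close> is
    slightly above \<open>101/70\<close>, the reciprocal of \<open>7/10\<close> divided by
    \<open>101/100\<close>.\<close>
  define S0 where "S0 = t / g"
  have S0: "norm S0 \<le> 145/100"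
  proof (rule power2_le_imp_le)
    have "(norm t)\<^sup>2 * 10000 \<le> 21025 * (norm g)\<^sup>2"
      using t g3 zero_le_power2[of "norm g"] by linarith
    then have "(norm t)\<^sup>2 \<le> (145/100)\<^sup>2 * (norm g)\<^sup>2" by (simp add: power_divide)
    then show "(norm S0)\<^sup>2 \<le> (145/100)\<^sup>2" using g0 by (simp add: S0_def norm_divide power_divide divide_le_eq)
  qed auto
  define u where "u = (if S0 = 0 then 1 else S0 / of_real (norm S0))"
  have u: "norm u = 1" "S0 = of_real (norm S0) * u" by (auto simp: u_def norm_divide)
  obtain z1 where z1: "z1 ^ 12 = Z" "(z1 * cis (2 * pi / 12)) ^ 12 = Z"
    "Re (z1 * cnj u) \<ge> sqrt 3 / 2 * norm z1"
    "Re (z1 * cis (2 * pi / 12) * cnj u) \<ge> sqrt 3 / 2 * norm z1"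
    using roots_near_direction[OF _ u(1), of 12 Z] by auto
  define z2 where "z2 = z1 * cis (pi / 6)"
  have r12: "norm z1 ^ 12 = norm Z" using z1(1) by (metis norm_power)
  have rup: "norm z1 \<le> 101/100"
  proof (rule ccontr)
    assume n: "\<not> ?thesis"
    then have "(101/100) ^ 12 \<le> norm z1 ^ 12" by (intro power_mono) auto
    then show False using r12 Zup by (simp add: power_divide)
  qed
  have rlo: "norm z1 \<ge> 99/100"
  proof (rule ccontr)
    assume n: "\<not> ?thesis"
    then have "norm z1 ^ 12 \<le> (99/100) ^ 12" by (intro power_mono) auto
    then show False using r12 Zlo by (simp add: power_divide)
  qed
  have z2n: "norm z2 = norm z1" by (simp add: z2_def norm_mult)
  have s3: "173/100 \<le> sqrt 3" "sqrt 3 \<le> 1733/1000"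
    by (rule real_le_rsqrt, simp add: power_divide, rule real_le_lsqrt, simp_all add: power_divide)
  have dist12: "(norm (z1 - z2))\<^sup>2 = (norm z1)\<^sup>2 * (2 - sqrt 3)"
  proof -
    have "z1 - z2 = z1 * (1 - cis (pi / 6))" by (simp add: z2_def algebra_simps)
    moreover have "(norm (1 - cis (pi / 6)))\<^sup>2 = 2 - sqrt 3"
      unfolding cmod_power2 by (simp add: cos_30 sin_30 power2_eq_square algebra_simps)
    ultimately show ?thesis by (simp add: norm_mult power_mult_distrib)
  qed
  have rr: "(norm z1)\<^sup>2 \<ge> 98/100" "(norm z1)\<^sup>2 \<le> 1021/1000"
    using power_mono[OF rlo, of 2] power_mono[OF rup, of 2] by (auto simp: power2_eq_square)
  have d_lo: "norm (z1 - z2) > 1/2"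
  proof (rule power2_less_imp_less)
    have "98/100 * (2 - 1733/1000) \<le> (norm z1)\<^sup>2 * (2 - sqrt 3)"
      using rr s3 by (intro mult_mono) auto
    then show "(1/2)\<^sup>2 < (norm (z1 - z2))\<^sup>2" unfolding dist12 by (simp add: power2_eq_square)
  qed auto
  have d_hi: "norm (z1 - z2) < 1"
  proof (rule power2_less_imp_less)
    have "(norm z1)\<^sup>2 * (2 - sqrt 3) \<le> 1021/1000 * (2 - 173/100)"
      using rr s3 by (intro mult_mono) auto
    then show "(norm (z1 - z2))\<^sup>2 < 1\<^sup>2" unfolding dist12 by (simp add: power2_eq_square)
  qed auto
  have bad: "norm (z - 1) \<le> 21/100 \<or> norm (z + 1) \<le> 21/100"
    if "norm z = norm z1" "\<not> (norm (z + 1) / 10 < norm (z - 1) \<and> norm (z - 1) / 10 < norm (z + 1))" for z :: complex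
    using that norm_triangle_ineq[of z 1] norm_triangle_ineq4[of z 1] rup by auto
  \<comment> \<open>A vertex violating the condition is within \<open>21/100\<close> of
    \<open>1\<close> or of \<open>-1\<close>. Two such vertices would be at distance at most
    \<open>42/100\<close> or at least \<open>2 - 42/100\<close>, whereas adjacent ones are between
    \<open>1/2\<close> and \<open>1\<close> apart.\<close>
  have "\<exists>z\<in>{z1,z2}. norm (z + 1) / 10 < norm (z - 1) \<and> norm (z - 1) / 10 < norm (z + 1)"
  proof (rule ccontr)
    assume "\<not> ?thesis"
    then have "norm (z1 - 1) \<le> 21/100 \<or> norm (z1 + 1) \<le> 21/100" "norm (z2 - 1) \<le> 21/100 \<or> norm (z2 + 1) \<le> 21/100"
      using bad[of z1] bad[of z2] z2n by auto
    moreover have "norm (z1 - z2) \<le> norm (z1 - c) + norm (z2 - c)" for c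
      using norm_triangle_ineq4[of "z1 - c" "z2 - c"] by simp
    from this[of 1] this[of "-1"]
    have "norm (z1 - z2) \<le> norm (z1 - 1) + norm (z2 - 1)" "norm (z1 - z2) \<le> norm (z1 + 1) + norm (z2 + 1)" by auto
    moreover have "2 \<le> norm (z1 - z2) + norm (z1 - 1) + norm (z2 + 1)"
      using norm_triangle_ineq4[of "z2 + 1" "z2 - 1"] norm_triangle_ineq[of "z1 - 1" "z2 - z1"]
      by (simp add: norm_minus_commute)
    moreover have "2 \<le> norm (z1 - z2) + norm (z1 + 1) + norm (z2 - 1)"
      using norm_triangle_ineq4[of "z2 + 1" "z2 - 1"] norm_triangle_ineq[of "z1 + 1" "z2 - z1"]
      by (simp add: norm_minus_commute add.commute)
    ultimately show False using d_lo d_hi by auto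
  qed
  then obtain z where z: "z \<in> {z1, z2}" "norm (z + 1) / 10 < norm (z - 1)" "norm (z - 1) / 10 < norm (z + 1)" by auto
  have zn: "norm z = norm z1" "z ^ 12 = Z" "Re (z * cnj u) \<ge> sqrt 3 / 2 * norm z1"
    using z(1) z1 z2n by (auto simp: z2_def)
  \<comment> \<open>Law of cosines with an angle of at most \<open>pi / 6\<close>. The resulting
    quadratic in \<open>norm S0\<close> is estimated on the interval up to \<open>145/100\<close>;
    its value at that end is just below \<open>865/1000\<close>.\<close>
  have near: "(norm (S0 - 7/10 * z))\<^sup>2 \<le> 865/1000"
  proof -
    have "(norm (S0 - 7/10 * z))\<^sup>2 = (norm S0)\<^sup>2 + 49/100 * (norm z1)\<^sup>2 - 14/10 * Re (S0 * cnj z)"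
      unfolding zn(1)[symmetric] cmod_power2 by (simp add: power2_eq_square algebra_simps)
    also have "Re (S0 * cnj z) = norm S0 * Re (z * cnj u)"
      by (subst u(2)) (simp add: algebra_simps)
    also have "norm S0 * Re (z * cnj u) \<ge> norm S0 * (173/200 * (99/100))"
    proof (intro mult_left_mono)
      have "173/200 * (99/100) \<le> sqrt 3 / 2 * norm z1" using s3 rlo by (intro mult_mono) auto
      then show "173/200 * (99/100) \<le> Re (z * cnj u)" using zn(3) by linarith
    qed auto
    then have "(norm S0)\<^sup>2 + 49/100 * (norm z1)\<^sup>2 - 14/10 * (norm S0 * Re (z * cnj u))
       \<le> (norm S0)\<^sup>2 + 49/100 * (1021/1000) - 14/10 * (norm S0 * (173/200 * (99/100)))"
      using rr by linarith
    also have "\<dots> \<le> 865/1000"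
    proof -
      have "(norm S0)\<^sup>2 \<le> 145/100 * norm S0" unfolding power2_eq_square using S0 by (rule mult_right_mono) simp
      then show ?thesis using S0 by (simp add: algebra_simps)
    qed
    finally show ?thesis .
  qed
  have near': "norm (S0 - 7/10 * z) \<le> 94/100"
    by (rule power2_le_imp_le) (use near in \<open>auto simp: power2_eq_square\<close>)
  define k where "k = 12 * l"
  \<comment> \<open>The \<delta> term moves the solution only slightly. As
    \<open>norm S \<le> 2\<close> on this ball, the perturbation is at most
    \<open>1/1000 / (69/100)\<close>, and Brouwer's theorem applies.\<close>
  have "\<exists>S\<in>cball S0 (1/20). (t - of_real \<delta> * S ^ k) / g = S"
  proof (rule brouwer_ball[of "1/20" S0 "\<lambda>S. (t - of_real \<delta> * S ^ k) / g"])
    show "continuous_on (cball S0 (1/20)) (\<lambda>S. (t - of_real \<delta> * S ^ k) / g)"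
      using g0 by (intro continuous_intros) auto
    show "(\<lambda>S. (t - of_real \<delta> * S ^ k) / g) \<in> cball S0 (1/20) \<rightarrow> cball S0 (1/20)"
    proof
      fix S assume "S \<in> cball S0 (1/20)"
      then have "norm S \<le> 2" using S0 norm_triangle_sub[of S S0] by (simp add: dist_norm norm_minus_commute)
      then have "norm S ^ k \<le> 2 ^ k" by (intro power_mono) auto
      then have "\<delta> * norm S ^ k \<le> 1/1000" using \<delta> by (smt (verit) k_def mult_left_mono)
      then have "\<delta> * norm S ^ k / norm g \<le> 1/1000 / (69/100)" using g1 \<delta> by (intro frac_le) auto
      moreover have "dist S0 ((t - of_real \<delta> * S ^ k) / g) = \<delta> * norm S ^ k / norm g"
        using \<delta> by (simp add: dist_norm S0_def diff_divide_distrib norm_divide norm_mult norm_power)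
      ultimately show "(t - of_real \<delta> * S ^ k) / g \<in> cball S0 (1/20)" by simp
    qed
  qed auto
  then obtain S where S: "dist S0 S \<le> 1/20" "(t - of_real \<delta> * S ^ k) / g = S" by auto
  have zk: "z ^ k = \<zeta>" by (simp add: k_def power_mult zn(2) Z(1))
  have zk12: "z ^ (k - 12) = \<zeta> / Z"
  proof -
    have "z ^ (k - 12) * z ^ 12 = z ^ k" using l by (simp add: k_def flip: power_add)
    then show ?thesis using Z0 by (simp add: zn(2) zk field_simps)
  qed
  show ?thesis
  proof (rule that[of z S])
    show "z ^ (12 * l) = \<zeta>" using zk by (simp add: k_def)
    show "norm (z + 1) / 10 < norm (z - 1)" "norm (z - 1) / 10 < norm (z + 1)" using z by auto
    have "g * S = t - of_real \<delta> * S ^ k" using S(2) g0 by (metis nonzero_mult_div_cancel_left times_divide_eq_right)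
    then have "g * S + of_real \<delta> * S ^ k = t" by simp
    moreover have "7/10 * (1 + z ^ (k - 12)) = g" by (simp only: g_def zk12)
    ultimately show "7/10 * (1 + z ^ (12 * l - 12)) * S + of_real \<delta> * S ^ (12 * l) = t"
      unfolding k_def by simp
    have "norm (S - 7/10 * z) \<le> 94/100 + 1/20"
      using norm_triangle_ineq[of "S - S0" "S0 - 7/10 * z"] near' S(1) by (simp add: dist_norm norm_minus_commute)
    then have "(norm (S - 7/10 * z))\<^sup>2 \<le> (99/100)\<^sup>2" by (intro power_mono) auto
    also have "\<dots> < (1 + (norm z)\<^sup>2) / 2" using rr unfolding zn(1) by (simp add: power2_eq_square)
    finally show "(norm (S - 7/10 * z))\<^sup>2 < (1 + (norm z)\<^sup>2) / 2" .
  qed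
qed

section \<open>The projective plane\<close>

lemma smult3_simp [simp]: "smult3 c (x, y, t) = (c * x, c * y, c * t)"
  by (simp add: smult3_def)

lemma smult3_smult3: "smult3 a (smult3 b v) = smult3 (a * b) v"
  by (simp add: smult3_def)

lemma smult3_one [simp]: "smult3 1 v = v"
  by (simp add: smult3_def)

lemma smult3_eq_0_iff: "smult3 c v = 0 \<longleftrightarrow> c = 0 \<or> v = 0"
  by (cases v) (auto simp: zero_prod_def)

lemma norm_smult3: "norm (smult3 c v) = norm c * norm v"
proof -
  have e: "(norm c)\<^sup>2 * a + ((norm c)\<^sup>2 * b + (norm c)\<^sup>2 * d) = (norm c)\<^sup>2 * (a + (b + d))" for a b d
    by (simp add: algebra_simps)
  show ?thesis
    by (cases v) (simp add: norm_Pair norm_mult power_mult_distrib e real_sqrt_mult)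
qed

lemma cline_smult3: "c \<noteq> 0 \<Longrightarrow> cline (smult3 c v) = cline v"
proof -
  assume c: "c \<noteq> 0"
  have "\<exists>b'. smult3 b v = smult3 (b' * c) v \<and> b' \<noteq> 0" if "b \<noteq> 0" for b
    using c that by (intro exI[of _ "b / c"]) auto
  then show ?thesis using c unfolding cline_def
    by (auto simp: smult3_smult3)
qed

lemma proj_eq_iff:
  assumes "v \<noteq> 0" "w \<noteq> 0"
  shows "proj v = proj w \<longleftrightarrow> (\<exists>c. c \<noteq> 0 \<and> w = smult3 c v)"
proof
  assume "proj v = proj w"
  then have "cline v = cline w"
    unfolding proj_def by (subst (asm) Abs_cp2_inject) (use assms in blast)+
  moreover have "w \<in> cline w" by (auto simp: cline_def intro!: exI[of _ 1])
  ultimately show "\<exists>c. c \<noteq> 0 \<and> w = smult3 c v" by (auto simp: cline_def)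
next
  assume "\<exists>c. c \<noteq> 0 \<and> w = smult3 c v"
  then show "proj v = proj w" by (auto simp: proj_def cline_smult3)
qed

lemma proj_smult3: "c \<noteq> 0 \<Longrightarrow> proj (smult3 c v) = proj v"
  by (simp add: proj_def cline_smult3)

lemma cp2_cases: obtains v where "v \<noteq> 0" "p = proj v"
  using Rep_cp2[of p] Rep_cp2_inverse[of p] unfolding proj_def by auto

lemma open_proj_image:
  assumes "open S" "0 \<notin> S" "\<And>c v. c \<noteq> 0 \<Longrightarrow> v \<in> S \<Longrightarrow> smult3 c v \<in> S"
  shows "open (proj ` S)"
proof -
  have "{v. v \<noteq> 0 \<and> proj v \<in> proj ` S} = S"
  proof safe
    fix v w assume "v \<noteq> 0" "w \<in> S" "proj v = proj w"
    then show "v \<in> S" using assms(2,3) proj_eq_iff[of w v] by metis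
  qed (use assms(2) in auto)
  then show ?thesis using assms(1) by (simp add: open_cp2_def)
qed

lemma continuous_on_proj: "continuous_on (- {0}) proj"
  unfolding continuous_on_open_vimage[OF open_Compl[OF closed_singleton]]
proof safe
  fix B :: "cp2 set" assume "open B"
  moreover have "proj -` B \<inter> - {0} = {v. v \<noteq> 0 \<and> proj v \<in> B}" by auto
  ultimately show "open (proj -` B \<inter> - {0})" by (simp add: open_cp2_def)
qed

text \<open>The sum \<open>n u\<close> of the moduli of the 2 by 2 minors of \<open>u\<close> and
  \<open>v\<close> measures how far \<open>u\<close> is from the line of \<open>v\<close>. The
  quotient \<open>n u / norm u\<close> is constant on punctured lines, zero at \<open>v\<close> and
  positive at \<open>w\<close>, so half its value at \<open>w\<close> separates two open
  cones.\<close>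

instance cp2 :: t2_space
proof
  fix p q :: cp2 assume pq: "p \<noteq> q"
  obtain v where v: "v \<noteq> 0" "p = proj v" by (rule cp2_cases)
  obtain w where w: "w \<noteq> 0" "q = proj w" by (rule cp2_cases)
  define n :: "c3 \<Rightarrow> real" where "n = (\<lambda>u. norm (fst u * fst (snd v) - fst (snd u) * fst v)
     + norm (fst u * snd (snd v) - snd (snd u) * fst v)
     + norm (fst (snd u) * snd (snd v) - snd (snd u) * fst (snd v)))"
  have n_smult: "n (smult3 c u) = norm c * n u" for c u
    by (simp add: n_def smult3_def mult.assoc norm_mult ring_distribs flip: right_diff_distrib)
  have cont: "continuous_on UNIV n" unfolding n_def by (intro continuous_intros)
  have nv: "n v = 0" by (simp add: n_def mult.commute)
  have "n w \<noteq> 0"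
  proof
    assume "n w = 0"
    then have m: "fst w * fst (snd v) = fst (snd w) * fst v" "fst w * snd (snd v) = snd (snd w) * fst v"
        "fst (snd w) * snd (snd v) = snd (snd w) * fst (snd v)"
      unfolding n_def by (smt (verit) norm_ge_zero norm_eq_zero right_minus_eq)+
    have "\<exists>c. w = smult3 c v"
    proof -
      consider "fst v \<noteq> 0" | "fst (snd v) \<noteq> 0" | "snd (snd v) \<noteq> 0"
        using v(1) by (auto simp: prod_eq_iff)
      then show ?thesis
      proof cases
        case 1 then show ?thesis using m
          by (intro exI[of _ "fst w / fst v"]) (auto simp: smult3_def prod_eq_iff field_simps)
      next
        case 2 then show ?thesis using m
          by (intro exI[of _ "fst (snd w) / fst (snd v)"]) (auto simp: smult3_def prod_eq_iff field_simps)
      next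
        case 3 then show ?thesis using m
          by (intro exI[of _ "snd (snd w) / snd (snd v)"]) (auto simp: smult3_def prod_eq_iff field_simps)
      qed
    qed
    then obtain c where "w = smult3 c v" by blast
    then show False using w v pq proj_eq_iff[OF v(1) w(1)] smult3_eq_0_iff by metis
  qed
  then have nw: "n w > 0" by (simp add: n_def less_le)
  define e where "e = n w / (2 * norm w)"
  have e: "e > 0" "e * norm w < n w" using nw w(1) by (auto simp: e_def)
  define S where "S = {u. n u < e * norm u}"
  define T where "T = {u. e * norm u < n u}"
  have "open (proj ` S)"
  proof (rule open_proj_image)
    show "open S" unfolding S_def using cont by (intro open_Collect_less continuous_intros)
    show "0 \<notin> S" by (simp add: S_def n_def)
    show "smult3 c u \<in> S" if "c \<noteq> 0" "u \<in> S" for c u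
      using that by (simp add: S_def n_smult norm_smult3 mult.left_commute[of e])
  qed
  moreover have "open (proj ` T)"
  proof (rule open_proj_image)
    show "open T" unfolding T_def using cont by (intro open_Collect_less continuous_intros)
    show "0 \<notin> T" by (simp add: T_def n_def)
    show "smult3 c u \<in> T" if "c \<noteq> 0" "u \<in> T" for c u
      using that by (simp add: T_def n_smult norm_smult3 mult.left_commute[of e])
  qed
  moreover have "p \<in> proj ` S" using v e nv by (auto simp: S_def)
  moreover have "q \<in> proj ` T" using w e by (auto simp: T_def)
  moreover have "proj ` S \<inter> proj ` T = {}"
  proof safe
    fix a b assume ab: "a \<in> S" "b \<in> T" "proj a = proj b"
    have "a \<noteq> 0" "b \<noteq> 0" using ab by (auto simp: S_def T_def n_def)
    then obtain c where "c \<noteq> 0" "b = smult3 c a" using ab(3) proj_eq_iff by metis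
    then show "proj a \<in> {}" using ab by (simp add: S_def T_def n_smult norm_smult3 mult.left_commute[of e])
  qed
  ultimately show "\<exists>U V. open U \<and> open V \<and> p \<in> U \<and> q \<in> V \<and> U \<inter> V = {}" by blast
qed

section \<open>Maps induced by homogeneous lifts, and homogeneous polynomials\<close>

definition induced :: "(c3 \<Rightarrow> c3) \<Rightarrow> cp2 \<Rightarrow> cp2" where
  "induced F p = proj (F (SOME v. v \<noteq> 0 \<and> proj v = p))"

definition homogeneous :: "nat \<Rightarrow> (c3 \<Rightarrow> c3) \<Rightarrow> bool" where
  "homogeneous d F \<longleftrightarrow> (\<forall>v. v \<noteq> 0 \<longrightarrow> F v \<noteq> 0) \<and> (\<forall>c v. F (smult3 c v) = smult3 (c ^ d) (F v))"

lemma induced_proj: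
  assumes "homogeneous d F" "v \<noteq> 0"
  shows "induced F (proj v) = proj (F v)"
proof -
  define w where "w = (SOME w. w \<noteq> 0 \<and> proj w = proj v)"
  have w: "w \<noteq> 0" "proj w = proj v"
    using someI_ex[of "\<lambda>w. w \<noteq> 0 \<and> proj w = proj v"] assms(2) unfolding w_def by blast+
  then obtain c where c: "c \<noteq> 0" "v = smult3 c w" using proj_eq_iff assms(2) by metis
  then have "F v = smult3 (c ^ d) (F w)" using assms(1) unfolding homogeneous_def by metis
  then have "proj (F v) = proj (F w)" using c by (simp add: proj_smult3)
  then show ?thesis by (simp add: induced_def w_def)
qed

lemma funpow_nonzero: "homogeneous d F \<Longrightarrow> v \<noteq> 0 \<Longrightarrow> (F ^^ n) v \<noteq> 0"
  by (induction n) (simp_all add: homogeneous_def del: split_paired_All)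

lemma induced_funpow_proj:
  assumes "homogeneous d F" "v \<noteq> 0"
  shows "(induced F ^^ n) (proj v) = proj ((F ^^ n) v)"
proof (induction n)
  case (Suc n)
  then show ?case using induced_proj[OF assms(1) funpow_nonzero[OF assms, of n]] by simp
qed auto

lemma continuous_induced_funpow:
  assumes F: "homogeneous d F" "continuous_on UNIV F"
  shows "continuous_on UNIV (induced F ^^ n)"
proof -
  have contn: "continuous_on UNIV (F ^^ n)"
  proof (induction n)
    case (Suc n)
    then show ?case
      using continuous_on_compose2[OF F(2) Suc] by (simp add: o_def)
  qed (auto simp: continuous_on_id id_def)
  show ?thesis
    unfolding continuous_on_open_vimage[OF open_UNIV]
  proof safe
    fix B :: "cp2 set" assume B: "open B"
    have "{v. v \<noteq> 0 \<and> proj v \<in> (induced F ^^ n) -` B} = - {0} \<inter> (F ^^ n) -` {v. v \<noteq> 0 \<and> proj v \<in> B}"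
      using induced_funpow_proj[OF F(1)] funpow_nonzero[OF F(1)] by auto
    moreover have "open ((F ^^ n) -` {v. v \<noteq> 0 \<and> proj v \<in> B})"
      using B contn by (intro open_vimage) (auto simp: open_cp2_def continuous_on_eq_continuous_at)
    ultimately show "open ((induced F ^^ n) -` B \<inter> UNIV)"
      by (simp add: open_cp2_def open_Int open_Compl)
  qed
qed

text \<open>Speaks about values instead of coefficient families, so that closure under sums,
  products and powers replaces an explicit expansion of the map.\<close>

definition hpoly :: "nat \<Rightarrow> (c3 \<Rightarrow> complex) \<Rightarrow> bool" where
  "hpoly d g \<longleftrightarrow> (\<exists>a. \<forall>v. heval d a v = g v)"

lemma finite_hmonos: "finite (hmonos d)"
  by (rule finite_subset[of _ "{..d} \<times> {..d} \<times> {..d}"]) (auto simp: hmonos_def)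

lemma heval_indicator:
  assumes "i + j + k = d"
  shows "heval d (\<lambda>m. if m = (i, j, k) then 1 else 0) v = fst v ^ i * fst (snd v) ^ j * snd (snd v) ^ k"
proof -
  have "heval d (\<lambda>m. if m = (i, j, k) then 1 else 0) v =
     (\<Sum>m\<in>hmonos d. if m = (i, j, k) then fst v ^ i * fst (snd v) ^ j * snd (snd v) ^ k else 0)"
    unfolding heval_def
  proof (intro sum.cong refl)
    fix m :: "nat \<times> nat \<times> nat"
    show "(case m of (i', j', k') \<Rightarrow> (if (i', j', k') = (i, j, k) then 1 else 0) * fst v ^ i' * fst (snd v) ^ j' * snd (snd v) ^ k')
      = (if m = (i, j, k) then fst v ^ i * fst (snd v) ^ j * snd (snd v) ^ k else 0)"
      by (cases "m = (i, j, k)"; cases m) auto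
  qed
  then show ?thesis using assms by (simp add: sum.delta[OF finite_hmonos]) (simp add: hmonos_def)
qed

lemma hpoly_monom: "i + j + k = d \<Longrightarrow> hpoly d (\<lambda>v. fst v ^ i * fst (snd v) ^ j * snd (snd v) ^ k)"
  unfolding hpoly_def using heval_indicator by blast

lemma heval_add: "heval d (\<lambda>m. a m + b m) v = heval d a v + heval d b v"
  unfolding heval_def sum.distrib[symmetric] by (intro sum.cong refl) (auto simp: ring_distribs)

lemma heval_cmult: "heval d (\<lambda>m. c * a m) v = c * heval d a v"
  unfolding heval_def sum_distrib_left by (intro sum.cong refl) (auto simp: mult.assoc)

lemma hpoly_add: "hpoly d g \<Longrightarrow> hpoly d h \<Longrightarrow> hpoly d (\<lambda>v. g v + h v)"
  unfolding hpoly_def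
  by (elim exE, rule_tac x = "\<lambda>m. a m + aa m" in exI) (simp add: heval_add del: split_paired_All)

lemma hpoly_cmult: "hpoly d g \<Longrightarrow> hpoly d (\<lambda>v. c * g v)"
  unfolding hpoly_def
  by (elim exE, rule_tac x = "\<lambda>m. c * a m" in exI) (simp add: heval_cmult del: split_paired_All)

lemma hpoly_sum: "finite I \<Longrightarrow> (\<And>i. i \<in> I \<Longrightarrow> hpoly d (g i)) \<Longrightarrow> hpoly d (\<lambda>v. \<Sum>i\<in>I. g i v)"
proof (induction I rule: finite_induct)
  case empty
  show ?case unfolding hpoly_def by (intro exI[of _ "\<lambda>_. 0"]) (auto simp: heval_def intro!: sum.neutral)
next
  case (insert x I)
  then show ?case using hpoly_add[of d "g x" "\<lambda>v. \<Sum>i\<in>I. g i v"] by simp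
qed

lemma hpoly_mult:
  assumes "hpoly d g" "hpoly e h"
  shows "hpoly (d + e) (\<lambda>v. g v * h v)"
proof -
  obtain a b where ab: "\<And>v. heval d a v = g v" "\<And>v. heval e b v = h v"
    using assms unfolding hpoly_def by blast
  have "hpoly (d + e) (\<lambda>v. \<Sum>m\<in>hmonos d. \<Sum>n\<in>hmonos e. 
      (case m of (i,j,k) \<Rightarrow> a (i,j,k) * fst v ^ i * fst (snd v) ^ j * snd (snd v) ^ k) *
      (case n of (i,j,k) \<Rightarrow> b (i,j,k) * fst v ^ i * fst (snd v) ^ j * snd (snd v) ^ k))"
  proof (intro hpoly_sum finite_hmonos)
    fix m n assume mn: "m \<in> hmonos d" "n \<in> hmonos e"
    obtain i j k where m: "m = (i,j,k)" by (cases m)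
    obtain i' j' k' where n: "n = (i',j',k')" by (cases n)
    have "hpoly (d + e) (\<lambda>v. (a m * b n) * (fst v ^ (i + i') * fst (snd v) ^ (j + j') * snd (snd v) ^ (k + k')))"
      using mn by (intro hpoly_cmult hpoly_monom) (auto simp: m n hmonos_def)
    then show "hpoly (d + e) (\<lambda>v. (case m of (i,j,k) \<Rightarrow> a (i,j,k) * fst v ^ i * fst (snd v) ^ j * snd (snd v) ^ k) *
      (case n of (i,j,k) \<Rightarrow> b (i,j,k) * fst v ^ i * fst (snd v) ^ j * snd (snd v) ^ k))"
      by (simp add: m n power_add mult_ac)
  qed
  then show ?thesis by (simp add: ab[symmetric] heval_def sum_product)
qed

lemma hpoly_power: "hpoly 1 g \<Longrightarrow> hpoly n (\<lambda>v. g v ^ n)"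
proof (induction n)
  case 0
  show ?case using hpoly_monom[of 0 0 0 0] by simp
next
  case (Suc n)
  then show ?case using hpoly_mult[of 1 g n "\<lambda>v. g v ^ n"] by simp
qed

lemma hpoly_linear: "hpoly 1 (\<lambda>v. a * fst v + b * fst (snd v) + c * snd (snd v))"
proof -
  have 1: "hpoly 1 (\<lambda>v. fst v)" and 2: "hpoly 1 (\<lambda>v. fst (snd v))" and 3: "hpoly 1 (\<lambda>v. snd (snd v))"
    using hpoly_monom[of 1 0 0 1] hpoly_monom[of 0 1 0 1] hpoly_monom[of 0 0 1 1] by simp_all
  show ?thesis
    by (rule hpoly_add[OF hpoly_add[OF hpoly_cmult[OF 1] hpoly_cmult[OF 2]] hpoly_cmult[OF 3]])
qed

text \<open>Every line in question meets the slice \<open>norm (x, y) = 1\<close>, which is compact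
  because the last coordinate is bounded there.\<close>

lemma compact_disc_bundle:
  "compact (proj ` {v. (fst v, fst (snd v)) \<noteq> 0 \<and> norm (snd (snd v)) \<le> \<rho> * norm (fst v, fst (snd v))})"
proof -
  define S where "S = {v :: c3. norm (fst v, fst (snd v)) = 1} \<inter> {v. norm (snd (snd v)) \<le> \<rho>}"
  have "compact S"
    unfolding compact_eq_bounded_closed
  proof
    show "closed S" unfolding S_def
      by (intro closed_Int closed_Collect_eq closed_Collect_le continuous_intros)
    have "norm v \<le> 1 + (1 + \<rho>)" if vS: "v \<in> S" for v
    proof -
      obtain x y t where v: "v = (x, y, t)" by (cases v)
      have "norm (x, y) = 1" "norm t \<le> \<rho>" using vS by (auto simp: S_def v)
      moreover have "norm x \<le> norm (x, y)" "norm y \<le> norm (x, y)"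
        using norm_fst_le[of x y] norm_snd_le[of y x] by auto
      moreover have "norm (x, y, t) \<le> norm x + (norm y + norm t)"
        using norm_Pair_le[of x "(y, t)"] norm_Pair_le[of y t] by simp
      ultimately show ?thesis unfolding v by linarith
    qed
    then show "bounded S" unfolding bounded_iff by blast
  qed
  moreover have "0 \<notin> S" by (auto simp: S_def)
  ultimately have "compact (proj ` S)"
    by (intro compact_continuous_image continuous_on_subset[OF continuous_on_proj]) auto
  moreover have "proj ` {v. (fst v, fst (snd v)) \<noteq> 0 \<and> norm (snd (snd v)) \<le> \<rho> * norm (fst v, fst (snd v))} = proj ` S"
  proof safe
    fix x y t assume a: "(fst (x,y,t), fst (snd (x,y,t))) \<noteq> (0 :: complex \<times> complex)" "norm (snd (snd (x,y,t))) \<le> \<rho> * norm (fst (x,y,t), fst (snd (x,y,t :: complex)))"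
    define N where "N = norm (x, y)"
    have N: "N > 0" using a by (simp add: N_def zero_prod_def)
    define c where "c = complex_of_real (1 / N)"
    have c0: "c \<noteq> 0" "norm c = 1 / N" using N by (auto simp: c_def norm_divide)
    have "(c * x, c * y) = (1 / N) *\<^sub>R (x, y)" by (simp add: c_def scaleR_conv_of_real)
    then have "norm (c * x, c * y) = norm ((1 / N) *\<^sub>R (x, y))" by (simp only:)
    also have "\<dots> = 1" unfolding norm_scaleR using N by (simp add: N_def)
    finally have "norm (c * x, c * y) = 1" .
    moreover have "norm (c * t) \<le> \<rho>" using a N by (simp add: c0 norm_mult N_def field_simps)
    ultimately have "smult3 c (x, y, t) \<in> S" by (simp add: S_def)
    then show "proj (x, y, t) \<in> proj ` S" using proj_smult3[OF c0(1)] by (metis imageI)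
  next
    fix x y t assume "(x,y,t) \<in> S"
    then show "proj (x,y,t) \<in> proj ` {v. (fst v, fst (snd v)) \<noteq> 0 \<and> norm (snd (snd v)) \<le> \<rho> * norm (fst v, fst (snd v))}"
      by (auto simp: S_def)
  qed
  ultimately show ?thesis by simp
qed

lemma tube_lemma_euclidean:
  fixes K :: "'b::topological_space set" and x :: "'a::topological_space"
  assumes "open W" "compact K" "{x} \<times> K \<subseteq> W"
  obtains X where "open X" "x \<in> X" "X \<times> K \<subseteq> W"
proof -
  obtain U V where "open U" "open V" "x \<in> U" "K \<subseteq> V" "U \<times> V \<subseteq> W"
    using tube_lemma_right[of euclidean euclidean W K x] assms by auto
  then show ?thesis by (intro that[of U]) auto
qed

section \<open>The fibred map\<close>

text \<open>The constant \<open>7/10\<close> is just below \<open>1 / sqrt 2\<close>: as a bound for the slope this makes the fibre maps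
  contract, as a bound for the shift it keeps the centres \<open>t = - 7u/10\<close> inside the unit disc bundle,
  and both are still large enough for the covering argument.\<close>

locale fibred_map =
  fixes l :: nat and \<delta> :: real
  assumes l: "900 \<le> l" and \<delta>_pos: "0 < \<delta>" and \<delta>_small: "\<delta> * real (12 * l) * 301 ^ (12 * l) \<le> 1/1000"
begin

definition k :: nat where "k = 12 * l"

definition fibre_slope :: "complex \<Rightarrow> complex \<Rightarrow> complex" where
  "fibre_slope x y = 7/10 * (y - \<i> * x) ^ 11 * ((y - \<i> * x) ^ (k - 12) + (y + \<i> * x) ^ (k - 12))"

definition fibre_map :: "complex \<Rightarrow> complex \<Rightarrow> complex \<Rightarrow> complex" where
  "fibre_map x y t = fibre_slope x y * (t + 7/10 * (y + \<i> * x)) + of_real \<delta> * (t + 7/10 * (y + \<i> * x)) ^ k"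

definition F :: "c3 \<Rightarrow> c3" where
  "F v = (fst (base_lift k (fst v, fst (snd v))), snd (base_lift k (fst v, fst (snd v))),
          fibre_map (fst v) (fst (snd v)) (snd (snd v)))"

lemma F_simp: "F (x, y, t) = (fst (base_lift k (x, y)), snd (base_lift k (x, y)), fibre_map x y t)"
  by (simp add: F_def)

section \<open>Trapping and contraction of the fibres\<close>

lemma k_facts: "k \<ge> 10800" "k > 0" "4 dvd k" "k \<ge> 12"
  using l by (auto simp: k_def)

text \<open>The \<delta> term is estimated three times: its Lipschitz constant on the trapping
  bundle needs \<open>k 301^k\<close>, its size there \<open>301^k\<close>, and its size in the
  covering argument \<open>2^k\<close>. The base \<open>301\<close> is the radius \<open>300\<close>
  plus the shift.\<close>

lemma \<delta>_bounds: "\<delta> * real k * 301 ^ k \<le> 1/1000" "\<delta> * 301 ^ k \<le> 1/1000" "\<delta> * 2 ^ k \<le> 1/1000"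
proof -
  show 1: "\<delta> * real k * 301 ^ k \<le> 1/1000" using \<delta>_small by (simp add: k_def)
  have "\<delta> * 301 ^ k * 1 \<le> \<delta> * 301 ^ k * real k"
    using k_facts \<delta>_pos by (intro mult_left_mono) auto
  also have "\<dots> \<le> 1/1000" using 1 by (simp add: mult_ac)
  finally show 2: "\<delta> * 301 ^ k \<le> 1/1000" by simp
  have "\<delta> * 2 ^ k \<le> \<delta> * 301 ^ k"
    using \<delta>_pos by (intro mult_left_mono power_mono) auto
  then show "\<delta> * 2 ^ k \<le> 1/1000" using 2 by linarith
qed

lemma shift_bound: "norm (7/10 * (y + \<i> * x)) \<le> 99/100 * norm (x, y)"
proof (rule power2_le_imp_le)
  have "(norm (y + \<i> * x))\<^sup>2 \<le> 2 * (norm (x, y))\<^sup>2"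
    using norm_rotate[of y x] zero_le_power2[of "norm (y - \<i> * x)"] by linarith
  then have "(norm (7/10 * (y + \<i> * x)))\<^sup>2 \<le> 98/100 * (norm (x, y))\<^sup>2"
    unfolding norm_mult power_mult_distrib by (simp add: power_divide)
  also have "\<dots> \<le> (99/100 * norm (x, y))\<^sup>2"
    unfolding power_mult_distrib by (simp add: power_divide)
  finally show "(norm (7/10 * (y + \<i> * x)))\<^sup>2 \<le> (99/100 * norm (x, y))\<^sup>2" .
qed auto

lemma norm_base_lift:
  "(norm (base_lift k (x, y)))\<^sup>2 = (norm (y + \<i> * x) ^ k)\<^sup>2 + (norm (y - \<i> * x) ^ k)\<^sup>2"
  by (simp add: base_lift_def norm_Pair norm_power)

text \<open>The square of \<open>norm (x, y)\<close> is the mean of the squared moduli of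
  \<open>u\<close> and \<open>w\<close>, hence at most the larger one. This is what makes the
  \<delta> term small compared with the radius of the image fibre.\<close>

lemma norm_power_le_base_lift: "norm (x, y) ^ k \<le> norm (base_lift k (x, y))"
proof -
  define A B where "A = norm (y + \<i> * x)" and "B = norm (y - \<i> * x)"
  have "norm (x, y) \<le> max A B"
  proof (rule power2_le_imp_le)
    have "A\<^sup>2 \<le> (max A B)\<^sup>2" "B\<^sup>2 \<le> (max A B)\<^sup>2" by (auto intro!: power_mono simp: A_def B_def)
    then show "(norm (x, y))\<^sup>2 \<le> (max A B)\<^sup>2"
      using norm_rotate[of y x] unfolding A_def[symmetric] B_def[symmetric] by linarith
  qed (simp add: A_def le_max_iff_disj)
  then have "norm (x, y) ^ k \<le> (max A B) ^ k" by (intro power_mono) auto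
  also have "\<dots> \<le> norm (base_lift k (x, y))"
  proof (rule power2_le_imp_le)
    show "((max A B) ^ k)\<^sup>2 \<le> (norm (base_lift k (x, y)))\<^sup>2"
      unfolding norm_base_lift A_def[symmetric] B_def[symmetric] by (simp add: max_def)
  qed auto
  finally show ?thesis .
qed

text \<open>In units of \<open>norm (x, y)\<close> in the source fibre and of
  \<open>norm (base_lift k (x, y))\<close> in the target fibre, the slope is a contraction by
  \<open>995/1000\<close>. Both sides are homogeneous of degree \<open>k\<close>, so representatives
  do not matter.\<close>

lemma fibre_slope_bound: "norm (fibre_slope x y) * norm (x, y) \<le> 995/1000 * norm (base_lift k (x, y))"
proof (rule power2_le_imp_le)
  define A B where "A = norm (y - \<i> * x)" and "B = norm (y + \<i> * x)"
  have N: "(norm (x, y))\<^sup>2 = (A\<^sup>2 + B\<^sup>2) / 2" using norm_rotate[of y x] by (simp add: A_def B_def)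
  have "norm (fibre_slope x y) \<le> 7/10 * A ^ 11 * (A ^ (k - 12) + B ^ (k - 12))"
    unfolding fibre_slope_def norm_mult norm_power A_def B_def
    by (intro mult_mono) (auto simp: norm_triangle_ineq norm_power intro!: order_trans[OF norm_triangle_ineq])
  then have "(norm (fibre_slope x y))\<^sup>2 \<le> (7/10 * A ^ 11 * (A ^ (k - 12) + B ^ (k - 12)))\<^sup>2" by (intro power_mono) auto
  then have "(norm (fibre_slope x y))\<^sup>2 * ((A\<^sup>2 + B\<^sup>2) / 2) \<le> (7/10 * A ^ 11 * (A ^ (k - 12) + B ^ (k - 12)))\<^sup>2 * ((A\<^sup>2 + B\<^sup>2) / 2)"
    by (intro mult_right_mono) auto
  also have "\<dots> \<le> (995/1000)\<^sup>2 * ((B ^ k)\<^sup>2 + (A ^ k)\<^sup>2)"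
    by (rule multiplier_bound_real) (auto simp: A_def B_def k_facts)
  also have "(B ^ k)\<^sup>2 + (A ^ k)\<^sup>2 = (norm (base_lift k (x, y)))\<^sup>2"
    by (simp add: norm_base_lift A_def B_def)
  finally show "(norm (fibre_slope x y) * norm (x, y))\<^sup>2 \<le> (995/1000 * norm (base_lift k (x, y)))\<^sup>2"
    unfolding power_mult_distrib N .
qed auto

lemma shifted_bound: "norm t \<le> 300 * norm (x, y) \<Longrightarrow> norm (t + 7/10 * (y + \<i> * x)) \<le> 301 * norm (x, y)"
  using norm_triangle_ineq[of t "7/10 * (y + \<i> * x)"] shift_bound[of y x] norm_ge_zero[of "(x, y)"]
  by linarith

text \<open>The shift costs at most one unit of radius, so a radius \<open>R\<close> is trapped once
  \<open>995/1000 (R + 1) < R\<close>, that is \<open>R > 199\<close>. With \<open>300\<close> there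
  is room for the \<delta> term as well: \<open>299.495 + 0.001 < 299.5\<close>.\<close>

lemma fibre_map_trap:
  assumes "norm t \<le> 300 * norm (x, y)"
  shows "norm (fibre_map x y t) \<le> 2995/10 * norm (base_lift k (x, y))"
proof -
  define T where "T = t + 7/10 * (y + \<i> * x)"
  define N where "N = norm (x, y)"
  define N' where "N' = norm (base_lift k (x, y))"
  have T: "norm T \<le> 301 * N" using shifted_bound[OF assms] by (simp add: T_def N_def)
  have "norm (fibre_slope x y * T) \<le> 301 * (norm (fibre_slope x y) * N)"
    using mult_left_mono[OF T, of "norm (fibre_slope x y)"] by (simp add: norm_mult mult_ac)
  also have "\<dots> \<le> 301 * (995/1000 * N')" unfolding N_def N'_def by (intro mult_left_mono fibre_slope_bound) simp
  finally have 1: "norm (fibre_slope x y * T) \<le> 299495/1000 * N'" by simp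
  have "norm (of_real \<delta> * T ^ k) = \<delta> * norm T ^ k" using \<delta>_pos by (simp add: norm_mult norm_power)
  also have "\<dots> \<le> \<delta> * (301 * N) ^ k" using T \<delta>_pos by (intro mult_left_mono power_mono) auto
  also have "\<dots> = (\<delta> * 301 ^ k) * N ^ k" by (simp add: power_mult_distrib)
  also have "\<dots> \<le> 1/1000 * N'"
    using \<delta>_bounds(2) norm_power_le_base_lift[of x y] unfolding N_def N'_def by (intro mult_mono) auto
  finally have 2: "norm (of_real \<delta> * T ^ k) \<le> 1/1000 * N'" .
  have "fibre_map x y t = fibre_slope x y * T + of_real \<delta> * T ^ k" by (simp add: fibre_map_def T_def)
  then have "norm (fibre_map x y t) \<le> 299495/1000 * N' + 1/1000 * N'"
    using norm_triangle_ineq[of "fibre_slope x y * T" "of_real \<delta> * T ^ k"] 1 2 by simp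
  moreover have "N' \<ge> 0" by (simp add: N'_def)
  ultimately show ?thesis unfolding N'_def[symmetric] by linarith
qed

text \<open>The Lipschitz bound for powers on the unit disc, rescaled to radius \<open>M\<close>;
  the factor \<open>M\<close> on the left avoids \<open>M ^ (n - 1)\<close>.\<close>

lemma norm_power_diff_le:
  fixes a b :: complex
  assumes "norm a \<le> M" "norm b \<le> M" "M > 0"
  shows "norm (a ^ n - b ^ n) * M \<le> real n * M ^ n * norm (a - b)"
proof -
  have "norm ((a / of_real M) ^ n - (b / of_real M) ^ n) \<le> n * norm (a / of_real M - b / of_real M)"
    by (rule norm_power_diff) (use assms in \<open>auto simp: norm_divide\<close>)
  moreover have "(a / of_real M) ^ n - (b / of_real M) ^ n = (a ^ n - b ^ n) / of_real (M ^ n)"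
    by (simp add: power_divide diff_divide_distrib)
  moreover have "a / of_real M - b / of_real M = (a - b) / of_real M" by (simp add: diff_divide_distrib)
  ultimately have "norm (a ^ n - b ^ n) / M ^ n \<le> n * (norm (a - b) / M)"
    using assms(3) by (simp add: norm_divide norm_power)
  then show ?thesis using assms(3) by (simp add: field_simps)
qed

lemma fibre_map_contract:
  assumes "norm t \<le> 300 * norm (x, y)" "norm t' \<le> 300 * norm (x, y)"
  shows "norm (fibre_map x y t - fibre_map x y t') * norm (x, y) \<le> 996/1000 * norm (base_lift k (x, y)) * norm (t - t')"
proof (cases "norm (x, y) = 0")
  case True
  then show ?thesis by simp
next
  case False
  define T where "T = t + 7/10 * (y + \<i> * x)"
  define T' where "T' = t' + 7/10 * (y + \<i> * x)"
  define N where "N = norm (x, y)"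
  define N' where "N' = norm (base_lift k (x, y))"
  have N: "N > 0" using False by (simp add: N_def)
  have T: "norm T \<le> 301 * N" "norm T' \<le> 301 * N"
    using shifted_bound[OF assms(1)] shifted_bound[OF assms(2)] by (auto simp: T_def T'_def N_def)
  have TT: "T - T' = t - t'" by (simp add: T_def T'_def)
  have "norm (T ^ k - T' ^ k) * (301 * N) \<le> real k * (301 * N) ^ k * norm (t - t')"
    using norm_power_diff_le[OF T, of k] N TT by simp
  then have "norm (T ^ k - T' ^ k) * N \<le> real k * (301 * N) ^ k * norm (t - t')"
    using N by (smt (verit) mult_left_mono norm_ge_zero)
  then have "\<delta> * (norm (T ^ k - T' ^ k) * N) \<le> \<delta> * (real k * (301 * N) ^ k * norm (t - t'))"
    using \<delta>_pos by (intro mult_left_mono) auto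
  also have "\<dots> = (\<delta> * real k * 301 ^ k) * (N ^ k * norm (t - t'))" by (simp add: power_mult_distrib mult_ac)
  also have "\<dots> \<le> 1/1000 * (N' * norm (t - t'))"
    using \<delta>_bounds(1) norm_power_le_base_lift[of x y] N unfolding N_def N'_def by (intro mult_mono) auto
  finally have 2: "norm (of_real \<delta> * (T ^ k - T' ^ k)) * N \<le> 1/1000 * (N' * norm (t - t'))"
    using \<delta>_pos by (simp add: norm_mult mult.assoc)
  have 1: "norm (fibre_slope x y * (T - T')) * N \<le> 995/1000 * N' * norm (t - t')"
    using mult_right_mono[OF fibre_slope_bound[of x y], of "norm (t - t')"] unfolding TT N_def N'_def
    by (simp add: norm_mult mult_ac)
  have "fibre_map x y t - fibre_map x y t' = fibre_slope x y * (T - T') + of_real \<delta> * (T ^ k - T' ^ k)"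
    by (simp add: fibre_map_def T_def T'_def algebra_simps)
  then have "norm (fibre_map x y t - fibre_map x y t') * N \<le> (norm (fibre_slope x y * (T - T')) + norm (of_real \<delta> * (T ^ k - T' ^ k))) * N"
    using N by (intro mult_right_mono) (auto intro: norm_triangle_ineq)
  then show ?thesis using 1 2 unfolding N_def[symmetric] N'_def[symmetric] by (simp add: algebra_simps)
qed

lemma F_homogeneous: "homogeneous k F"
  unfolding homogeneous_def
proof (intro conjI allI impI)
  fix v :: c3 assume v: "v \<noteq> 0"
  obtain x y t where [simp]: "v = (x, y, t)" by (cases v)
  show "F v \<noteq> 0"
  proof (cases "(x, y) = 0")
    \<comment> \<open>Over the centre \<open>[0 : 0 : 1]\<close> of the pencil only
      \<open>\<delta> t^k\<close> survives.\<close>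
    case True
    then have "t \<noteq> 0" "x = 0" "y = 0" using v by (auto simp: zero_prod_def)
    then show ?thesis using \<delta>_pos k_facts
      by (auto simp: F_simp fibre_map_def fibre_slope_def zero_prod_def power_0_left)
  next
    case False
    then show ?thesis using base_lift_nonzero[OF k_facts(2) False]
      by (auto simp: F_simp zero_prod_def prod_eq_iff)
  qed
next
  fix c and v :: c3
  obtain x y t where v: "v = (x, y, t)" by (cases v)
  have u: "c * y + \<i> * (c * x) = c * (y + \<i> * x)" "c * y - \<i> * (c * x) = c * (y - \<i> * x)"
    by (auto simp: algebra_simps)
  have "fibre_slope (c * x) (c * y) = 7/10 * (c * (y - \<i> * x)) ^ 11 * ((c * (y - \<i> * x)) ^ (k - 12) + (c * (y + \<i> * x)) ^ (k - 12))"
    unfolding fibre_slope_def u ..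
  also have "\<dots> = c ^ 11 * c ^ (k - 12) * fibre_slope x y"
    unfolding fibre_slope_def power_mult_distrib by (simp add: algebra_simps)
  also have "c ^ 11 * c ^ (k - 12) = c ^ (k - 1)"
    using k_facts by (simp flip: power_add)
  finally have fibre_slope: "fibre_slope (c * x) (c * y) = c ^ (k - 1) * fibre_slope x y" .
  have T: "c * t + 7/10 * (c * (y + \<i> * x)) = c * (t + 7/10 * (y + \<i> * x))" by (simp add: algebra_simps)
  have ck: "c ^ (k - 1) * c = c ^ k" using k_facts by (metis power_minus_mult)
  have "fibre_map (c * x) (c * y) (c * t) = c ^ (k - 1) * fibre_slope x y * (c * (t + 7/10 * (y + \<i> * x))) + of_real \<delta> * (c * (t + 7/10 * (y + \<i> * x))) ^ k"
    unfolding fibre_map_def u T fibre_slope ..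
  also have "\<dots> = (c ^ (k - 1) * c) * (fibre_slope x y * (t + 7/10 * (y + \<i> * x))) + c ^ k * (of_real \<delta> * (t + 7/10 * (y + \<i> * x)) ^ k)"
    unfolding power_mult_distrib by (simp only: mult_ac)
  also have "\<dots> = c ^ k * fibre_map x y t" unfolding ck fibre_map_def by (simp only: distrib_left)
  finally have "fibre_map (c * x) (c * y) (c * t) = c ^ k * fibre_map x y t" .
  then show "F (smult3 c v) = smult3 (c ^ k) (F v)"
    by (simp add: v F_simp base_lift_scale)
qed

lemma F_continuous: "continuous_on UNIV F"
  unfolding F_def[abs_def] base_lift_def fibre_map_def fibre_slope_def by (intro continuous_intros)

lemma F_funpow:
  "fst ((F ^^ n) v) = fst ((base_lift k ^^ n) (fst v, fst (snd v)))"
  "fst (snd ((F ^^ n) v)) = snd ((base_lift k ^^ n) (fst v, fst (snd v)))"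
  by (induction n) (auto simp: F_def)

lemma F_funpow_trap:
  assumes "norm t \<le> 300 * norm (x, y)"
  shows "norm (snd (snd ((F ^^ n) (x, y, t)))) \<le> 300 * norm ((base_lift k ^^ n) (x, y))"
proof (induction n)
  case (Suc n)
  obtain a b s where abs: "(F ^^ n) (x, y, t) = (a, b, s)" by (cases "(F ^^ n) (x, y, t)")
  then have ab: "(base_lift k ^^ n) (x, y) = (a, b)" using F_funpow[of n "(x, y, t)"] by (simp add: prod_eq_iff)
  have "norm s \<le> 300 * norm (a, b)" using Suc abs ab by simp
  then have "norm (fibre_map a b s) \<le> 2995/10 * norm (base_lift k (a, b))" by (rule fibre_map_trap)
  also have "\<dots> \<le> 300 * norm (base_lift k (a, b))" by (intro mult_right_mono) auto
  finally show ?case by (simp add: abs ab F_simp)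
qed (use assms in auto)

lemma F_funpow_contract:
  assumes "norm t \<le> 300 * norm (x, y)" "norm t' \<le> 300 * norm (x, y)"
  shows "norm (snd (snd ((F ^^ n) (x, y, t))) - snd (snd ((F ^^ n) (x, y, t')))) * norm (x, y)
     \<le> (996/1000) ^ n * norm ((base_lift k ^^ n) (x, y)) * norm (t - t')"
proof (cases "norm (x, y) = 0")
  case False
  show ?thesis
  proof (induction n)
    case (Suc n)
    obtain a b s where abs: "(F ^^ n) (x, y, t) = (a, b, s)" by (cases "(F ^^ n) (x, y, t)")
    then have ab: "(base_lift k ^^ n) (x, y) = (a, b)" using F_funpow[of n "(x, y, t)"] by (simp add: prod_eq_iff)
    obtain s' where s': "(F ^^ n) (x, y, t') = (a, b, s')"
      using F_funpow[of n "(x, y, t')"] ab by (cases "(F ^^ n) (x, y, t')") auto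
    have ss: "norm s \<le> 300 * norm (a, b)" "norm s' \<le> 300 * norm (a, b)"
      using F_funpow_trap[OF assms(1), of n] F_funpow_trap[OF assms(2), of n] by (auto simp: abs s' ab)
    define N where "N = norm (x, y)"
    define M where "M = norm (a, b)"
    define M' where "M' = norm (base_lift k (a, b))"
    have N: "N > 0" using False by (simp add: N_def)
    have M: "M > 0" using base_lift_funpow_nonzero[OF k_facts(2), of "(x, y)" n] False by (auto simp: M_def ab zero_prod_def)
    have IH: "norm (s - s') * N \<le> (996/1000) ^ n * M * norm (t - t')" using Suc by (simp add: abs s' ab N_def M_def)
    have st: "norm (fibre_map a b s - fibre_map a b s') * M \<le> 996/1000 * M' * norm (s - s')"
      using fibre_map_contract[OF ss] by (simp add: M_def M'_def)
    have "(norm (fibre_map a b s - fibre_map a b s') * N) * M \<le> (996/1000 * M') * (norm (s - s') * N)"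
      using mult_right_mono[OF st, of N] N by (simp add: mult_ac)
    also have "\<dots> \<le> (996/1000 * M') * ((996/1000) ^ n * M * norm (t - t'))"
      using IH by (intro mult_left_mono) (auto simp: M'_def)
    also have "\<dots> = ((996/1000) ^ Suc n * M' * norm (t - t')) * M" by simp
    finally have "norm (fibre_map a b s - fibre_map a b s') * N \<le> (996/1000) ^ Suc n * M' * norm (t - t')"
      using M by simp
    then show ?case by (simp add: abs s' ab F_simp N_def M'_def)
  qed auto
qed auto

section \<open>Disc bundles and the covering region\<close>

abbreviation f :: "cp2 \<Rightarrow> cp2" where "f \<equiv> induced F"

text \<open>A cone over a disc bundle in the plane; radii are relative to the norm of the base
  vector. The strict inequality already forces \<open>(x, y) \<noteq> 0\<close>.\<close>

definition disc_bundle :: "real \<Rightarrow> c3 set" where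
  "disc_bundle r = {v. norm (snd (snd v)) < r * norm (fst v, fst (snd v))}"

text \<open>A blender in the sense of smooth dynamics: its image covers it although all fibres are
  contracted. The last two conditions cut off neighbourhoods of the critical values
  \<open>[0 : 1]\<close> and \<open>[1 : 0]\<close> of the base map.\<close>

definition blender :: "c3 set" where
  "blender = disc_bundle 1 \<inter> {v. norm (fst v) < 10 * norm (fst (snd v))} \<inter> {v. norm (fst (snd v)) < 10 * norm (fst v)}"

lemma norm_smult_pair: "norm (c * x, c * y) = norm c * norm (x, y)" for c x y :: complex
proof -
  have "(norm (c * x, c * y))\<^sup>2 = (norm c * norm (x, y))\<^sup>2"
    by (simp add: norm_Pair norm_mult power_mult_distrib distrib_left)
  then show ?thesis by (simp add: power2_eq_iff_nonneg)
qed

lemma zero_notin_disc_bundle: "0 \<notin> disc_bundle r"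
  by (simp add: disc_bundle_def zero_prod_def[symmetric])

lemma open_disc_bundle: "open (disc_bundle r)"
  unfolding disc_bundle_def by (intro open_Collect_less continuous_intros)

lemma disc_bundle_cone: "c \<noteq> 0 \<Longrightarrow> v \<in> disc_bundle r \<Longrightarrow> smult3 c v \<in> disc_bundle r"
  by (cases v) (simp add: disc_bundle_def norm_smult_pair norm_mult mult.left_commute[of r])

lemma proj_in_disc_bundle_iff: "v \<noteq> 0 \<Longrightarrow> proj v \<in> proj ` disc_bundle r \<longleftrightarrow> v \<in> disc_bundle r"
  using proj_eq_iff disc_bundle_cone zero_notin_disc_bundle by (metis imageE imageI)

lemma open_proj_disc_bundle: "open (proj ` disc_bundle r)"
  by (intro open_proj_image open_disc_bundle zero_notin_disc_bundle disc_bundle_cone)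

lemma unrotate:
  fixes u w :: complex
  defines "x \<equiv> (u - w) / (2 * \<i>)" and "y \<equiv> (u + w) / 2"
  shows "y + \<i> * x = u" "y - \<i> * x = w" "2 * (norm (x, y))\<^sup>2 = (norm u)\<^sup>2 + (norm w)\<^sup>2"
    "norm x = norm (u - w) / 2" "norm y = norm (u + w) / 2"
proof -
  show 1: "y + \<i> * x = u" "y - \<i> * x = w" unfolding x_def y_def by (simp_all add: field_simps)
  show "2 * (norm (x, y))\<^sup>2 = (norm u)\<^sup>2 + (norm w)\<^sup>2" using norm_rotate[of y x] unfolding 1 by simp
  show "norm x = norm (u - w) / 2" "norm y = norm (u + w) / 2"
    unfolding x_def y_def by (simp_all add: norm_divide norm_mult)
qed

text \<open>\<open>affine_covering\<close> made homogeneous: all quantities are scaled by a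
  \<open>k\<close>-th root \<open>w\<close> of \<open>Y\<close>.\<close>

lemma blender_covers_itself:
  assumes "(X, Y, t') \<in> blender"
  shows "\<exists>v\<in>blender. F v = (X, Y, t')"
proof -
  have a: "norm X < 10 * norm Y" "norm Y < 10 * norm X" "norm t' < norm (X, Y)"
    using assms by (auto simp: blender_def disc_bundle_def)
  then have Y0: "Y \<noteq> 0" by auto
  define \<zeta> where "\<zeta> = X / Y"
  define t where "t = t' / Y"
  have z1: "1/10 < norm \<zeta>" "norm \<zeta> < 10" using a Y0 by (auto simp: \<zeta>_def norm_divide field_simps)
  have "(norm t')\<^sup>2 < (norm (X, Y))\<^sup>2" using a(3) by (intro power_strict_mono) auto
  then have t1: "(norm t)\<^sup>2 < 1 + (norm \<zeta>)\<^sup>2"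
    using Y0 by (simp add: t_def \<zeta>_def norm_divide norm_Pair power_divide field_simps)
  obtain z S where zS: "z ^ k = \<zeta>" "norm (z + 1) / 10 < norm (z - 1)" "norm (z - 1) / 10 < norm (z + 1)"
    "7/10 * (1 + z ^ (k - 12)) * S + of_real \<delta> * S ^ k = t"
    "(norm (S - 7/10 * z))\<^sup>2 < (1 + (norm z)\<^sup>2) / 2"
    using affine_covering[OF l \<delta>_pos \<delta>_bounds(3)[unfolded k_def] z1 t1] unfolding k_def by metis
  obtain w where w: "Y = w ^ k" using exists_complex_root[of k Y] k_facts by auto
  have w0: "w \<noteq> 0" using Y0 w k_facts by (auto simp: power_0_left)
  define u where "u = z * w"
  define x where "x = (u - w) / (2 * \<i>)"
  define y where "y = (u + w) / 2"
  note un = unrotate[of u w, folded x_def y_def]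
  \<comment> \<open>The shifted coordinate has to be \<open>w * S\<close>, so the shift is
    subtracted.\<close>
  define s where "s = w * S - 7/10 * u"
  have N: "(norm (x, y))\<^sup>2 = (norm w)\<^sup>2 * ((1 + (norm z)\<^sup>2) / 2)"
    using un(3) by (simp add: u_def norm_mult power_mult_distrib algebra_simps)
  have "(x, y, s) \<in> blender"
  proof -
    have "s = w * (S - 7/10 * z)" by (simp add: s_def u_def algebra_simps)
    then have "(norm s)\<^sup>2 = (norm w)\<^sup>2 * (norm (S - 7/10 * z))\<^sup>2" by (simp only: norm_mult power_mult_distrib)
    also have "\<dots> < (norm (x, y))\<^sup>2" unfolding N using zS(5) w0 by (intro mult_strict_left_mono) auto
    finally have sN: "norm s < norm (x, y)" by (rule power2_less_imp_less) simp
    have "u - w = w * (z - 1)" "u + w = w * (z + 1)" by (auto simp: u_def algebra_simps)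
    then have "norm x = norm w * norm (z - 1) / 2" "norm y = norm w * norm (z + 1) / 2"
      unfolding un(4,5) by (simp_all only: norm_mult)
    moreover have "norm w * norm (z - 1) < norm w * (10 * norm (z + 1))" "norm w * norm (z + 1) < norm w * (10 * norm (z - 1))"
      using zS(2,3) w0 by (auto intro!: mult_strict_left_mono)
    ultimately have "norm x < 10 * norm y" "norm y < 10 * norm x" by simp_all
    then show ?thesis using sN by (simp add: blender_def disc_bundle_def)
  qed
  moreover have "F (x, y, s) = (X, Y, t')"
  proof -
    have "u ^ k = X" using zS(1) w Y0 by (simp add: u_def power_mult_distrib \<zeta>_def)
    moreover have "fibre_map x y s = t'"
    proof -
      have wk: "w ^ 11 * w ^ (k - 12) * w = w ^ k"
        using k_facts by (simp flip: power_add power_Suc2)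
      have "fibre_map x y s = 7/10 * w ^ 11 * (w ^ (k - 12) + u ^ (k - 12)) * (w * S) + of_real \<delta> * (w * S) ^ k"
        by (simp add: fibre_map_def fibre_slope_def un(1,2) s_def)
      also have "\<dots> = (w ^ 11 * w ^ (k - 12) * w) * (7/10 * (1 + z ^ (k - 12)) * S) + w ^ k * (of_real \<delta> * S ^ k)"
        unfolding u_def power_mult_distrib by (simp add: algebra_simps)
      also have "\<dots> = w ^ k * t" unfolding wk zS(4)[symmetric] by (simp only: distrib_left)
      also have "\<dots> = t'" using Y0 by (simp add: t_def w[symmetric])
      finally show ?thesis .
    qed
    ultimately show ?thesis by (simp add: F_simp base_lift_def un(1,2) w)
  qed
  ultimately show ?thesis by blast
qed

text \<open>Near the critical values the slope may vanish, and the dodecagon gives nothing. For tiny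
  \<open>t'\<close> the \<delta> term suffices instead: the trinomial has a root so small that,
  after undoing the shift, the point remains in the unit disc bundle. It only remains to pick a
  preimage in the base that avoids the critical values.\<close>

lemma blender_covers_line:
  "\<exists>r>0. \<forall>v\<in>disc_bundle r. \<exists>v'\<in>blender. F v' = v"
proof -
  \<comment> \<open>Read off from the estimates below: \<open>norm (X, Y) \<le> 2 (2N)^k\<close> and
    \<open>norm T ^ k \<le> norm t' / \<delta>\<close> give \<open>norm T < N / 100\<close>, which
    is exactly what the shift of at most \<open>99/100 N\<close> leaves.\<close>
  define r where "r = \<delta> * (1/200) ^ k / 2"
  have r0: "r > 0" using \<delta>_pos by (simp add: r_def)
  have "\<exists>v'\<in>blender. F v' = (X, Y, t')" if v: "(X, Y, t') \<in> disc_bundle r" for X Y t'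
  proof -
    have XY: "norm t' < r * norm (X, Y)" using v by (simp add: disc_bundle_def)
    then have nz: "X \<noteq> 0 \<or> Y \<noteq> 0" by (auto simp: zero_prod_def[symmetric])
    have "\<exists>u w. u ^ k = X \<and> w ^ k = Y \<and> norm (u - w) < 10 * norm (u + w) \<and> norm (u + w) < 10 * norm (u - w)"
    proof (cases "X = 0 \<or> Y = 0")
      case True
      obtain u where u: "X = u ^ k" using exists_complex_root[of k X] k_facts by auto
      obtain w where w: "Y = w ^ k" using exists_complex_root[of k Y] k_facts by auto
      have "u = 0 \<and> w \<noteq> 0 \<or> w = 0 \<and> u \<noteq> 0" using True nz u w k_facts by (auto simp: power_0_left)
      then show ?thesis using u w by (intro exI[of _ u] exI[of _ w]) auto
    next
      case False
      obtain w where w: "Y = w ^ k" using exists_complex_root[of k Y] k_facts by auto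
      have w0: "w \<noteq> 0" using False w k_facts by (auto simp: power_0_left)
      \<comment> \<open>Close to the imaginary axis \<open>z - 1\<close> and \<open>z + 1\<close>
        have comparable moduli; these are the moduli of \<open>x\<close> and \<open>y\<close> up to
        a common factor.\<close>
      obtain z where z: "z ^ k = X / Y" "Re (z * cnj \<i>) \<ge> sqrt 3 / 2 * norm z"
        using roots_near_direction[OF k_facts(4), of \<i> "X / Y"] by auto
      have z0: "z \<noteq> 0" using z(1) False k_facts by (auto simp: power_0_left)
      have "sqrt 3 / 2 * norm z \<le> Im z" using z(2) by simp
      then have "(sqrt 3 / 2 * norm z)\<^sup>2 \<le> (Im z)\<^sup>2" by (intro power_mono) auto
      then have "3/4 * (norm z)\<^sup>2 \<le> (Im z)\<^sup>2" by (simp add: power_mult_distrib power_divide)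
      then have "(Re z)\<^sup>2 \<le> ((norm z) / 2)\<^sup>2" using cmod_power2[of z] by (simp add: power_divide)
      then have Re: "\<bar>Re z\<bar> \<le> norm z / 2" using abs_le_square_iff[of "Re z" "norm z / 2"] by simp
      have "norm z \<le> (1 + (norm z)\<^sup>2) / 2" using sum_squares_bound[of 1 "norm z"] by simp
      then have Re2: "\<bar>Re z\<bar> \<le> (1 + (norm z)\<^sup>2) / 4" using Re by linarith
      have pm: "(norm (z + 1))\<^sup>2 = 1 + (norm z)\<^sup>2 + 2 * Re z" "(norm (z - 1))\<^sup>2 = 1 + (norm z)\<^sup>2 - 2 * Re z"
        unfolding cmod_power2 by (auto simp: power2_eq_square algebra_simps)
      have n0: "0 \<le> (norm z)\<^sup>2" by simp
      have "norm (z - 1) < 10 * norm (z + 1)"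
      proof (rule power2_less_imp_less)
        have "1 + (norm z)\<^sup>2 - 2 * Re z < 100 * (1 + (norm z)\<^sup>2 + 2 * Re z)" using Re2 n0 by argo
        then show "(norm (z - 1))\<^sup>2 < (10 * norm (z + 1))\<^sup>2" unfolding power_mult_distrib pm by simp
      qed auto
      moreover have "norm (z + 1) < 10 * norm (z - 1)"
      proof (rule power2_less_imp_less)
        have "1 + (norm z)\<^sup>2 + 2 * Re z < 100 * (1 + (norm z)\<^sup>2 - 2 * Re z)" using Re2 n0 by argo
        then show "(norm (z + 1))\<^sup>2 < (10 * norm (z - 1))\<^sup>2" unfolding power_mult_distrib pm by simp
      qed auto
      moreover have "z * w - w = w * (z - 1)" "z * w + w = w * (z + 1)" by (auto simp: algebra_simps)
      ultimately have "norm (z * w - w) < 10 * norm (z * w + w)" "norm (z * w + w) < 10 * norm (z * w - w)"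
        using w0 by (simp_all add: norm_mult)
      moreover have "(z * w) ^ k = X" using z(1) w False by (simp add: power_mult_distrib)
      ultimately show ?thesis using w by blast
    qed
    then obtain u w where uw: "u ^ k = X" "w ^ k = Y" "norm (u - w) < 10 * norm (u + w)" "norm (u + w) < 10 * norm (u - w)" by blast
    define x where "x = (u - w) / (2 * \<i>)"
    define y where "y = (u + w) / 2"
    note un = unrotate[of u w, folded x_def y_def]
    have BL: "base_lift k (x, y) = (X, Y)" using uw un by (simp add: base_lift_def)
    define N where "N = norm (x, y)"
    have N: "N > 0"
    proof -
      have "base_lift k (x, y) \<noteq> 0" unfolding BL using nz by (simp add: zero_prod_def)
      moreover have "base_lift k (0, 0) = 0" using k_facts by (simp add: base_lift_def zero_prod_def power_0_left)
      ultimately have "(x, y) \<noteq> 0" by (metis zero_prod_def)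
      then show ?thesis by (simp add: N_def)
    qed
    have N': "norm (X, Y) \<le> 2 * (2 * N) ^ k"
    proof -
      have e: "(2 * N)\<^sup>2 = 4 * N\<^sup>2" "(norm u)\<^sup>2 \<le> 2 * N\<^sup>2" "(norm w)\<^sup>2 \<le> 2 * N\<^sup>2" "0 \<le> N\<^sup>2"
        using un(3) unfolding N_def[symmetric] by (simp_all add: power_mult_distrib)
      have "norm u \<le> 2 * N" by (rule power2_le_imp_le) (use e N in linarith)+
      moreover have "norm w \<le> 2 * N" by (rule power2_le_imp_le) (use e N in linarith)+
      ultimately
      have "norm X \<le> (2 * N) ^ k" "norm Y \<le> (2 * N) ^ k"
        unfolding uw(1,2)[symmetric] norm_power by (simp_all only: power_mono norm_ge_zero)
      then show ?thesis using norm_Pair_le[of X Y] by linarith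
    qed
    obtain T where T: "fibre_slope x y * T + of_real \<delta> * T ^ k = t'" "norm T ^ k \<le> norm t' / norm (complex_of_real \<delta>)"
      using small_root_trinomial[of k "of_real \<delta>" "fibre_slope x y" t'] k_facts \<delta>_pos by auto
    have "norm T ^ k \<le> norm t' / \<delta>" using T(2) \<delta>_pos by simp
    also have "\<dots> < r * norm (X, Y) / \<delta>" using XY \<delta>_pos by (intro divide_strict_right_mono) auto
    also have "\<dots> \<le> r * (2 * (2 * N) ^ k) / \<delta>"
      using N' r0 \<delta>_pos by (intro divide_right_mono mult_left_mono) auto
    also have "\<dots> = (1/200) ^ k * (2 * N) ^ k" using \<delta>_pos by (simp add: r_def)
    also have "\<dots> = (1/200 * (2 * N)) ^ k" by (rule power_mult_distrib[symmetric])
    also have "\<dots> = (N / 100) ^ k" by simp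
    finally have "norm T < N / 100" by (rule power_less_imp_less_base) (use N in simp)
    define s where "s = T - 7/10 * u"
    have "norm s < N"
    proof -
      have "norm (7/10 * u) \<le> 99/100 * N" using shift_bound[of y x] un(1) by (simp add: N_def)
      then show ?thesis using norm_triangle_ineq4[of T "7/10 * u"] \<open>norm T < N / 100\<close>
        unfolding s_def by linarith
    qed
    then have "(x, y, s) \<in> blender" using uw un(4,5) by (simp add: blender_def disc_bundle_def N_def)
    moreover have "F (x, y, s) = (X, Y, t')" using T(1) BL un(1) by (simp add: F_simp fibre_map_def s_def)
    ultimately show ?thesis by blast
  qed
  then show ?thesis using r0 by (intro exI[of _ r]) auto
qed

section \<open>The attracting set\<close>

definition A :: "cp2 set" where "A = (\<Inter>n. (f ^^ n) ` proj ` disc_bundle 300)"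

definition closed_bundle :: "real \<Rightarrow> cp2 set" where
  "closed_bundle r = proj ` {v. (fst v, fst (snd v)) \<noteq> 0 \<and> norm (snd (snd v)) \<le> r * norm (fst v, fst (snd v))}"

lemma compact_closed_bundle: "compact (closed_bundle r)"
  unfolding closed_bundle_def by (rule compact_disc_bundle)

lemma bundle_subset_closed: "proj ` disc_bundle r \<subseteq> closed_bundle r"
proof -
  have "disc_bundle r \<subseteq> {v. (fst v, fst (snd v)) \<noteq> 0 \<and> norm (snd (snd v)) \<le> r * norm (fst v, fst (snd v))}"
    by (auto simp: disc_bundle_def zero_prod_def)
  then show ?thesis unfolding closed_bundle_def by (rule image_mono)
qed

lemma f_closed_bundle: "f ` closed_bundle 300 \<subseteq> closed_bundle (2995/10)"
proof
  fix p assume "p \<in> f ` closed_bundle 300"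
  then obtain x y t where v: "p = f (proj (x, y, t))" "(x, y) \<noteq> 0" "norm t \<le> 300 * norm (x, y)"
    by (auto simp: closed_bundle_def)
  have "(x, y, t) \<noteq> 0" using v(2) by (auto simp: zero_prod_def)
  then have "p = proj (F (x, y, t))" using v(1) induced_proj[OF F_homogeneous] by simp
  then show "p \<in> closed_bundle (2995/10)"
    unfolding closed_bundle_def using base_lift_nonzero[OF k_facts(2) v(2)] fibre_map_trap[OF v(3)]
    by (auto simp: F_simp)
qed

lemma closed_bundle_subset: "closed_bundle (2995/10) \<subseteq> proj ` disc_bundle 300"
  unfolding closed_bundle_def
proof (rule image_mono, safe)
  fix x y t assume "(fst (x, y, t), fst (snd (x, y, t))) \<noteq> (0 :: complex \<times> complex)"
    "norm (snd (snd (x, y, t))) \<le> 2995/10 * norm (fst (x, y, t), fst (snd (x, y, t :: complex)))"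
  then have "norm t \<le> 2995/10 * norm (x, y)" "norm (x, y) > 0" by auto
  then have "norm t < 300 * norm (x, y)" by linarith
  then show "(x, y, t) \<in> disc_bundle 300" by (simp add: disc_bundle_def)
qed

lemma f_bundle: "f ` closed_bundle 300 \<subseteq> proj ` disc_bundle 300"
  using f_closed_bundle closed_bundle_subset by blast

lemma continuous_f: "continuous_on UNIV (f ^^ n)"
  by (rule continuous_induced_funpow[OF F_homogeneous F_continuous])

lemma A_subset: "A \<subseteq> proj ` disc_bundle 300"
  unfolding A_def using INT_lower[of 0 UNIV "\<lambda>n. (f ^^ n) ` proj ` disc_bundle 300"] by simp

lemma attracting_set_A: "attracting_set f A"
  unfolding attracting_set_def
proof (intro conjI exI)
  show "open (proj ` disc_bundle 300)" by (rule open_proj_disc_bundle)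
  have "closed (closed_bundle (2995/10))" by (intro compact_imp_closed compact_closed_bundle)
  then have "closure (f ` proj ` disc_bundle 300) \<subseteq> closed_bundle (2995/10)"
    using f_closed_bundle bundle_subset_closed[of 300] by (intro closure_minimal) auto
  then show "closure (f ` proj ` disc_bundle 300) \<subseteq> proj ` disc_bundle 300"
    using closed_bundle_subset by blast
  show "A = (\<Inter>n. (f ^^ n) ` proj ` disc_bundle 300)" by (rule A_def)
  \<comment> \<open>Compactness is not visible from images of an open set. Since \<open>f\<close>
    maps the closed bundle into the open one, the two nested sequences of images interlace and have
    the same intersection.\<close>
  have "A = (\<Inter>n. (f ^^ n) ` closed_bundle 300)"
  proof
    show "A \<subseteq> (\<Inter>n. (f ^^ n) ` closed_bundle 300)"
    proof (rule INT_greatest)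
      fix n
      have "A \<subseteq> (f ^^ n) ` proj ` disc_bundle 300" unfolding A_def by blast
      also have "\<dots> \<subseteq> (f ^^ n) ` closed_bundle 300" by (intro image_mono bundle_subset_closed)
      finally show "A \<subseteq> (f ^^ n) ` closed_bundle 300" .
    qed
    show "(\<Inter>n. (f ^^ n) ` closed_bundle 300) \<subseteq> A"
    proof
      fix p assume p: "p \<in> (\<Inter>n. (f ^^ n) ` closed_bundle 300)"
      have "p \<in> (f ^^ n) ` proj ` disc_bundle 300" for n
      proof -
        have "p \<in> (f ^^ Suc n) ` closed_bundle 300" using p by blast
        then have "p \<in> (f ^^ n) ` f ` closed_bundle 300" by (simp add: funpow_Suc_right image_comp del: funpow.simps)
        then show ?thesis using f_bundle by blast
      qed
      then show "p \<in> A" by (simp add: A_def)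
    qed
  qed
  moreover have cp: "compact ((f ^^ n) ` closed_bundle 300)" for n
    using continuous_f by (intro compact_continuous_image compact_closed_bundle) (auto intro: continuous_on_subset)
  then have "closed (\<Inter>n. (f ^^ n) ` closed_bundle 300)"
    by (intro closed_INT ballI compact_imp_closed) auto
  ultimately have "closed A" by simp
  moreover have "closed_bundle 300 \<inter> A = A" using A_subset bundle_subset_closed[of 300] by blast
  ultimately show "compact A" using compact_Int_closed[OF compact_closed_bundle, of A 300] by simp
qed

lemma f_A: "p \<in> A \<Longrightarrow> f p \<in> A"
proof -
  assume p: "p \<in> A"
  have "f p \<in> (f ^^ n) ` proj ` disc_bundle 300" for n
  proof (cases n)
    case 0
    have "p \<in> closed_bundle 300" using p A_subset bundle_subset_closed[of 300] by blast
    then have "f p \<in> proj ` disc_bundle 300" using f_bundle by blast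
    then show ?thesis using 0 by simp
  next
    case (Suc m)
    have "p \<in> (f ^^ m) ` proj ` disc_bundle 300" using p by (simp add: A_def)
    then show ?thesis by (auto simp: Suc)
  qed
  then show ?thesis by (simp add: A_def)
qed

lemma funpow_A: "p \<in> A \<Longrightarrow> (f ^^ n) p \<in> A"
  by (induction n) (auto simp: f_A)

lemma blender_nonzero: "v \<in> blender \<Longrightarrow> v \<noteq> 0"
  using zero_notin_disc_bundle by (auto simp: blender_def)

text \<open>A set covered by its own image is covered by all its iterated images, and this one lies
  in the trapping bundle.\<close>

lemma blender_subset_A: "proj ` blender \<subseteq> A"
proof -
  have sub: "proj ` blender \<subseteq> f ` proj ` blender"
  proof
    fix p assume "p \<in> proj ` blender"
    then obtain v where v: "v \<in> blender" "p = proj v" by blast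
    then obtain v' where v': "v' \<in> blender" "F v' = v" using blender_covers_itself by (metis prod_cases3)
    then have "f (proj v') = p" using v induced_proj[OF F_homogeneous] blender_nonzero by simp
    then show "p \<in> f ` proj ` blender" using v' by blast
  qed
  have "proj ` blender \<subseteq> (f ^^ n) ` proj ` blender" for n
  proof (induction n)
    case (Suc n)
    have "proj ` blender \<subseteq> f ` proj ` blender" by (rule sub)
    also have "\<dots> \<subseteq> f ` (f ^^ n) ` proj ` blender" using Suc by (rule image_mono)
    finally show ?case by (simp add: image_comp)
  qed auto
  moreover have "blender \<subseteq> disc_bundle 300"
  proof
    fix v assume "v \<in> blender"
    then have "norm (snd (snd v)) < norm (fst v, fst (snd v))" by (auto simp: blender_def disc_bundle_def)
    then have "norm (snd (snd v)) < 300 * norm (fst v, fst (snd v))"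
      using norm_ge_zero[of "(fst v, fst (snd v))"] by linarith
    then show "v \<in> disc_bundle 300" by (simp add: disc_bundle_def)
  qed
  ultimately show ?thesis unfolding A_def by (meson INT_greatest image_mono order_trans)
qed

lemma line_interior: "\<exists>r>0. proj ` disc_bundle r \<subseteq> A"
proof -
  obtain r where r: "r > 0" "\<forall>v\<in>disc_bundle r. \<exists>v'\<in>blender. F v' = v" using blender_covers_line by blast
  have "proj v \<in> A" if vr: "v \<in> disc_bundle r" for v
  proof -
    obtain v' where v': "v' \<in> blender" "F v' = v" using r(2) vr by blast
    then have "f (proj v') = proj v" using induced_proj[OF F_homogeneous] blender_nonzero by simp
    then show ?thesis using f_A[of "proj v'"] v' blender_subset_A by auto
  qed
  then show ?thesis using r(1) by blast
qed

lemma line_in_A: "(x, y) \<noteq> 0 \<Longrightarrow> proj (x, y, 0) \<in> A"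
proof -
  assume "(x, y) \<noteq> 0"
  moreover obtain r where "r > 0" "proj ` disc_bundle r \<subseteq> A" using line_interior by blast
  ultimately show ?thesis by (auto simp: disc_bundle_def image_subset_iff)
qed

section \<open>Transitivity on the attractor\<close>

lemma small_fibre:
  assumes "open W" "a \<in> W" "a \<in> A"
  obtains i x y where "(x, y) \<noteq> 0" "\<And>t. norm t \<le> 300 * norm (x, y) \<Longrightarrow> (f ^^ i) (proj (x, y, t)) \<in> W"
proof -
  obtain x0 y0 t0 where v: "(x0, y0, t0) \<noteq> 0" "a = proj (x0, y0, t0)" by (metis cp2_cases prod_cases3)
  have "(x0, y0, t0) \<in> disc_bundle 300" using v assms(3) A_subset proj_in_disc_bundle_iff by blast
  then have N0: "norm (x0, y0) > 0" by (auto simp: disc_bundle_def zero_prod_def)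
  have "open {v. v \<noteq> 0 \<and> proj v \<in> W}" using assms(1) by (simp add: open_cp2_def)
  then obtain e where e: "e > 0" "ball (x0, y0, t0) e \<subseteq> {v. v \<noteq> 0 \<and> proj v \<in> W}"
    using v assms(2) open_contains_ball by (metis (mono_tags, lifting) mem_Collect_eq)
  \<comment> \<open>\<open>600\<close> is the diameter of a fibre in units of
    \<open>norm (x, y)\<close>.\<close>
  obtain i where i: "(996/1000) ^ i < e / (600 * norm (x0, y0))"
    using real_arch_pow_inv[of "e / (600 * norm (x0, y0))" "996/1000"] e N0 by auto
  \<comment> \<open>A point of \<open>A\<close> has preimages of every order in the bundle; the
    whole fibre through a preimage of high order is contracted into a small neighbourhood of
    \<open>a\<close>.\<close>
  have "a \<in> (f ^^ i) ` proj ` disc_bundle 300" using assms(3) by (simp add: A_def)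
  then obtain x y t1 where b: "(x, y, t1) \<in> disc_bundle 300" "a = (f ^^ i) (proj (x, y, t1))" by auto
  have t1: "norm t1 \<le> 300 * norm (x, y)" "norm (x, y) > 0" using b(1) by (auto simp: disc_bundle_def zero_prod_def)
  have nz: "(x, y, t) \<noteq> 0" for t :: complex using t1(2) by (auto simp: zero_prod_def)
  define X where "X = fst ((base_lift k ^^ i) (x, y))"
  define Y where "Y = snd ((base_lift k ^^ i) (x, y))"
  have XY: "(base_lift k ^^ i) (x, y) = (X, Y)" by (simp add: X_def Y_def)
  define T where "T = (\<lambda>t. snd (snd ((F ^^ i) (x, y, t))))"
  have Fi: "(F ^^ i) (x, y, t) = (X, Y, T t)" for t
    using F_funpow[of i "(x, y, t)"] by (simp add: prod_eq_iff X_def Y_def T_def)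
  have fi: "(f ^^ i) (proj (x, y, t)) = proj (X, Y, T t)" for t
    using induced_funpow_proj[OF F_homogeneous nz, of i] by (simp add: Fi)
  have nz': "(X, Y, T t) \<noteq> 0" for t using funpow_nonzero[OF F_homogeneous nz, of i] by (simp add: Fi)
  \<comment> \<open>The iterated lift ends at some representative of \<open>a\<close>; rescaling by
    \<open>c\<close> moves the estimate to the fixed one, whatever the size of the lift.\<close>
  obtain c where c: "c \<noteq> 0" "(x0, y0, t0) = smult3 c (X, Y, T t1)"
    using proj_eq_iff[OF nz' v(1)] b(2) v(2) fi by metis
  show ?thesis
  proof (rule that)
    show "(x, y) \<noteq> 0" using t1(2) by auto
    fix t :: complex assume t: "norm t \<le> 300 * norm (x, y)"
    have "norm (T t - T t1) * norm (x, y) \<le> (996/1000) ^ i * norm (X, Y) * norm (t - t1)"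
      using F_funpow_contract[OF t t1(1), of i] by (simp add: T_def XY)
    also have "\<dots> \<le> (996/1000) ^ i * norm (X, Y) * (600 * norm (x, y))"
      using norm_triangle_ineq4[of t t1] t t1 by (intro mult_left_mono) auto
    finally have "norm (T t - T t1) \<le> (996/1000) ^ i * norm (X, Y) * 600" using t1(2) by simp
    then have "norm c * norm (T t - T t1) \<le> norm c * ((996/1000) ^ i * norm (X, Y) * 600)"
      by (rule mult_left_mono) simp
    also have "\<dots> = (996/1000) ^ i * (norm c * norm (X, Y)) * 600" by (simp only: mult_ac)
    also have "norm c * norm (X, Y) = norm (x0, y0)" using c(2) norm_smult_pair[of c X Y] by simp
    also have "(996/1000) ^ i * norm (x0, y0) * 600 < e" using i N0 by (simp add: field_simps)
    finally have small: "norm c * norm (T t - T t1) < e" .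
    have "dist (x0, y0, t0) (smult3 c (X, Y, T t)) = norm (c * T t1 - c * T t)"
      using c(2) by (simp add: dist_Pair_Pair dist_norm)
    also have "\<dots> = norm c * norm (T t - T t1)"
      by (metis norm_minus_commute norm_mult right_diff_distrib)
    finally have "smult3 c (X, Y, T t) \<in> ball (x0, y0, t0) e" using small by simp
    then have "proj (smult3 c (X, Y, T t)) \<in> W" using e(2) by blast
    then show "(f ^^ i) (proj (x, y, t)) \<in> W" unfolding fi proj_smult3[OF c(1)] .
  qed
qed

text \<open>Closed fibres are compact, so the tube lemma extends \<open>small_fibre\<close> to all
  base points near the given one. The map \<open>m\<close> measures the fibre coordinate in units of
  the base norm, so that one fixed disc serves all fibres.\<close>

lemma small_fibres_open:
  assumes W: "open W" "a \<in> W" "a \<in> A"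
  obtains i Q where "open Q" "Q \<noteq> {}"
    "\<And>z t. z \<in> Q \<Longrightarrow> norm t \<le> 300 * norm (z, 1 :: complex) \<Longrightarrow> (f ^^ i) (proj (z, 1, t)) \<in> W"
proof -
  obtain i x y where xy: "(x, y) \<noteq> 0" "\<And>t. norm t \<le> 300 * norm (x, y) \<Longrightarrow> (f ^^ i) (proj (x, y, t)) \<in> W"
    using small_fibre[OF W] by metis
  define m :: "(complex \<times> complex) \<times> complex \<Rightarrow> c3"
    where "m = (\<lambda>p. (fst (fst p), snd (fst p), snd p * of_real (norm (fst p))))"
  have "open ((f ^^ i) -` W)" using continuous_f[of i] W(1) by (simp add: continuous_on_open_vimage)
  then have opW: "open {v. v \<noteq> 0 \<and> (f ^^ i) (proj v) \<in> W}" by (simp add: open_cp2_def)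
  have opS: "open (m -` {v. v \<noteq> 0 \<and> (f ^^ i) (proj v) \<in> W})"
    by (rule open_vimage[OF opW]) (auto simp: m_def intro!: continuous_intros)
  have sub: "{(x, y)} \<times> cball 0 300 \<subseteq> m -` {v. v \<noteq> 0 \<and> (f ^^ i) (proj v) \<in> W}"
    using xy by (auto simp: m_def norm_mult zero_prod_def intro!: mult_right_mono)
  obtain X0 where X0: "open X0" "(x, y) \<in> X0" "X0 \<times> cball 0 300 \<subseteq> m -` {v. v \<noteq> 0 \<and> (f ^^ i) (proj v) \<in> W}"
    by (rule tube_lemma_euclidean[OF opS compact_cball sub])
  have "open ((\<lambda>b. (x, b)) -` X0)" by (rule open_vimage[OF X0(1)]) (auto intro!: continuous_intros)
  then obtain d where d: "d > 0" "ball y d \<subseteq> (\<lambda>b. (x, b)) -` X0"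
    using X0(2) open_contains_ball by (metis vimageI)
  \<comment> \<open>The base point may be infinity; it is moved slightly into the chart
    \<open>z = x / y\<close>.\<close>
  have "\<exists>y'. y' \<noteq> 0 \<and> (x, y') \<in> X0"
  proof (cases "y = 0")
    case True
    have "of_real (d/2) \<in> ball y d" using d(1) True by simp
    then show ?thesis using d by (intro exI[of _ "of_real (d/2)"]) auto
  qed (use X0 in auto)
  then obtain y' where y': "y' \<noteq> 0" "(x, y') \<in> X0" by blast
  define Q where "Q = (\<lambda>z. (z * y', y')) -` X0"
  show ?thesis
  proof (rule that[of Q i])
    show "open Q" unfolding Q_def by (rule open_vimage[OF X0(1)]) (auto intro!: continuous_intros)
    have "x / y' \<in> Q" using y' by (simp add: Q_def)
    then show "Q \<noteq> {}" by blast
    fix z t :: complex assume z: "z \<in> Q" "norm t \<le> 300 * norm (z, 1 :: complex)"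
    define N where "N = norm (z * y', y')"
    have N: "N = norm y' * norm (z, 1 :: complex)" using norm_smult_pair[of y' z 1] by (simp add: N_def mult.commute)
    have N0: "N > 0" using y' by (simp add: N_def zero_prod_def)
    define \<tau> where "\<tau> = y' * t / of_real N"
    have "norm \<tau> \<le> 300" 
    proof -
      have "norm y' * norm t \<le> norm y' * (300 * norm (z, 1 :: complex))" using z(2) by (rule mult_left_mono) simp
      then have "norm y' * norm t \<le> 300 * N" unfolding N by simp
      then show ?thesis using N0 by (simp add: \<tau>_def norm_divide norm_mult pos_divide_le_eq)
    qed
    then have "((z * y', y'), \<tau>) \<in> X0 \<times> cball 0 300" using z(1) by (simp add: Q_def)
    then have "(f ^^ i) (proj (m ((z * y', y'), \<tau>))) \<in> W" using X0(3) by blast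
    moreover have "m ((z * y', y'), \<tau>) = smult3 y' (z, 1, t)"
      using N0 by (simp add: m_def \<tau>_def N_def[symmetric])
    ultimately show "(f ^^ i) (proj (z, 1, t)) \<in> W" by (simp only: proj_smult3[OF y'(1)])
  qed
qed

text \<open>The witness starts at a point \<open>c\<close> of the line \<open>t = 0\<close> over
  \<open>z\<close>: time \<open>j\<close> takes it into \<open>U\<close>, time \<open>n\<close> into
  the bundle over \<open>Q\<close>, and \<open>i\<close> further steps into \<open>V\<close>. The
  condition \<open>n \<ge> j\<close> allows the second itinerary to start at the image of
  \<open>c\<close> in \<open>U\<close>.\<close>

lemma transitive_A: "topologically_transitive_on A f"
  unfolding topologically_transitive_on_def
proof (intro allI impI)
  fix U V assume "openin (top_of_set A) U" "openin (top_of_set A) V" and ne: "U \<noteq> {}" "V \<noteq> {}"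
  then obtain W1 W2 where W: "open W1" "U = A \<inter> W1" "open W2" "V = A \<inter> W2"
    unfolding openin_open by blast
  obtain a1 a2 where a: "a1 \<in> W1" "a1 \<in> A" "a2 \<in> W2" "a2 \<in> A" using W ne by blast
  obtain j D where D: "open D" "D \<noteq> {}"
    "\<And>z t. z \<in> D \<Longrightarrow> norm t \<le> 300 * norm (z, 1 :: complex) \<Longrightarrow> (f ^^ j) (proj (z, 1, t)) \<in> W1"
    using small_fibres_open[OF W(1) a(1,2)] by metis
  obtain i Q where Q: "open Q" "Q \<noteq> {}"
    "\<And>z t. z \<in> Q \<Longrightarrow> norm t \<le> 300 * norm (z, 1 :: complex) \<Longrightarrow> (f ^^ i) (proj (z, 1, t)) \<in> W2"
    using small_fibres_open[OF W(3) a(3,4)] by metis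
  obtain n z where nz: "n \<ge> j" "z \<in> D" "snd ((base_lift k ^^ n) (z, 1)) \<noteq> 0"
    "fst ((base_lift k ^^ n) (z, 1)) / snd ((base_lift k ^^ n) (z, 1)) \<in> Q"
    using base_lift_transitive[OF k_facts(3,2) D(1,2) Q(1,2), of j] by blast
  define X where "X = fst ((base_lift k ^^ n) (z, 1))"
  define Y where "Y = snd ((base_lift k ^^ n) (z, 1))"
  define c where "c = proj (z, 1, 0)"
  have cA: "c \<in> A" unfolding c_def by (rule line_in_A) (simp add: zero_prod_def)
  have u: "(f ^^ j) c \<in> U" using funpow_A[OF cA, of j] D(3)[OF nz(2), of 0] W(2) by (simp add: c_def)
  define t where "t = snd (snd ((F ^^ n) (z, 1, 0)))"
  have Fn: "(F ^^ n) (z, 1, 0) = (X, Y, t)"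
    using F_funpow[of n "(z, 1, 0)"] by (simp add: prod_eq_iff X_def Y_def t_def)
  have fn: "(f ^^ n) c = proj (X, Y, t)"
    unfolding c_def using induced_funpow_proj[OF F_homogeneous, of "(z, 1, 0)" n] by (simp add: Fn zero_prod_def)
  have Y0: "Y \<noteq> 0" using nz(3) by (simp add: Y_def)
  have "norm t \<le> 300 * norm (X, Y)"
    using F_funpow_trap[of 0 z 1 n] by (simp add: t_def X_def Y_def)
  moreover have "norm (X, Y) = norm Y * norm (X / Y, 1 :: complex)"
    using norm_smult_pair[of Y "X / Y" 1] Y0 by simp
  ultimately have "norm (t / Y) \<le> 300 * norm (X / Y, 1 :: complex)"
    using Y0 by (simp add: norm_divide field_simps)
  then have "(f ^^ i) (proj (X / Y, 1, t / Y)) \<in> W2" using Q(3) nz(4) by (simp add: X_def Y_def)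
  moreover have "proj (X / Y, 1, t / Y) = (f ^^ n) c"
    using proj_smult3[OF Y0, of "(X / Y, 1, t / Y)"] Y0 by (simp add: fn)
  ultimately have "(f ^^ i) ((f ^^ n) c) \<in> V" using W(4) funpow_A[OF funpow_A[OF cA]] by auto
  moreover have "(f ^^ i) ((f ^^ n) c) = (f ^^ (i + (n - j))) ((f ^^ j) c)"
  proof -
    have "(f ^^ (i + (n - j))) ((f ^^ j) c) = (f ^^ (i + (n - j) + j)) c" by (simp only: funpow_add o_apply)
    also have "i + (n - j) + j = i + n" using nz(1) by simp
    finally show ?thesis by (simp only: funpow_add o_apply)
  qed
  ultimately show "\<exists>m. (f ^^ m) ` U \<inter> V \<noteq> {}" using u by (intro exI[of _ "i + (n - j)"]) auto
qed

section \<open>Holomorphy, properness and the curve in the interior\<close>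

lemma holo_endo: "holo_endo_deg k f"
proof -
  have u: "hpoly 1 (\<lambda>v. fst (snd v) + \<i> * fst v)" and w: "hpoly 1 (\<lambda>v. fst (snd v) - \<i> * fst v)"
    using hpoly_linear[of \<i> 1 0] hpoly_linear[of "-\<i>" 1 0] by (simp_all add: algebra_simps)
  have "(\<lambda>v :: c3. 7/10 * \<i> * fst v + 7/10 * fst (snd v) + 1 * snd (snd v)) =
      (\<lambda>v. snd (snd v) + 7/10 * (fst (snd v) + \<i> * fst v))"
    by (rule ext) (simp add: field_simps)
  then have T: "hpoly 1 (\<lambda>v. snd (snd v) + 7/10 * (fst (snd v) + \<i> * fst v))"
    using hpoly_linear[of "7/10 * \<i>" "7/10" 1] by metis
  have 0: "hpoly k (\<lambda>v. (fst (snd v) + \<i> * fst v) ^ k)" by (rule hpoly_power[OF u])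
  have 1: "hpoly k (\<lambda>v. (fst (snd v) - \<i> * fst v) ^ k)" by (rule hpoly_power[OF w])
  have "hpoly (11 + (k - 12) + 1) (\<lambda>v. (7/10 * (fst (snd v) - \<i> * fst v) ^ 11) *
     ((fst (snd v) - \<i> * fst v) ^ (k - 12) + (fst (snd v) + \<i> * fst v) ^ (k - 12)) *
     (snd (snd v) + 7/10 * (fst (snd v) + \<i> * fst v)))"
    by (rule hpoly_mult[OF hpoly_mult[OF hpoly_cmult[OF hpoly_power[OF w]] hpoly_add[OF hpoly_power[OF w] hpoly_power[OF u]]] T])
  moreover have "11 + (k - 12) + 1 = k" using k_facts by simp
  ultimately have "hpoly k (\<lambda>v. (7/10 * (fst (snd v) - \<i> * fst v) ^ 11) *
     ((fst (snd v) - \<i> * fst v) ^ (k - 12) + (fst (snd v) + \<i> * fst v) ^ (k - 12)) *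
     (snd (snd v) + 7/10 * (fst (snd v) + \<i> * fst v)) +
     of_real \<delta> * (snd (snd v) + 7/10 * (fst (snd v) + \<i> * fst v)) ^ k)"
    using hpoly_add[OF _ hpoly_cmult[OF hpoly_power[OF T, of k], of "of_real \<delta>"]] by simp
  then have 2: "hpoly k (\<lambda>v. fibre_map (fst v) (fst (snd v)) (snd (snd v)))" by (simp add: fibre_map_def fibre_slope_def)
  obtain F0 F1 F2 where "\<And>v. heval k F0 v = (fst (snd v) + \<i> * fst v) ^ k" 
      "\<And>v. heval k F1 v = (fst (snd v) - \<i> * fst v) ^ k"
      "\<And>v. heval k F2 v = fibre_map (fst v) (fst (snd v)) (snd (snd v))"
    using 0 1 2 unfolding hpoly_def by blast
  then have "(heval k F0 v, heval k F1 v, heval k F2 v) = F v" for v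
    by (simp add: F_def base_lift_def)
  moreover have "F v \<noteq> 0 \<and> f (proj v) = proj (F v)" if "v \<noteq> 0" for v
    using that F_homogeneous induced_proj[OF F_homogeneous that] by (simp add: homogeneous_def del: split_paired_All)
  ultimately show ?thesis unfolding holo_endo_deg_def
    by (intro exI[of _ F0] exI[of _ F1] exI[of _ F2]) (simp del: split_paired_All)
qed

lemma A_proper: "A \<noteq> UNIV"
proof -
  have "(0, 0, 1) \<notin> disc_bundle 300" by (simp add: disc_bundle_def zero_prod_def[symmetric])
  then have "proj (0, 0, 1) \<notin> A"
    using A_subset proj_in_disc_bundle_iff[of "(0, 0, 1)" 300] by (auto simp: zero_prod_def)
  then show ?thesis by blast
qed

lemma line_algebraic: "algebraic_curve {proj v | v. v \<noteq> 0 \<and> snd (snd v) = 0}"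
  unfolding algebraic_curve_def
proof (intro exI conjI)
  let ?P = "\<lambda>m. if m = (0, 0, 1) then 1 else 0"
  show "(1 :: nat) \<ge> 1" by simp
  show "\<exists>m\<in>hmonos 1. ?P m \<noteq> (0 :: complex)" by (intro bexI[of _ "(0, 0, 1)"]) (auto simp: hmonos_def)
  have "heval 1 ?P v = snd (snd v)" for v using heval_indicator[of 0 0 1 1 v] by simp
  then show "{proj v | v. v \<noteq> 0 \<and> snd (snd v) = 0} = {proj v | v. v \<noteq> 0 \<and> heval 1 ?P v = 0}" by simp
qed

lemma line_subset_interior: "{proj v | v. v \<noteq> 0 \<and> snd (snd v) = 0} \<subseteq> interior A"
proof -
  obtain r where r: "r > 0" "proj ` disc_bundle r \<subseteq> A" using line_interior by blast
  have "{proj v | v. v \<noteq> 0 \<and> snd (snd v) = 0} \<subseteq> proj ` disc_bundle r"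
    using r(1) by (auto simp: disc_bundle_def zero_prod_def)
  also have "\<dots> \<subseteq> interior A" using r(2) open_proj_disc_bundle by (rule interior_maximal)
  finally show ?thesis .
qed

end

theorem theorem1p4:
  shows "\<exists>(f :: cp2 \<Rightarrow> cp2) d A C. d \<ge> 2 \<and> holo_endo_deg d f \<and>
           attractor f A \<and> A \<noteq> UNIV \<and> algebraic_curve C \<and> C \<subseteq> interior A"
proof -
  obtain l :: nat where l: "l \<ge> 900" by blast
  \<comment> \<open>The largest value that the smallness condition permits.\<close>
  define \<delta> :: real where "\<delta> = 1 / (1000 * real (12 * l) * 301 ^ (12 * l))"
  have "fibred_map l \<delta>" using l by unfold_locales (auto simp: \<delta>_def)
  then interpret fibred_map l \<delta> .
  show ?thesis
    using k_facts holo_endo attracting_set_A transitive_A A_proper line_algebraic line_subset_interior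
    by (intro exI[of _ f] exI[of _ k] exI[of _ A] exI[of _ "{proj v | v. v \<noteq> 0 \<and> snd (snd v) = 0}"])
       (auto simp: attractor_def)
qed

end
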